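(* Let $L\subset\mathbb{A}\times I$ be an oriented link with $k$ components. Then the homology $Kh^{\mathbb{A}}_{\alpha\mathcal{D}}(L)$ is a free $R_{\alpha\mathcal{D}}$-module of rank $2^k$.
   Context: **Frobenius algebra.** $R_\alpha=\mathbb{Z}[\alpha_0,\alpha_1]$; $A_\alpha=R_\alpha[X]/((X-\alpha_0)(X-\alpha_1))$, a Frobenius algebra over $R_\alpha$ with trace $\varepsilon_\alpha(1)=0$, $\varepsilon_\alpha(X)=1$ and comultiplication $\Delta(1)=(X-\alpha_0)\otimes1+1\otimes(X-\alpha_1)$, $\Delta(X)=X\otimes X-\alpha_0\alpha_1\,1\otimes1$. Let $\mathcal{D}=(\alpha_0-\alpha_1)^2$ and $R_{\alpha\mathcal{D}}=R_\alpha[\mathcal{D}^{-1}]$. $\mathcal{F}_\alpha$ is the TQFT of $A_\alpha$ on cobordisms in $\mathbb{R}^2\times I$: a collection of circles goes to the tensor product over $R_\alpha$ of one copy of $A_\alpha$ per circle; cup, cap, merge and split go to unit, trace, multiplication and comultiplication; a dot goes to multiplication by $X$. **Annular TQFT.** $I=[0,1]$; $\mathbb{A}=S^1\times I$ is embedded in $\mathbb{R}^2$ as $\{x:1\le|x|\le2\}$. Circles in $\mathbb{A}$ are trivial if contractible in $\mathbb{A}$, and essential otherwise. For a collection $\mathscr{C}\subset\mathbb{A}$ of disjoint circles, order the essential ones from innermost to outermost. Give $\mathcal{F}_\alpha(\mathscr{C})$ the grading $\mathrm{adeg}$, additive over tensor factors with $R_\alpha$ in degree $0$: trivial circle factors are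 in annular degree $0$; the factor of the $i$-th essential circle has homogeneous basis $\{1,X-\alpha_0\}$ ($i$ odd) or $\{1,X-\alpha_1\}$ ($i$ even), the first element in annular degree $-1$ and the second in annular degree $1$. For a cobordism $S\subset\mathbb{A}\times I$, $\mathcal{F}_\alpha(S)$ is the sum of an $\mathrm{adeg}$-preserving map $\mathcal{F}_\alpha(S)_0$ and a map strictly increasing $\mathrm{adeg}$. The equivariant annular TQFT is $\mathcal{G}_\alpha(\mathscr{C})=\mathcal{F}_\alpha(\mathscr{C})$, $\mathcal{G}_\alpha(S)=\mathcal{F}_\alpha(S)_0$; it is functorial. $\mathcal{G}_{\alpha\mathcal{D}}=\mathcal{G}_\alpha\otimes_{R_\alpha}R_{\alpha\mathcal{D}}$. **Complex and homology.** Let $D\subset\mathbb{A}$ be a diagram of $L$ (projection to $\mathbb{A}$) with crossings $1,\dots,n$, of which $n_+$ are positive and $n_-$ negative. Each crossing has a $0$-smoothing and a $1$-smoothing in the standard Khovanov convention: the $0$-smoothing of a positive crossing and the $1$-smoothing of a negative crossing are the orientation-consistent ones. For $u\in\{0,1\}^n$ let $D_u$ be the resulting collection of circles and $|u|=\sum_iu_i$. The formal complex $[[D]]$ has $[[D]]^i=\bigoplus_{|u|=i+n_-}D_u\{n_--n_+-i\}$ ($\{\cdot\}$ a quantum grading shift) and differential with components $(-1)^{s_{u,v}}d_{u,v}$, where for $u,v$ differing in one entry ($0$ in $u$, $1$ in $v$) $d_{u,v}$ is the saddle cobordism $D_u\to D_v$ near that crossing (product elsewhere), and $s_{u,v}\in\{0,1\}$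 is a sign assignment making the cube anticommute. Set $CKh^{\mathbb{A}}_{\alpha\mathcal{D}}(D)=\mathcal{G}_{\alpha\mathcal{D}}([[D]])$. Up to chain homotopy equivalence it does not depend on the diagram $D$ of $L$; $Kh^{\mathbb{A}}_{\alpha\mathcal{D}}(L)$ denotes its (total) homology, for any diagram $D$ of $L$. *)

theory Defs
  imports
    "HOL-Computational_Algebra.Polynomial"
    "HOL-Computational_Algebra.Fraction_Field"
    "HOL-Algebra.Module"
    "HOL-Algebra.AbelCoset"
begin

section \<open>Diagrams in the annulus\<close>

text \<open>
  Every link diagram in the annulus can be brought, by a planar isotopy of the annulus, into general
  position with respect to the angular coordinate: finitely many rays, one of which is the base ray
  at angle 0, cut the annulus into sectors each of which contains at most one crossing or critical
  point of the angle. A pair \<open>(n, ls)\<close> records such a diagram: \<open>n\<close> is the number of points on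
  the base ray, and \<open>ls\<close> lists the sectors counterclockwise. Points on a ray are numbered
  \<open>0, 1, 2, \<dots>\<close> from the inner to the outer boundary of the annulus. The layers, read
  counterclockwise, are: no event; a new pair of adjacent points at positions \<open>i, i + 1\<close> (\<open>Cup\<close>);
  the points \<open>i, i + 1\<close> joined (\<open>Cap\<close>); a crossing of the strands at \<open>i, i + 1\<close> (\<open>Cross\<close>).
  \<open>CapCup i\<close> is \<open>Cap i\<close> followed by \<open>Cup i\<close>; with it and \<open>Straight\<close>, smoothing a crossing
  replaces one layer by one layer. In \<open>Cross i b\<close> the strand that moves outwards, from \<open>i\<close> to
  \<open>i + 1\<close>, is the overstrand if \<open>b\<close> and the understrand if \<open>\<not> b\<close>.
  Diagrams without \<open>Cross\<close> layers are collections of disjoint circles in the annulus.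
\<close>

datatype layer = Straight | Cup nat | Cap nat | CapCup nat | Cross nat bool

type_synonym diagram = "nat \<times> layer list"

fun top_width :: "layer \<Rightarrow> nat \<Rightarrow> nat" where
  "top_width (Cup i) n = n + 2"
| "top_width (Cap i) n = n - 2"
| "top_width _ n = n"

fun admissible :: "layer \<Rightarrow> nat \<Rightarrow> bool" where
  "admissible Straight n \<longleftrightarrow> True"
| "admissible (Cup i) n \<longleftrightarrow> i \<le> n"
| "admissible (Cap i) n \<longleftrightarrow> i + 2 \<le> n"
| "admissible (CapCup i) n \<longleftrightarrow> i + 2 \<le> n"
| "admissible (Cross i b) n \<longleftrightarrow> i + 2 \<le> n"

definition layers :: "diagram \<Rightarrow> layer list" where
  "layers D = snd D"

definition width :: "diagram \<Rightarrow> nat \<Rightarrow> nat" where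
  "width D j = fold top_width (take j (layers D)) (fst D)"

definition annular_diagram :: "diagram \<Rightarrow> bool" where
  "annular_diagram D \<longleftrightarrow>
     (\<forall>j < length (layers D). admissible (layers D ! j) (width D j)) \<and>
     width D (length (layers D)) = fst D"

text \<open>
  The point \<open>(j, a)\<close> is the point at position \<open>a\<close> on the ray before layer \<open>j\<close>. Once around the
  annulus, level \<open>length (layers D)\<close> is level \<open>0\<close> again; its points are kept as separate names and
  are joined to those of level \<open>0\<close> in \<open>straight_arcs\<close> below.
\<close>

type_synonym point = "nat \<times> nat"

definition points :: "diagram \<Rightarrow> point set" where
  "points D = {(j, a). j \<le> length (layers D) \<and> a < width D j}"

text \<open>Arcs crossing a layer of bottom width \<open>n\<close>, as pairs (bottom position, top position).\<close>

fun through :: "layer \<Rightarrow> nat \<Rightarrow> (nat \<times> nat) set" where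
  "through Straight n = {(a, a) | a. a < n}"
| "through (Cup i) n = {(a, a) | a. a < i} \<union> {(a, a + 2) | a. i \<le> a \<and> a < n}"
| "through (Cap i) n = {(a, a) | a. a < i} \<union> {(a + 2, a) | a. i \<le> a \<and> a + 2 < n}"
| "through (CapCup i) n = {(a, a) | a. a < n \<and> a \<noteq> i \<and> a \<noteq> i + 1}"
| "through (Cross i b) n = {(a, a) | a. a < n \<and> a \<noteq> i \<and> a \<noteq> i + 1} \<union> {(i, i + 1), (i + 1, i)}"

text \<open>Arcs turning back to the bottom, respectively to the top, of a layer.\<close>

fun bottom_turns :: "layer \<Rightarrow> (nat \<times> nat) set" where
  "bottom_turns (Cap i) = {(i, i + 1)}"
| "bottom_turns (CapCup i) = {(i, i + 1)}"
| "bottom_turns _ = {}"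

fun top_turns :: "layer \<Rightarrow> (nat \<times> nat) set" where
  "top_turns (Cup i) = {(i, i + 1)}"
| "top_turns (CapCup i) = {(i, i + 1)}"
| "top_turns _ = {}"

definition straight_arcs :: "diagram \<Rightarrow> (point \<times> point) set" where
  "straight_arcs D =
     {((j, a), (Suc j, b)) | j a b.
        j < length (layers D) \<and> (a, b) \<in> through (layers D ! j) (width D j)} \<union>
     {((length (layers D), a), (0, a)) | a. a < fst D}"

definition turning_arcs :: "diagram \<Rightarrow> (point \<times> point) set" where
  "turning_arcs D =
     {((j, a), (j, b)) | j a b.
        j < length (layers D) \<and> (a, b) \<in> bottom_turns (layers D ! j)} \<union>
     {((Suc j, a), (Suc j, b)) | j a b.
        j < length (layers D) \<and> (a, b) \<in> top_turns (layers D ! j)}"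

definition connected_by :: "diagram \<Rightarrow> (point \<times> point) set" where
  "connected_by D =
     (let E = straight_arcs D \<union> turning_arcs D in (E \<union> E\<inverse>)\<^sup>*)"

text \<open>
  The link components of a diagram (strands go straight through crossings). For a diagram without
  crossings these are its circles.
\<close>

definition components :: "diagram \<Rightarrow> point set set" where
  "components D = points D // connected_by D"

definition component_of :: "diagram \<Rightarrow> point \<Rightarrow> point set" where
  "component_of D p = connected_by D `` {p}"

text \<open>
  An orientation tells for each point whether the strand passes it counterclockwise
  (\<open>True\<close>) or clockwise (\<open>False\<close>).
\<close>

definition orientation :: "diagram \<Rightarrow> (point \<Rightarrow> bool) \<Rightarrow> bool" where
  "orientation D ori \<longleftrightarrow>
     (\<forall>(p, q) \<in> straight_arcs D. ori p = ori q) \<and>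
     (\<forall>(p, q) \<in> turning_arcs D. ori p \<noteq> ori q)"

text \<open>
  A closed curve in the annulus is contractible iff its class in
  \<open>\<pi>\<^sub>1 = \<int>\<close>, its signed number of intersections with the base ray, is zero.
\<close>

definition winding :: "(point \<Rightarrow> bool) \<Rightarrow> point set \<Rightarrow> int" where
  "winding ori c = (\<Sum>p \<in> {p \<in> c. fst p = 0}. if ori p then 1 else - 1)"

definition essential :: "diagram \<Rightarrow> point set \<Rightarrow> bool" where
  "essential D c \<longleftrightarrow> (\<exists>ori. orientation D ori \<and> winding ori c \<noteq> 0)"

definition essential_circles :: "diagram \<Rightarrow> point set set" where
  "essential_circles D = {c \<in> components D. essential D c}"

text \<open>
  Going outwards along the base ray, one meets an essential circle only after all essential circles
  inside it. So the essential circles are ordered from innermost to outermost by their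
  first points on the ray. The innermost one has index \<open>1\<close>.
\<close>

definition first_position :: "point set \<Rightarrow> nat" where
  "first_position c = (LEAST a. (0, a) \<in> c)"

definition essential_index :: "diagram \<Rightarrow> point set \<Rightarrow> nat" where
  "essential_index D c =
     card {c' \<in> essential_circles D. first_position c' \<le> first_position c}"


section \<open>Crossings and smoothings\<close>

definition crossings :: "diagram \<Rightarrow> nat set" where
  "crossings D = {j. j < length (layers D) \<and> (\<exists>i b. layers D ! j = Cross i b)}"

text \<open>
  A vertex of the cube is given by the set \<open>u\<close> of crossings that are \<open>1\<close>-smoothed. If both strands
  of \<open>Cross i b\<close> run counterclockwise, the oriented smoothing is \<open>Straight\<close>, and the crossing is
  positive iff \<open>b\<close> holds (with the orientation of the plane given by outward direction,
  counterclockwise direction). Hence \<open>Straight\<close> is the \<open>0\<close>-smoothing iff \<open>b\<close>.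
\<close>

fun smooth_layer :: "bool \<Rightarrow> layer \<Rightarrow> layer" where
  "smooth_layer w (Cross i b) = (if b = (\<not> w) then Straight else CapCup i)"
| "smooth_layer w l = l"

definition smoothing :: "diagram \<Rightarrow> nat set \<Rightarrow> diagram" where
  "smoothing D u =
     (fst D, map (\<lambda>j. smooth_layer (j \<in> u) (layers D ! j)) [0..<length (layers D)])"

text \<open>
  If exactly one strand of \<open>Cross i b\<close> is reversed, the sign of the crossing changes.
\<close>

definition positive_crossings :: "diagram \<Rightarrow> (point \<Rightarrow> bool) \<Rightarrow> nat set" where
  "positive_crossings D ori =
     {j. j < length (layers D) \<and>
         (\<exists>i b. layers D ! j = Cross i b \<and> b = (ori (j, i) = ori (j, i + 1)))}"

definition negative_crossings :: "diagram \<Rightarrow> (point \<Rightarrow> bool) \<Rightarrow> nat set" where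
  "negative_crossings D ori = crossings D - positive_crossings D ori"

text \<open>
  The squares of the cube of cobordisms commute, so the signed squares anticommute iff the exponents
  on each square have odd sum.
\<close>

definition sign_assignment :: "diagram \<Rightarrow> (nat set \<Rightarrow> nat set \<Rightarrow> nat) \<Rightarrow> bool" where
  "sign_assignment D s \<longleftrightarrow>
     (\<forall>u j. u \<subseteq> crossings D \<and> j \<in> crossings D - u \<longrightarrow> s u (insert j u) \<in> {0, 1}) \<and>
     (\<forall>u i j. u \<subseteq> crossings D \<and> i \<in> crossings D - u \<and> j \<in> crossings D - u \<and> i \<noteq> j \<longrightarrow>
        odd (s u (insert i u) + s (insert i u) (insert j (insert i u)) +
             s u (insert j u) + s (insert j u) (insert j (insert i u))))"


section \<open>The Frobenius algebra\<close>

text \<open>\<open>R\<^sub>\<alpha> = \<int>[\<alpha>\<^sub>0][\<alpha>\<^sub>1]\<close>\<close>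

type_synonym R_alpha = "int poly poly"

definition alpha0 :: R_alpha where "alpha0 = [:[:0, 1:]:]"

definition alpha1 :: R_alpha where "alpha1 = [:0, 1:]"

text \<open>
  An element \<open>(a, b)\<close> stands for the residue class of \<open>a + b X\<close> in
  \<open>R\<^sub>\<alpha>[X] / ((X - \<alpha>\<^sub>0) (X - \<alpha>\<^sub>1))\<close>; products are reduced by
  \<open>X\<^sup>2 = (\<alpha>\<^sub>0 + \<alpha>\<^sub>1) X - \<alpha>\<^sub>0 \<alpha>\<^sub>1\<close>.
\<close>

type_synonym A_alpha = "R_alpha \<times> R_alpha"

definition A_one :: A_alpha where "A_one = (1, 0)"

definition A_X :: A_alpha where "A_X = (0, 1)"

fun A_mult :: "A_alpha \<Rightarrow> A_alpha \<Rightarrow> A_alpha" where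
  "A_mult (a, b) (c, d) =
     (a * c - alpha0 * alpha1 * (b * d), a * d + b * c + (alpha0 + alpha1) * (b * d))"

lemma A_relation: "A_mult (- alpha0, 1) (- alpha1, 1) = (0, 0)"
  by simp

text \<open>
  An element \<open>t\<close> of \<open>A\<^sub>\<alpha> \<otimes> A\<^sub>\<alpha>\<close> is given by its coefficients in the basis
  \<open>1 \<otimes> 1, 1 \<otimes> X, X \<otimes> 1, X \<otimes> X\<close>: \<open>t k l\<close> is the coefficient of \<open>X\<^sup>k \<otimes> X\<^sup>l\<close>
  with \<open>False\<close> for exponent \<open>0\<close> and \<open>True\<close> for exponent \<open>1\<close>. The two defining equations are
  \<open>\<Delta>(1) = (X - \<alpha>\<^sub>0) \<otimes> 1 + 1 \<otimes> (X - \<alpha>\<^sub>1)\<close> and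
  \<open>\<Delta>(X) = X \<otimes> X - \<alpha>\<^sub>0 \<alpha>\<^sub>1 1 \<otimes> 1\<close>.
\<close>

definition A_comult_one :: "bool \<Rightarrow> bool \<Rightarrow> R_alpha" where
  "A_comult_one k l =
     (if k \<and> l then 0 else if k \<or> l then 1 else - alpha0 - alpha1)"

definition A_comult_X :: "bool \<Rightarrow> bool \<Rightarrow> R_alpha" where
  "A_comult_X k l =
     (if k \<and> l then 1 else if k \<or> l then 0 else - (alpha0 * alpha1))"

definition A_comult :: "A_alpha \<Rightarrow> bool \<Rightarrow> bool \<Rightarrow> R_alpha" where
  "A_comult x k l = fst x * A_comult_one k l + snd x * A_comult_X k l"

text \<open>
  The basis \<open>{1, X - r}\<close> of \<open>A\<^sub>\<alpha>\<close> (\<open>False\<close> for \<open>1\<close>, \<open>True\<close> for \<open>X - r\<close>) and the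
  coordinates with respect to it: \<open>a + b X = (a + b r) + b (X - r)\<close>.
\<close>

definition basis_elem :: "R_alpha \<Rightarrow> bool \<Rightarrow> A_alpha" where
  "basis_elem r e = (if e then (- r, 1) else A_one)"

definition coord :: "R_alpha \<Rightarrow> A_alpha \<Rightarrow> bool \<Rightarrow> R_alpha" where
  "coord r x e = (if e then snd x else fst x + snd x * r)"

definition coord2 ::
  "R_alpha \<Rightarrow> R_alpha \<Rightarrow> (bool \<Rightarrow> bool \<Rightarrow> R_alpha) \<Rightarrow> bool \<Rightarrow> bool \<Rightarrow> R_alpha" where
  "coord2 r1 r2 t e1 e2 =
     (\<Sum>k \<in> UNIV. \<Sum>l \<in> UNIV.
        t k l * coord r1 (if k then A_X else A_one) e1 * coord r2 (if l then A_X else A_one) e2)"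


section \<open>The annular TQFT on the cube of resolutions\<close>

text \<open>
  \<open>\<F>\<^sub>\<alpha>\<close> of a collection of circles is the free \<open>R\<^sub>\<alpha>\<close>-module on the tensor products of the basis
  elements \<open>1, X - r\<close> of the factors, where \<open>r\<close> is \<open>circle_root\<close> of the circle. Such a product is
  given by the set of circles with label \<open>X - r\<close>. Trivial circles lie in annular degree \<open>0\<close>, and
  they get the basis \<open>{1, X}\<close>.
\<close>

definition circle_root :: "diagram \<Rightarrow> point set \<Rightarrow> R_alpha" where
  "circle_root C c =
     (if \<not> essential C c then 0 else if odd (essential_index C c) then alpha0 else alpha1)"

definition adeg :: "diagram \<Rightarrow> point set set \<Rightarrow> int" where
  "adeg C x = (\<Sum>c \<in> essential_circles C. if c \<in> x then 1 else - 1)"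

text \<open>
  Matrix entry of \<open>\<F>\<^sub>\<alpha>\<close> of the saddle at the crossing \<open>j\<close>, from the basis element \<open>x\<close> at \<open>u\<close>
  to the basis element \<open>y\<close> at \<open>insert j u\<close>. For either smoothing of the crossing, the points
  \<open>(j, i)\<close> and \<open>(Suc j, i + 1)\<close> lie on the two different local arcs of the smoothing. Hence if their
  circles differ at \<open>u\<close>, the saddle merges these two circles; otherwise it splits the one
  circle. All other circles are the same sets of points at \<open>u\<close> and at \<open>insert j u\<close>, and
  the map is the identity on their factors, written in the bases that belong to \<open>u\<close> and
  \<open>insert j u\<close>.
\<close>

definition F_saddle ::
  "diagram \<Rightarrow> nat \<Rightarrow> nat set \<Rightarrow> point set set \<Rightarrow> point set set \<Rightarrow> R_alpha" where
  "F_saddle D j u x y =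
     (let C = smoothing D u; C' = smoothing D (insert j u);
          i = (THE i. \<exists>b. layers D ! j = Cross i b);
          p = (j, i); q = (Suc j, i + 1);
          a1 = component_of C p; a2 = component_of C q;
          b1 = component_of C' p; b2 = component_of C' q
      in (\<Prod>c \<in> components C - {a1, a2}.
            coord (circle_root C' c) (basis_elem (circle_root C c) (c \<in> x)) (c \<in> y)) *
         (if a1 \<noteq> a2
          then coord (circle_root C' b1)
                 (A_mult (basis_elem (circle_root C a1) (a1 \<in> x))
                         (basis_elem (circle_root C a2) (a2 \<in> x)))
                 (b1 \<in> y)
          else coord2 (circle_root C' b1) (circle_root C' b2)
                 (A_comult (basis_elem (circle_root C a1) (a1 \<in> x)))
                 (b1 \<in> y) (b2 \<in> y)))"

text \<open>The part of \<open>\<F>\<^sub>\<alpha>\<close> of the saddle that preserves the annular degree.\<close>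

definition G_saddle ::
  "diagram \<Rightarrow> nat \<Rightarrow> nat set \<Rightarrow> point set set \<Rightarrow> point set set \<Rightarrow> R_alpha" where
  "G_saddle D j u x y =
     (if adeg (smoothing D u) x = adeg (smoothing D (insert j u)) y
      then F_saddle D j u x y else 0)"


section \<open>The localised ground ring\<close>

type_synonym K_alpha = "R_alpha fract"

definition of_R :: "R_alpha \<Rightarrow> K_alpha" where
  "of_R a = Fract a 1"

definition discr :: R_alpha where
  "discr = (alpha0 - alpha1) ^ 2"

definition R_alphaD :: "K_alpha ring" where
  "R_alphaD =
     \<lparr>carrier = {of_R a / of_R discr ^ m | a m. True},
      mult = (*), one = 1, zero = 0, add = (+)\<rparr>"


section \<open>Modules\<close>

definition submodule_of :: "('a, 'b) module \<Rightarrow> 'b set \<Rightarrow> ('a, 'b) module" where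
  "submodule_of M N = M\<lparr>carrier := N\<rparr>"

text \<open>The ring multiplication and unit in a module record are irrelevant.\<close>

definition quotient_module :: "('a, 'b) module \<Rightarrow> 'b set \<Rightarrow> ('a, 'b set) module" where
  "quotient_module M N =
     \<lparr>carrier = a_rcosets\<^bsub>M\<^esub> N, mult = undefined, one = undefined,
      zero = N, add = (<+>\<^bsub>M\<^esub>),
      smult = (\<lambda>r S. \<Union>x\<in>S. N +>\<^bsub>M\<^esub> (r \<odot>\<^bsub>M\<^esub> x))\<rparr>"

text \<open>For finite \<open>I\<close>, so that the direct sum is the direct product.\<close>

definition direct_sum :: "'i set \<Rightarrow> ('i \<Rightarrow> ('a, 'b) module) \<Rightarrow> ('a, 'i \<Rightarrow> 'b) module" where
  "direct_sum I M =
     \<lparr>carrier = (\<Pi>\<^sub>E i\<in>I. carrier (M i)), mult = undefined, one = undefined,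
      zero = (\<lambda>i\<in>I. \<zero>\<^bsub>M i\<^esub>),
      add = (\<lambda>x y. \<lambda>i\<in>I. x i \<oplus>\<^bsub>M i\<^esub> y i),
      smult = (\<lambda>r x. \<lambda>i\<in>I. r \<odot>\<^bsub>M i\<^esub> x i)\<rparr>"

definition free_of_rank :: "('a, 'r) ring_scheme \<Rightarrow> ('a, 'b) module \<Rightarrow> nat \<Rightarrow> bool" where
  "free_of_rank R M r \<longleftrightarrow>
     Module.module R M \<and>
     (\<exists>b \<in> {..<r} \<rightarrow> carrier M. \<forall>m \<in> carrier M.
        \<exists>!c. c \<in> ({..<r} \<rightarrow>\<^sub>E carrier R) \<and> m = (\<Oplus>\<^bsub>M\<^esub>i\<in>{..<r}. c i \<odot>\<^bsub>M\<^esub> b i))"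


section \<open>The complex and its homology\<close>

text \<open>
  A generator \<open>(u, x)\<close> is a basis element \<open>x\<close> of the module at the vertex \<open>u\<close>. The
  complex in degree \<open>i\<close> is the free \<open>R\<^sub>\<alpha>\<^sub>\<D>\<close>-module on the generators with
  \<open>|u| = i + n\<^sub>-\<close>, so it is nonzero only for \<open>-n\<^sub>- \<le> i \<le> n\<^sub>+\<close>. The quantum grading shifts do not change
  the underlying modules.
\<close>

type_synonym generator = "nat set \<times> point set set"

definition generators :: "diagram \<Rightarrow> (point \<Rightarrow> bool) \<Rightarrow> int \<Rightarrow> generator set" where
  "generators D ori i =
     {(u, x). u \<subseteq> crossings D \<and> int (card u) = i + int (card (negative_crossings D ori)) \<and>
              x \<subseteq> components (smoothing D u)}"

definition CKh :: "diagram \<Rightarrow> (point \<Rightarrow> bool) \<Rightarrow> int \<Rightarrow> (K_alpha, generator \<Rightarrow> K_alpha) module" where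
  "CKh D ori i =
     \<lparr>carrier = {f. (\<forall>g. f g \<in> carrier R_alphaD) \<and> (\<forall>g. g \<notin> generators D ori i \<longrightarrow> f g = 0)},
      mult = undefined, one = undefined,
      zero = (\<lambda>g. 0), add = (\<lambda>f f' g. f g + f' g), smult = (\<lambda>r f g. r * f g)\<rparr>"

definition differential ::
  "diagram \<Rightarrow> (nat set \<Rightarrow> nat set \<Rightarrow> nat) \<Rightarrow> (generator \<Rightarrow> K_alpha) \<Rightarrow> generator \<Rightarrow> K_alpha" where
  "differential D s f =
     (\<lambda>(v, y).
        if v \<subseteq> crossings D \<and> y \<subseteq> components (smoothing D v)
        then (\<Sum>j \<in> v. \<Sum>x \<in> Pow (components (smoothing D (v - {j}))).
                (- 1) ^ s (v - {j}) v * of_R (G_saddle D j (v - {j}) x y) * f (v - {j}, x))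
        else 0)"

definition cycles ::
  "diagram \<Rightarrow> (point \<Rightarrow> bool) \<Rightarrow> (nat set \<Rightarrow> nat set \<Rightarrow> nat) \<Rightarrow> int \<Rightarrow> (generator \<Rightarrow> K_alpha) set" where
  "cycles D ori s i = {f \<in> carrier (CKh D ori i). differential D s f = (\<lambda>g. 0)}"

definition boundaries ::
  "diagram \<Rightarrow> (point \<Rightarrow> bool) \<Rightarrow> (nat set \<Rightarrow> nat set \<Rightarrow> nat) \<Rightarrow> int \<Rightarrow> (generator \<Rightarrow> K_alpha) set" where
  "boundaries D ori s i = differential D s ` carrier (CKh D ori (i - 1))"

definition homology ::
  "diagram \<Rightarrow> (point \<Rightarrow> bool) \<Rightarrow> (nat set \<Rightarrow> nat set \<Rightarrow> nat) \<Rightarrow> int \<Rightarrow>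
     (K_alpha, (generator \<Rightarrow> K_alpha) set) module" where
  "homology D ori s i =
     quotient_module (submodule_of (CKh D ori i) (cycles D ori s i)) (boundaries D ori s i)"

definition Kh ::
  "diagram \<Rightarrow> (point \<Rightarrow> bool) \<Rightarrow> (nat set \<Rightarrow> nat set \<Rightarrow> nat) \<Rightarrow>
     (K_alpha, int \<Rightarrow> (generator \<Rightarrow> K_alpha) set) module" where
  "Kh D ori s =
     direct_sum {- int (card (negative_crossings D ori)) .. int (card (positive_crossings D ori))}
       (homology D ori s)"

end

theory Submission
  imports Defs "HOL-Combinatorics.Orbits"
begin

text \<open>
  Over the localised ring, \<open>X\<close> acts diagonalisably on every circle: the factor of a trivial circle
  splits into the two idempotents of \<open>A\<^sub>\<alpha>\<close>, and in the degree-preserving part of the action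
  the two basis vectors of an essential circle are already eigenvectors. So each vertex of the cube has
  a basis indexed by the colourings of its circles by the two roots. In a suitable scaling, a merge
  sends equal colours to that colour and different colours to \<open>0\<close>, and a split doubles a colour up to
  the unit \<open>\<plusminus>(\<alpha>\<^sub>0 - \<alpha>\<^sub>1)\<close>. Hence the complex is the direct sum, over colourings of
  the points of the diagram, of cubes whose edge maps are units. Such a cube is contractible unless it
  is a single vertex, and that happens exactly if the two arcs at every smoothed crossing have different
  colours. Comparing with the checkerboard colouring, these colourings are the orientations of the
  link, so there are \<open>2\<^sup>k\<close> of them.

  That colours behave in the same way for essential and trivial circles rests on parity counts along
  rays: a circle is essential iff it meets the base ray an odd number of times, and the index of an
  essential circle has the parity of its first position plus one.
\<close>

section \<open>The Frobenius algebra over the localised ring\<close>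

text \<open>The bases in which a saddle is written depend on indices counted over all essential
  circles, and a saddle can change the index of a circle that it does not touch. Only the parity of
  the index enters, and this parity can be read off the points of the circle alone. So untouched
  circles keep their root, and every matrix entry becomes a product of local factors. A second
  obstacle is that a saddle might lead from one circle to one circle. This is excluded because all
  smoothings carry one common orientation, which alternates with the position on the ray, and a
  change of smoothing composes its successor permutation with a transposition. The computations take
  place in the fraction field. They descend to \<open>R_alphaD\<close> because
  \<open>delta k ^ 2\<close> is the discriminant, so that base changes and homotopies have
  coefficients in the localised ring.\<close>

lemma of_R_simps [simp]:
  "of_R 0 = 0" "of_R 1 = 1" "of_R (a + b) = of_R a + of_R b" "of_R (a * b) = of_R a * of_R b"
  "of_R (- a) = - of_R a" "of_R (a - b) = of_R a - of_R b"
  by (simp_all add: of_R_def Zero_fract_def One_fract_def)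

lemma of_R_eq_iff: "of_R a = of_R b \<longleftrightarrow> a = b"
  by (simp add: of_R_def eq_fract)

definition root :: "bool \<Rightarrow> K_alpha" where
  "root k = of_R (if k then alpha1 else alpha0)"

text \<open>The derivative of \<open>(X - \<alpha>0) (X - \<alpha>1)\<close> at the root of colour
  \<open>k\<close>. Its inverse is the trace of the idempotent of that colour.\<close>

definition delta :: "bool \<Rightarrow> K_alpha" where
  "delta k = root k - root (\<not> k)"

lemma root_neq: "root False \<noteq> root True"
  by (simp add: root_def of_R_eq_iff alpha0_def alpha1_def)

lemma delta_nonzero [simp]: "delta k \<noteq> 0"
  using root_neq by (cases k) (auto simp: delta_def)

definition deg :: "bool option \<Rightarrow> bool \<Rightarrow> int" where
  "deg t z = (if t = None then 0 else if z then 1 else - 1)"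

definition type_root :: "bool option \<Rightarrow> R_alpha" where
  "type_root t = (case t of None \<Rightarrow> 0 | Some m \<Rightarrow> if m then alpha1 else alpha0)"

text \<open>
  The type of a circle is \<open>None\<close> if it is trivial, \<open>Some False\<close> for an essential circle of odd
  index (root \<open>\<alpha>\<^sub>0\<close>) and \<open>Some True\<close> for one of even index (root \<open>\<alpha>\<^sub>1\<close>).
  The colour \<open>k\<close> stands for the eigenvalue \<open>root k\<close> of \<open>X\<close>. On a trivial circle, \<open>vec None k\<close>
  is the idempotent \<open>(X - root (\<not> k)) / delta k\<close>. On an essential circle with root \<open>root m\<close>, the
  vector \<open>1\<close> has colour \<open>m\<close> and \<open>X - root m\<close> has colour \<open>\<not> m\<close>; dividing the latter by
  \<open>delta\<close> turns all merge coefficients into \<open>1\<close>. The inverse base change is \<open>covec\<close>.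
\<close>

definition vec :: "bool option \<Rightarrow> bool \<Rightarrow> bool \<Rightarrow> K_alpha" where
  "vec t k z = (case t of
     None \<Rightarrow> if z then 1 / delta k else - root (\<not> k) / delta k
   | Some m \<Rightarrow> if k = m then if z then 0 else 1 else if z then 1 / delta k else 0)"

definition covec :: "bool option \<Rightarrow> bool \<Rightarrow> bool \<Rightarrow> K_alpha" where
  "covec t z k = (case t of
     None \<Rightarrow> if z then root k else 1
   | Some m \<Rightarrow> if k = m then if z then 0 else 1 else if z then delta k else 0)"

text \<open>The identities below are rational in one root and the difference of the two roots. With
  everything expressed by \<open>r\<close> and \<open>e\<close>, the only side condition for
  clearing denominators is \<open>e \<noteq> 0\<close>.\<close>

lemma root_delta:
  obtains r e where "root True = r" "root False = r + e" "delta True = - e" "delta False = e" "e \<noteq> 0"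
  by (rule that[of "root True" "delta False"]) (simp_all add: delta_def root_neq)

text \<open>On a trivial circle the sum evaluates the Lagrange polynomial
  \<open>(X - root (\<not> k)) / delta k\<close> at \<open>root k'\<close>. On an essential circle
  both factors are diagonal up to the relabelling of basis vectors by colours.\<close>

lemma vec_covec: "(\<Sum>z\<in>UNIV. vec t k z * covec t z k') = of_bool (k = k')"
proof -
  have "root k' - root (\<not> k) = (if k = k' then delta k else 0)"
    by (cases k; cases k') (auto simp: delta_def)
  then show ?thesis
    by (cases t) (auto simp: UNIV_bool vec_def covec_def field_simps)
qed

lemma covec_vec: "(\<Sum>k\<in>UNIV. covec t z k * vec t k z') = of_bool (z = z')"
proof -
  obtain r e where "root True = r" "root False = r + e" "delta True = - e" "delta False = e" "e \<noteq> 0"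
    by (rule root_delta)
  then show ?thesis
    unfolding UNIV_bool vec_def covec_def
    by (cases t; cases z; cases z') (auto simp: field_simps)
qed

text \<open>The truncation to equal annular degree is imposed on the circles of the saddle alone. It
  agrees with the global condition because untouched circles keep type and label, so that their
  degrees cancel.\<close>

definition merge_entry :: "bool option \<Rightarrow> bool option \<Rightarrow> bool option \<Rightarrow> bool \<Rightarrow> bool \<Rightarrow> bool \<Rightarrow> K_alpha" where
  "merge_entry t1 t2 t z1 z2 y = (if deg t1 z1 + deg t2 z2 = deg t y
     then of_R (coord (type_root t) (A_mult (basis_elem (type_root t1) z1) (basis_elem (type_root t2) z2)) y)
     else 0)"

definition split_entry :: "bool option \<Rightarrow> bool option \<Rightarrow> bool option \<Rightarrow> bool \<Rightarrow> bool \<Rightarrow> bool \<Rightarrow> K_alpha" where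
  "split_entry t t1 t2 z y1 y2 = (if deg t z = deg t1 y1 + deg t2 y2
     then of_R (coord2 (type_root t1) (type_root t2) (A_comult (basis_elem (type_root t) z)) y1 y2)
     else 0)"

text \<open>The possible types of two circles and of the circle obtained by merging them.\<close>

definition fuse :: "bool option \<Rightarrow> bool option \<Rightarrow> bool option \<Rightarrow> bool" where
  "fuse t1 t2 t \<longleftrightarrow> t1 = None \<and> t = t2 \<or> t2 = None \<and> t = t1 \<or>
    (\<exists>m. t1 = Some m \<and> t2 = Some (\<not> m) \<and> t = None)"

lemma fuse_cases:
  assumes "fuse t1 t2 t"
  obtains "t1 = None" "t2 = None" "t = None"
  | m where "t1 = None" "t2 = Some m" "t = Some m"
  | m where "t1 = Some m" "t2 = None" "t = Some m"
  | m where "t1 = Some m" "t2 = Some (\<not> m)" "t = None"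
  using assms unfolding fuse_def by (cases t1; cases t2) auto

text \<open>Two trivial circles: the idempotents are orthogonal. One essential circle of type
  \<open>m\<close>: the truncated action of \<open>X\<close> has eigenvalue \<open>root m\<close> on
  \<open>1\<close> and \<open>root (\<not> m)\<close> on \<open>X - root m\<close>. Two essential
  circles have opposite types, so vectors of different colours have total degree \<open>2\<close> or
  \<open>-2\<close> and die in the trivial circle, while those of equal colour have total degree
  \<open>0\<close> and multiply to the idempotent.\<close>

lemma merge_vec:
  assumes "fuse t1 t2 t"
  shows "(\<Sum>z1\<in>UNIV. \<Sum>z2\<in>UNIV. merge_entry t1 t2 t z1 z2 y * (vec t1 k1 z1 * vec t2 k2 z2)) =
    (if k1 = k2 then vec t k1 y else 0)"
proof -
  obtain r e where roots: "root True = r" "root False = r + e" "delta True = - e" "delta False = e" "e \<noteq> 0"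
    by (rule root_delta)
  then have of_R: "of_R alpha0 = r + e" "of_R alpha1 = r" by (simp_all add: root_def)
  note defs = UNIV_bool vec_def merge_entry_def deg_def type_root_def coord_def
    basis_elem_def A_one_def of_R
  from assms show ?thesis
  proof (cases rule: fuse_cases)
    case 1
    then show ?thesis
      by (cases k1; cases k2; cases y) (simp_all add: defs roots field_simps)
  next
    case (2 m)
    then show ?thesis
      by (cases m; cases k1; cases k2; cases y) (simp_all add: defs roots field_simps)
  next
    case (3 m)
    then show ?thesis
      by (cases m; cases k1; cases k2; cases y) (simp_all add: defs roots field_simps)
  next
    case (4 m)
    then show ?thesis
      by (cases m; cases k1; cases k2; cases y) (simp_all add: defs roots field_simps)
  qed
qed

text \<open>Since \<open>vec\<close> is normalised to make all merge coefficients \<open>1\<close>,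
  the whole unit ends up in the splits. For trivial circles this is the formula for the
  comultiplication of an idempotent \<open>e\<close> with trace \<open>1 / delta k\<close>, namely
  \<open>delta k\<close> times \<open>e\<close> tensor \<open>e\<close>.\<close>

lemma split_vec:
  assumes "fuse t1 t2 t"
  shows "(\<Sum>z\<in>UNIV. split_entry t t1 t2 z y1 y2 * vec t k z) =
    delta k * (vec t1 k y1 * vec t2 k y2)"
proof -
  obtain r e where roots: "root True = r" "root False = r + e" "delta True = - e" "delta False = e" "e \<noteq> 0"
    by (rule root_delta)
  then have of_R: "of_R alpha0 = r + e" "of_R alpha1 = r" by (simp_all add: root_def)
  note defs = UNIV_bool vec_def split_entry_def deg_def type_root_def coord_def coord2_def
    A_comult_def A_comult_one_def A_comult_X_def A_X_def
    basis_elem_def A_one_def of_R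
  from assms show ?thesis
  proof (cases rule: fuse_cases)
    case 1
    then show ?thesis
      by (cases k; cases y1; cases y2) (simp_all add: defs roots field_simps)
  next
    case (2 m)
    then show ?thesis
      by (cases m; cases k; cases y1; cases y2) (simp_all add: defs roots field_simps)
  next
    case (3 m)
    then show ?thesis
      by (cases m; cases k; cases y1; cases y2) (simp_all add: defs roots field_simps)
  next
    case (4 m)
    then show ?thesis
      by (cases m; cases k; cases y1; cases y2) (simp_all add: defs roots field_simps)
  qed
qed

section \<open>Cubes with invertible edge maps\<close>

lemma sum_Pow_insert:
  assumes "finite A" "a \<notin> A"
  shows "(\<Sum>x\<in>Pow (insert a A). f x) = (\<Sum>x\<in>Pow A. f x + f (insert a x))"
proof -
  have "inj_on (insert a) (Pow A)" using assms(2) by (auto simp: inj_on_def)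
  moreover have "Pow A \<inter> insert a ` Pow A = {}" using assms(2) by auto
  ultimately show ?thesis using assms(1)
    by (simp add: Pow_insert sum.union_disjoint sum.reindex sum.distrib)
qed

text \<open>Labellings of circles by two values are encoded as subsets. A sum over them of products
  of local factors separates circle by circle, which reduces statements on tensor products to a
  single circle.\<close>

lemma sum_Pow_prod:
  fixes g :: "'a \<Rightarrow> bool \<Rightarrow> 'b :: comm_ring_1"
  assumes "finite A"
  shows "(\<Sum>x\<in>Pow A. \<Prod>c\<in>A. g c (c \<in> x)) = (\<Prod>c\<in>A. \<Sum>z\<in>UNIV. g c z)"
  using assms
proof (induction A)
  case (insert a A)
  have "(\<Prod>c\<in>A. g c (c \<in> insert a x)) = (\<Prod>c\<in>A. g c (c \<in> x))" for x
  proof (rule prod.cong)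
    fix c assume "c \<in> A"
    then have "c \<noteq> a" using insert.hyps by auto
    then show "g c (c \<in> insert a x) = g c (c \<in> x)" by simp
  qed simp
  moreover have "a \<notin> x" if "x \<in> Pow A" for x using that insert.hyps by auto
  ultimately show ?case using insert
    by (simp add: sum_Pow_insert UNIV_bool flip: distrib_right sum_distrib_left)
qed simp

lemma prod_of_bool:
  "finite A \<Longrightarrow> (\<Prod>c\<in>A. of_bool (P c)) = (of_bool (\<forall>c\<in>A. P c) :: 'b :: comm_semiring_1)"
  by (induction A rule: finite_induct) auto

text \<open>Each vertex \<open>u\<close> of the interval from \<open>L\<close> to \<open>U\<close>
  carries a one-dimensional space, and \<open>e u j\<close> is the coefficient of the edge from
  \<open>u\<close> to \<open>insert j u\<close>. This is the total differential on
  coordinates.\<close>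

definition cube_d :: "'a set \<Rightarrow> 'a set \<Rightarrow> ('a set \<Rightarrow> 'a \<Rightarrow> 'b :: field) \<Rightarrow> ('a set \<Rightarrow> 'b) \<Rightarrow> 'a set \<Rightarrow> 'b" where
  "cube_d L U e c v =
    (if L \<subseteq> v \<and> v \<subseteq> U then \<Sum>j\<in>v - L. e (v - {j}) j * c (v - {j}) else 0)"

text \<open>The homotopy inverts the edge maps in one fixed direction \<open>m\<close>.\<close>

definition cube_h :: "'a set \<Rightarrow> 'a set \<Rightarrow> ('a set \<Rightarrow> 'a \<Rightarrow> 'b :: field) \<Rightarrow> 'a \<Rightarrow> ('a set \<Rightarrow> 'b) \<Rightarrow> 'a set \<Rightarrow> 'b" where
  "cube_h L U e m c u =
    (if L \<subseteq> u \<and> u \<subseteq> U \<and> m \<notin> u then c (insert m u) / e u m else 0)"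

locale cube =
  fixes L U :: "'a set" and e :: "'a set \<Rightarrow> 'a \<Rightarrow> 'b :: field"
  assumes finite_U: "finite U"
    and anticommute: "\<And>u i j. L \<subseteq> u \<Longrightarrow> u \<subseteq> U \<Longrightarrow> i \<in> U - u \<Longrightarrow> j \<in> U - u \<Longrightarrow> i \<noteq> j \<Longrightarrow>
      e u i * e (insert i u) j + e u j * e (insert j u) i = 0"
    and nonzero: "\<And>u j. L \<subseteq> u \<Longrightarrow> u \<subseteq> U \<Longrightarrow> j \<in> U - u \<Longrightarrow> e u j \<noteq> 0"
begin

text \<open>Contraction along the direction \<open>m\<close>: cancelling the edges in this direction
  pairs off all vertices. The mixed terms of the two compositions cancel by anticommutation of the
  squares containing \<open>m\<close>.\<close>

lemma cube_homotopy:
  assumes m: "m \<in> U - L" and v: "L \<subseteq> v" "v \<subseteq> U"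
  shows "cube_d L U e (cube_h L U e m c) v + cube_h L U e m (cube_d L U e c) v = c v"
proof (cases "m \<in> v")
  case True
  have fin: "finite (v - L)" using v finite_U finite_subset by blast
  have ne: "e (v - {m}) m \<noteq> 0" by (rule nonzero) (use m v in auto)
  \<comment> \<open>For \<open>j \<noteq> m\<close> the vertex \<open>v - {j}\<close> still contains
    \<open>m\<close>, and there \<open>cube_h\<close> is \<open>0\<close>.\<close>
  have "cube_d L U e (cube_h L U e m c) v =
      (\<Sum>j\<in>v - L. if j = m then e (v - {m}) m * (c v / e (v - {m}) m) else 0)"
    unfolding cube_d_def using v
    by (auto intro!: sum.cong simp: cube_h_def insert_absorb True)
  also have "\<dots> = c v"
    using fin True m ne by (simp add: sum.delta)
  finally show ?thesis using True by (simp add: cube_h_def)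
next
  case False
  have fin: "finite (v - L)" using v finite_U finite_subset by blast
  have ne: "e v m \<noteq> 0" using nonzero[of v m] v m False by auto
  have "cube_h L U e m (cube_d L U e c) v =
      (\<Sum>j\<in>insert m v - L. e (insert m v - {j}) j * c (insert m v - {j})) / e v m"
    using v m False by (auto simp: cube_h_def cube_d_def)
  also have "insert m v - L = insert m (v - L)" using m by auto
  also have "(\<Sum>j\<in>insert m (v - L). e (insert m v - {j}) j * c (insert m v - {j})) =
      e v m * c v + (\<Sum>j\<in>v - L. e (insert m v - {j}) j * c (insert m v - {j}))"
    using fin False by simp
  finally have h: "cube_h L U e m (cube_d L U e c) v =
      c v + (\<Sum>j\<in>v - L. e (insert m v - {j}) j * c (insert m v - {j}) / e v m)"
    using ne by (simp add: add_divide_distrib sum_divide_distrib)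
  have "cube_d L U e (cube_h L U e m c) v =
      (\<Sum>j\<in>v - L. e (v - {j}) j * (c (insert m (v - {j})) / e (v - {j}) m))"
    unfolding cube_d_def using v False by (auto intro!: sum.cong simp: cube_h_def)
  also have "\<dots> = (\<Sum>j\<in>v - L. - (e (insert m v - {j}) j * c (insert m v - {j}) / e v m))"
  proof (rule sum.cong)
    fix j assume j: "j \<in> v - L"
    let ?w = "v - {j}"
    have "e ?w j * e (insert j ?w) m + e ?w m * e (insert m ?w) j = 0"
      by (rule anticommute) (use j v m False in auto)
    moreover have "insert j ?w = v" "insert m ?w = insert m v - {j}" using j False by auto
    ultimately have "e ?w j * e v m = - (e ?w m * e (insert m v - {j}) j)"
      by (simp add: eq_neg_iff_add_eq_0)
    then have "e ?w j * e v m * c (insert m v - {j}) =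
        - (e ?w m * e (insert m v - {j}) j) * c (insert m v - {j})"
      by (rule arg_cong)
    moreover have "e ?w m \<noteq> 0" using nonzero[of ?w m] j v m False by auto
    ultimately show "e ?w j * (c (insert m ?w) / e ?w m) =
        - (e (insert m v - {j}) j * c (insert m v - {j}) / e v m)"
      using ne \<open>insert m ?w = insert m v - {j}\<close> by (simp add: field_simps)
  qed simp
  finally show ?thesis unfolding h by (simp add: sum_negf)
qed

end

section \<open>Free modules\<close>

text \<open>\<open>M\<close> is only a record with operations and is not assumed to be a module.
  Every module axiom is transported along the bijection with coordinate functions, and the basis
  consists of the images of the unit vectors.\<close>

lemma free_of_rankI:
  assumes R: "cring R" and B: "finite B" "card B = r"
    and bij: "bij_betw \<theta> (B \<rightarrow>\<^sub>E carrier R) (carrier M)"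
    and add: "\<And>x y. x \<in> B \<rightarrow>\<^sub>E carrier R \<Longrightarrow> y \<in> B \<rightarrow>\<^sub>E carrier R \<Longrightarrow>
      \<theta> (\<lambda>b\<in>B. x b \<oplus>\<^bsub>R\<^esub> y b) = \<theta> x \<oplus>\<^bsub>M\<^esub> \<theta> y"
    and smult: "\<And>a x. a \<in> carrier R \<Longrightarrow> x \<in> B \<rightarrow>\<^sub>E carrier R \<Longrightarrow>
      \<theta> (\<lambda>b\<in>B. a \<otimes>\<^bsub>R\<^esub> x b) = a \<odot>\<^bsub>M\<^esub> \<theta> x"
    and zero: "\<theta> (\<lambda>b\<in>B. \<zero>\<^bsub>R\<^esub>) = \<zero>\<^bsub>M\<^esub>"
  shows "free_of_rank R M r"
proof -
  interpret R: cring R by (rule R)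
  let ?F = "B \<rightarrow>\<^sub>E carrier R"
  have \<theta>: "\<theta> x \<in> carrier M" if "x \<in> ?F" for x
    using bij that by (auto simp: bij_betw_def)
  have surj: "\<exists>x\<in>?F. m = \<theta> x" if "m \<in> carrier M" for m
    using bij that by (auto simp: bij_betw_def)
  have inj: "x = y" if "x \<in> ?F" "y \<in> ?F" "\<theta> x = \<theta> y" for x y
    using bij that by (auto simp: bij_betw_def inj_on_def)
  have mem: "x b \<in> carrier R" if "x \<in> ?F" "b \<in> B" for x b
    using that by (rule PiE_mem)
  have F_add: "(\<lambda>b\<in>B. x b \<oplus>\<^bsub>R\<^esub> y b) \<in> ?F" if "x \<in> ?F" "y \<in> ?F" for x y
    using that by auto
  have F_smult: "(\<lambda>b\<in>B. a \<otimes>\<^bsub>R\<^esub> x b) \<in> ?F" if "a \<in> carrier R" "x \<in> ?F" for x a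
    using that by auto
  have mod: "Module.module R M"
  proof (rule moduleI[OF R])
    show "abelian_group M"
    proof (rule abelian_groupI)
      fix m n assume "m \<in> carrier M" "n \<in> carrier M"
      then obtain x y where "x \<in> ?F" "y \<in> ?F" "m = \<theta> x" "n = \<theta> y" using surj by metis
      moreover from this have "\<theta> (\<lambda>b\<in>B. x b \<oplus>\<^bsub>R\<^esub> y b) = \<theta> (\<lambda>b\<in>B. y b \<oplus>\<^bsub>R\<^esub> x b)"
        by (intro arg_cong[of _ _ \<theta>] restrict_ext R.a_comm) (auto simp: mem)
      ultimately show "m \<oplus>\<^bsub>M\<^esub> n \<in> carrier M" "m \<oplus>\<^bsub>M\<^esub> n = n \<oplus>\<^bsub>M\<^esub> m"
        using add[of x y] add[of y x] \<theta>[OF F_add[of x y]] by simp_all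
    next
      fix m n p assume "m \<in> carrier M" "n \<in> carrier M" "p \<in> carrier M"
      then obtain x y z where xyz: "x \<in> ?F" "y \<in> ?F" "z \<in> ?F" "m = \<theta> x" "n = \<theta> y" "p = \<theta> z"
        using surj by metis
      have "\<theta> (\<lambda>b\<in>B. (\<lambda>b\<in>B. x b \<oplus>\<^bsub>R\<^esub> y b) b \<oplus>\<^bsub>R\<^esub> z b) = \<theta> (\<lambda>b\<in>B. x b \<oplus>\<^bsub>R\<^esub> (\<lambda>b\<in>B. y b \<oplus>\<^bsub>R\<^esub> z b) b)"
        using xyz by (intro arg_cong[of _ _ \<theta>] restrict_ext) (simp add: R.a_assoc mem)
      then show "m \<oplus>\<^bsub>M\<^esub> n \<oplus>\<^bsub>M\<^esub> p = m \<oplus>\<^bsub>M\<^esub> (n \<oplus>\<^bsub>M\<^esub> p)"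
        by (simp only: add F_add xyz)
    next
      show "\<zero>\<^bsub>M\<^esub> \<in> carrier M" unfolding zero[symmetric] by (rule \<theta>) auto
    next
      fix m assume "m \<in> carrier M"
      then obtain x where x: "x \<in> ?F" "m = \<theta> x" using surj by blast
      have z: "(\<lambda>b\<in>B. \<zero>\<^bsub>R\<^esub>) \<in> ?F" and neg: "(\<lambda>b\<in>B. \<ominus>\<^bsub>R\<^esub> x b) \<in> ?F"
        using mem[OF x(1)] by auto
      have eq: "(\<lambda>b\<in>B. (\<lambda>b\<in>B. \<zero>\<^bsub>R\<^esub>) b \<oplus>\<^bsub>R\<^esub> x b) = x"
        by (rule ext) (simp add: restrict_def mem[OF x(1)] PiE_arb[OF x(1)])
      show "\<zero>\<^bsub>M\<^esub> \<oplus>\<^bsub>M\<^esub> m = m"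
        unfolding x(2) zero[symmetric] add[OF z x(1), symmetric] eq ..
      have eq': "\<theta> (\<lambda>b\<in>B. (\<lambda>b\<in>B. \<ominus>\<^bsub>R\<^esub> x b) b \<oplus>\<^bsub>R\<^esub> x b) = \<theta> (\<lambda>b\<in>B. \<zero>\<^bsub>R\<^esub>)"
        using x by (intro arg_cong[of _ _ \<theta>] restrict_ext) (simp add: mem R.l_neg)
      show "\<exists>n\<in>carrier M. n \<oplus>\<^bsub>M\<^esub> m = \<zero>\<^bsub>M\<^esub>"
      proof (rule bexI)
        show "\<theta> (\<lambda>b\<in>B. \<ominus>\<^bsub>R\<^esub> x b) \<oplus>\<^bsub>M\<^esub> m = \<zero>\<^bsub>M\<^esub>"
          unfolding x(2) add[OF neg x(1), symmetric] eq' by (rule zero)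
      qed (rule \<theta>[OF neg])
    qed
    fix a m assume a: "a \<in> carrier R" and m: "m \<in> carrier M"
    then obtain x where x: "x \<in> ?F" "m = \<theta> x" using surj by blast
    show "a \<odot>\<^bsub>M\<^esub> m \<in> carrier M" using a x smult[of a x] \<theta>[OF F_smult[of a x]] by simp
    fix b assume b: "b \<in> carrier R"
    have "\<theta> (\<lambda>i\<in>B. (a \<oplus>\<^bsub>R\<^esub> b) \<otimes>\<^bsub>R\<^esub> x i) =
        \<theta> (\<lambda>i\<in>B. (\<lambda>i\<in>B. a \<otimes>\<^bsub>R\<^esub> x i) i \<oplus>\<^bsub>R\<^esub> (\<lambda>i\<in>B. b \<otimes>\<^bsub>R\<^esub> x i) i)"
      using x a b by (intro arg_cong[of _ _ \<theta>] restrict_ext) (simp add: mem R.l_distr)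
    then show "(a \<oplus>\<^bsub>R\<^esub> b) \<odot>\<^bsub>M\<^esub> m = a \<odot>\<^bsub>M\<^esub> m \<oplus>\<^bsub>M\<^esub> b \<odot>\<^bsub>M\<^esub> m"
      using a b by (simp only: add smult F_smult x R.add.m_closed)
    have "\<theta> (\<lambda>i\<in>B. (a \<otimes>\<^bsub>R\<^esub> b) \<otimes>\<^bsub>R\<^esub> x i) = \<theta> (\<lambda>i\<in>B. a \<otimes>\<^bsub>R\<^esub> (\<lambda>i\<in>B. b \<otimes>\<^bsub>R\<^esub> x i) i)"
      using x a b by (intro arg_cong[of _ _ \<theta>] restrict_ext) (simp add: mem R.m_assoc)
    then show "(a \<otimes>\<^bsub>R\<^esub> b) \<odot>\<^bsub>M\<^esub> m = a \<odot>\<^bsub>M\<^esub> (b \<odot>\<^bsub>M\<^esub> m)"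
      using a b by (simp only: smult F_smult x R.m_closed)
  next
    fix m assume "m \<in> carrier M"
    then obtain x where x: "x \<in> ?F" "m = \<theta> x" using surj by blast
    have "(\<lambda>b\<in>B. \<one>\<^bsub>R\<^esub> \<otimes>\<^bsub>R\<^esub> x b) = x"
      by (rule ext) (simp add: restrict_def mem[OF x(1)] PiE_arb[OF x(1)])
    then show "\<one>\<^bsub>R\<^esub> \<odot>\<^bsub>M\<^esub> m = m"
      unfolding x(2) using smult[OF R.one_closed x(1)] by (metis (no_types))
  next
    fix a m n assume a: "a \<in> carrier R" and "m \<in> carrier M" "n \<in> carrier M"
    then obtain x y where xy: "x \<in> ?F" "y \<in> ?F" "m = \<theta> x" "n = \<theta> y" using surj by metis
    have "\<theta> (\<lambda>i\<in>B. a \<otimes>\<^bsub>R\<^esub> (\<lambda>i\<in>B. x i \<oplus>\<^bsub>R\<^esub> y i) i) =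
        \<theta> (\<lambda>i\<in>B. (\<lambda>i\<in>B. a \<otimes>\<^bsub>R\<^esub> x i) i \<oplus>\<^bsub>R\<^esub> (\<lambda>i\<in>B. a \<otimes>\<^bsub>R\<^esub> y i) i)"
      using xy a by (intro arg_cong[of _ _ \<theta>] restrict_ext) (simp add: mem R.r_distr)
    then show "a \<odot>\<^bsub>M\<^esub> (m \<oplus>\<^bsub>M\<^esub> n) = a \<odot>\<^bsub>M\<^esub> m \<oplus>\<^bsub>M\<^esub> a \<odot>\<^bsub>M\<^esub> n"
      using a by (simp only: add smult F_add F_smult xy)
  qed
  interpret M: module R M by (rule mod)
  obtain h where h: "bij_betw h {..<r} B"
    using B ex_bij_betw_nat_finite[of B] by (auto simp: atLeast0LessThan)
  define g where "g = inv_into {..<r} h"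
  have hB: "h i \<in> B" if "i < r" for i using h that by (auto simp: bij_betw_def)
  have gh: "g (h i) = i" if "i < r" for i
    unfolding g_def using h that by (auto simp: bij_betw_def)
  have hg: "g x < r" "h (g x) = x" if "x \<in> B" for x
    unfolding g_def using h that by (auto simp: bij_betw_def f_inv_into_f inv_into_into)
  define b where "b i = \<theta> (\<lambda>x\<in>B. if x = h i then \<one>\<^bsub>R\<^esub> else \<zero>\<^bsub>R\<^esub>)" for i
  have b: "b i \<in> carrier M" for i unfolding b_def by (rule \<theta>) auto
  \<comment> \<open>Partial sums over \<open>A\<close> have coordinates \<open>0\<close> outside
    \<open>A\<close>. This generality makes an induction on the finite index set possible.\<close>
  have comb: "(\<Oplus>\<^bsub>M\<^esub>i\<in>A. c i \<odot>\<^bsub>M\<^esub> b i) = \<theta> (\<lambda>x\<in>B. if g x \<in> A then c (g x) else \<zero>\<^bsub>R\<^esub>)"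
    if "A \<subseteq> {..<r}" "c \<in> {..<r} \<rightarrow> carrier R" for A c
  proof -
    have "finite A" using that finite_subset by blast
    then show ?thesis using that
    proof (induction A)
      case empty
      show ?case unfolding M.finsum_empty zero[symmetric]
        by (intro arg_cong[of _ _ \<theta>] restrict_ext) simp
    next
      case (insert i A)
      have ci: "c i \<in> carrier R" and ir: "i < r" using insert.prems by auto
      have cA: "c j \<odot>\<^bsub>M\<^esub> b j \<in> carrier M" if "j \<in> A" for j
        using that insert.prems b by auto
      have x1: "(\<lambda>x\<in>B. if x = h i then \<one>\<^bsub>R\<^esub> else \<zero>\<^bsub>R\<^esub>) \<in> ?F" by auto
      have x2: "(\<lambda>x\<in>B. if g x \<in> A then c (g x) else \<zero>\<^bsub>R\<^esub>) \<in> ?F"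
        using insert.prems hg by auto
      have "(\<Oplus>\<^bsub>M\<^esub>i\<in>insert i A. c i \<odot>\<^bsub>M\<^esub> b i) = c i \<odot>\<^bsub>M\<^esub> b i \<oplus>\<^bsub>M\<^esub> (\<Oplus>\<^bsub>M\<^esub>i\<in>A. c i \<odot>\<^bsub>M\<^esub> b i)"
        using insert.hyps cA ci b by (intro M.finsum_insert) auto
      also have "\<dots> = \<theta> (\<lambda>x\<in>B. (\<lambda>x\<in>B. c i \<otimes>\<^bsub>R\<^esub> (\<lambda>x\<in>B. if x = h i then \<one>\<^bsub>R\<^esub> else \<zero>\<^bsub>R\<^esub>) x) x \<oplus>\<^bsub>R\<^esub>
          (\<lambda>x\<in>B. if g x \<in> A then c (g x) else \<zero>\<^bsub>R\<^esub>) x)"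
        using insert ci x1 x2 F_smult[OF ci x1] by (simp only: add smult b_def insert_subset)
      also have "\<dots> = \<theta> (\<lambda>x\<in>B. if g x \<in> insert i A then c (g x) else \<zero>\<^bsub>R\<^esub>)"
      proof (intro arg_cong[of _ _ \<theta>] restrict_ext)
        fix x assume x: "x \<in> B"
        have "x = h i \<longleftrightarrow> g x = i" using x hg gh ir by auto
        moreover have "c (g x) \<in> carrier R" using insert.prems hg x by auto
        ultimately show "(\<lambda>x\<in>B. c i \<otimes>\<^bsub>R\<^esub> (\<lambda>x\<in>B. if x = h i then \<one>\<^bsub>R\<^esub> else \<zero>\<^bsub>R\<^esub>) x) x \<oplus>\<^bsub>R\<^esub>
            (\<lambda>x\<in>B. if g x \<in> A then c (g x) else \<zero>\<^bsub>R\<^esub>) x =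
            (if g x \<in> insert i A then c (g x) else \<zero>\<^bsub>R\<^esub>)"
          using x ci insert.hyps by auto
      qed
      finally show ?case .
    qed
  qed
  have comb': "(\<Oplus>\<^bsub>M\<^esub>i\<in>{..<r}. c i \<odot>\<^bsub>M\<^esub> b i) = \<theta> (\<lambda>x\<in>B. c (g x))"
    if "c \<in> {..<r} \<rightarrow> carrier R" for c
    unfolding comb[OF order_refl that] using hg by (intro arg_cong[of _ _ \<theta>] restrict_ext) auto
  have uniq: "\<exists>!c. c \<in> ({..<r} \<rightarrow>\<^sub>E carrier R) \<and> m = (\<Oplus>\<^bsub>M\<^esub>i\<in>{..<r}. c i \<odot>\<^bsub>M\<^esub> b i)"
    if m: "m \<in> carrier M" for m
  proof -
    obtain x where x: "x \<in> ?F" "m = \<theta> x" using surj[OF m] by blast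
    show ?thesis
    proof (rule ex1I[of _ "\<lambda>i\<in>{..<r}. x (h i)"])
      have 1: "(\<lambda>i\<in>{..<r}. x (h i)) \<in> {..<r} \<rightarrow>\<^sub>E carrier R"
        using mem[OF x(1)] hB by auto
      have 2: "(\<lambda>y\<in>B. (\<lambda>i\<in>{..<r}. x (h i)) (g y)) = x"
        by (rule ext) (simp add: restrict_def hg PiE_arb[OF x(1)])
      have "(\<lambda>i\<in>{..<r}. x (h i)) \<in> {..<r} \<rightarrow> carrier R" using 1 by (simp add: PiE_def)
      from comb'[OF this] show "(\<lambda>i\<in>{..<r}. x (h i)) \<in> {..<r} \<rightarrow>\<^sub>E carrier R \<and>
          m = (\<Oplus>\<^bsub>M\<^esub>i\<in>{..<r}. (\<lambda>i\<in>{..<r}. x (h i)) i \<odot>\<^bsub>M\<^esub> b i)"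
        unfolding 2 x(2) using 1 by (metis (no_types))
    next
      fix c assume c: "c \<in> ({..<r} \<rightarrow>\<^sub>E carrier R) \<and> m = (\<Oplus>\<^bsub>M\<^esub>i\<in>{..<r}. c i \<odot>\<^bsub>M\<^esub> b i)"
      then have c_mem: "c i \<in> carrier R" if "i < r" for i using that by auto
      have "\<theta> x = \<theta> (\<lambda>y\<in>B. c (g y))"
        unfolding x(2)[symmetric] using c by (subst comb'[symmetric]) (auto simp: PiE_def)
      moreover have "(\<lambda>y\<in>B. c (g y)) \<in> ?F" using c_mem hg by auto
      ultimately have x_eq: "x = (\<lambda>y\<in>B. c (g y))" by (intro inj[OF x(1)])
      have "c i = x (h i)" if "i < r" for i unfolding x_eq using that hB gh by simp
      then show "c = (\<lambda>i\<in>{..<r}. x (h i))"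
        using c PiE_arb[of c "{..<r}" "\<lambda>_. carrier R"] by (auto simp: restrict_def fun_eq_iff)
    qed
  qed
  show ?thesis unfolding free_of_rank_def
  proof (intro conjI mod bexI[of _ b] ballI)
    show "b \<in> {..<r} \<rightarrow> carrier M" using b by simp
  qed (rule uniq)
qed

section \<open>Circles as orbits of a permutation\<close>

lemma orbit_comp_transpose_imp:
  assumes "permutation f" "x \<noteq> y" "y \<in> orbit f x"
  shows "y \<notin> orbit (f \<circ> transpose x y) x"
proof
  let ?g = "f \<circ> transpose x y"
  assume "y \<in> orbit ?g x"
  have "permutation ?g"
    using assms(1) by (simp add: permutation_compose permutation_swap_id)
  then have x_g: "x \<in> orbit ?g y"
    using \<open>y \<in> orbit ?g x\<close> by (metis orbit_swap permutation_self_in_orbit)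
  define k where "k = (LEAST k. (f ^^ k) x = y)"
  have ex: "\<exists>k. (f ^^ k) x = y"
    using assms(3) by (auto simp: orbit_altdef)
  have k: "(f ^^ k) x = y"
    unfolding k_def by (rule LeastI_ex[OF ex])
  have least: "(f ^^ m) x \<noteq> y" if "m < k" for m
    using not_less_Least that unfolding k_def by blast
  \<comment> \<open>An earlier return to \<open>x\<close> would let the orbit reach \<open>y\<close>
    already after \<open>k - m\<close> steps, against the minimality of \<open>k\<close>.\<close>
  have no_x: "(f ^^ m) x \<noteq> x" if "0 < m" "m \<le> k" for m
  proof
    assume m: "(f ^^ m) x = x"
    have "(f ^^ k) x = (f ^^ (k - m)) ((f ^^ m) x)"
      using that by (metis comp_apply funpow_add le_add_diff_inverse2)
    with m k least[of "k - m"] that show False by auto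
  qed
  have "k > 0" using k assms(2) by (cases k) auto
  \<comment> \<open>The stretch of the cycle of \<open>f\<close> from \<open>f x\<close> to
    \<open>y\<close>. The new map follows it and jumps from \<open>y\<close> back to
    \<open>f x\<close>, so it never meets \<open>x\<close>.\<close>
  let ?S = "{(f ^^ m) x | m. 0 < m \<and> m \<le> k}"
  have "z \<in> ?S" if "z \<in> orbit ?g y" for z
    using that
  proof induction
    case base
    then show ?case using \<open>k > 0\<close> by (auto intro!: exI[of _ 1])
  next
    case (step z)
    then obtain m where m: "z = (f ^^ m) x" "0 < m" "m \<le> k" by auto
    show ?case
    proof (cases "m = k")
      case True
      then show ?thesis using m k \<open>k > 0\<close> by (auto intro!: exI[of _ 1])
    next
      case False
      then have "?g z = (f ^^ Suc m) x"
        using m no_x least[of m] by (auto simp: transpose_def)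
      then show ?thesis using False m by (intro CollectI exI[of _ "Suc m"]) auto
    qed
  qed
  from this[OF x_g] obtain m where "x = (f ^^ m) x" "0 < m" "m \<le> k" by blast
  with no_x[of m] show False by simp
qed

text \<open>Cutting a cycle is the previous lemma, and exchanging \<open>f\<close> with the composed
  map there only gives its contrapositive. The joining of two cycles is therefore traced directly:
  from \<open>y\<close> the new map enters the cycle of \<open>x\<close> at \<open>f x\<close> and
  runs around it until it hits \<open>x\<close>.\<close>

lemma orbit_comp_transpose:
  assumes "permutation f" "x \<noteq> y"
  shows "y \<in> orbit (f \<circ> transpose x y) x \<longleftrightarrow> y \<notin> orbit f x"
proof
  show "y \<notin> orbit f x" if "y \<in> orbit (f \<circ> transpose x y) x"
    using orbit_comp_transpose_imp[OF assms] that by blast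
next
  let ?g = "f \<circ> transpose x y"
  assume y: "y \<notin> orbit f x"
  have perm: "permutation ?g"
    using assms(1) by (simp add: permutation_compose permutation_swap_id)
  have x_f: "x \<in> orbit f x" by (rule permutation_self_in_orbit[OF assms(1)])
  define n where "n = (LEAST n. 0 < n \<and> (f ^^ n) x = x)"
  have "\<exists>n. 0 < n \<and> (f ^^ n) x = x"
    using x_f unfolding orbit_altdef by force
  then have n: "0 < n" "(f ^^ n) x = x"
    unfolding n_def by (metis (mono_tags, lifting) LeastI_ex)+
  have least: "(f ^^ m) x \<noteq> x" if "0 < m" "m < n" for m
    using not_less_Least that unfolding n_def by blast
  have no_y: "(f ^^ m) x \<noteq> y" for m
  proof (cases m)
    case (Suc m')
    then show ?thesis using y unfolding orbit_altdef by blast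
  qed (use assms(2) in simp)
  have "(?g ^^ m) y = (f ^^ m) x" if "0 < m" "m \<le> n" for m
    using that
  proof (induction m)
    case (Suc m)
    show ?case
    proof (cases m)
      case 0
      then show ?thesis by simp
    next
      case (Suc m')
      then have "(?g ^^ m) y = (f ^^ m) x" using Suc.prems Suc by (intro Suc.IH) auto
      then have "(?g ^^ Suc m) y = ?g ((f ^^ m) x)" by (metis comp_apply funpow.simps(2))
      moreover have "(f ^^ m) x \<noteq> x" using least[of m] Suc.prems Suc by auto
      then have "?g ((f ^^ m) x) = (f ^^ Suc m) x" using no_y[of m] by (simp add: transpose_def)
      ultimately show ?thesis by (rule trans)
    qed
  qed simp
  then have "(?g ^^ n) y = x" using n by auto
  then have "x \<in> orbit ?g y" using n unfolding orbit_altdef by (intro CollectI exI[of _ n]) simp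
  then show "y \<in> orbit ?g x"
    by (metis orbit_swap permutation_self_in_orbit perm)
qed

text \<open>
  A pair \<open>(t, a)\<close> is the end at position \<open>a\<close> on the bottom (\<open>t = False\<close>) or top (\<open>t = True\<close>) of a
  layer; \<open>partner\<close> is the other end of its arc.
\<close>

fun partner :: "layer \<Rightarrow> bool \<times> nat \<Rightarrow> bool \<times> nat" where
  "partner (Cup i) (False, a) = (True, if a < i then a else a + 2)"
| "partner (Cup i) (True, a) =
    (if a < i then (False, a) else if a = i then (True, i + 1)
     else if a = i + 1 then (True, i) else (False, a - 2))"
| "partner (Cap i) (True, a) = (False, if a < i then a else a + 2)"
| "partner (Cap i) (False, a) =
    (if a < i then (True, a) else if a = i then (False, i + 1)
     else if a = i + 1 then (False, i) else (True, a - 2))"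
| "partner (CapCup i) (t, a) =
    (if a = i then (t, i + 1) else if a = i + 1 then (t, i) else (\<not> t, a))"
| "partner _ (t, a) = (\<not> t, a)"

definition side_width :: "layer \<Rightarrow> nat \<Rightarrow> bool \<Rightarrow> nat" where
  "side_width l n t = (if t then top_width l n else n)"

definition is_cross :: "layer \<Rightarrow> bool" where
  "is_cross l \<longleftrightarrow> (\<exists>i b. l = Cross i b)"

text \<open>Through arcs shift the position by \<open>0\<close> or \<open>2\<close> and turns join
  neighbours, which gives the parity clause. A crossing would shift by \<open>1\<close>. All later
  parity arguments rest on this.\<close>

lemma partner_involution:
  assumes "admissible l n" "\<not> is_cross l" "a < side_width l n t"
  shows "case partner l (t, a) of (t', b) \<Rightarrow>
    b < side_width l n t' \<and> partner l (t', b) = (t, a) \<and> (even a = even b \<longleftrightarrow> t \<noteq> t')"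
  using assms
  by (cases l; cases t) (auto simp: side_width_def is_cross_def split: if_splits)

text \<open>\<open>go C d p\<close> follows the arc that leaves \<open>p\<close> counterclockwise if \<open>d\<close>, clockwise otherwise.\<close>

definition go :: "diagram \<Rightarrow> bool \<Rightarrow> point \<Rightarrow> point" where
  "go C d p =
    (if d then
       (if fst p = length (layers C) then (0, snd p)
        else let (t, b) = partner (layers C ! fst p) (False, snd p)
             in (if t then Suc (fst p) else fst p, b))
     else
       (if fst p = 0 then (length (layers C), snd p)
        else let (t, b) = partner (layers C ! (fst p - 1)) (True, snd p)
             in (if t then fst p else fst p - 1, b)))"

lemma width_0 [simp]: "width C 0 = fst C"
  by (simp add: width_def)

lemma width_Suc:
  "j < length (layers C) \<Longrightarrow> width C (Suc j) = top_width (layers C ! j) (width C j)"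
  by (simp add: width_def take_Suc_conv_app_nth)

lemma finite_points: "finite (points D)"
proof -
  have "points D = (SIGMA j : {..length (layers D)}. {..<width D j})"
    by (auto simp: points_def)
  then show ?thesis by simp
qed

section \<open>Tracing the circles of a diagram without crossings\<close>

locale flat =
  fixes C :: diagram
  assumes annular: "annular_diagram C"
    and no_cross: "\<And>j. j < length (layers C) \<Longrightarrow> \<not> is_cross (layers C ! j)"
begin

lemma admissible_layer: "j < length (layers C) \<Longrightarrow> admissible (layers C ! j) (width C j)"
  using annular by (auto simp: annular_diagram_def)

lemma width_length: "width C (length (layers C)) = fst C"
  using annular by (auto simp: annular_diagram_def)

lemma partner_layer:
  assumes "j < length (layers C)" "a < width C (if t then Suc j else j)"
    "partner (layers C ! j) (t, a) = (t', b)"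
  shows "b < width C (if t' then Suc j else j)"
    "partner (layers C ! j) (t', b) = (t, a)" "even a = even b \<longleftrightarrow> t \<noteq> t'"
proof -
  have "a < side_width (layers C ! j) (width C j) t"
    using assms by (simp add: side_width_def width_Suc split: if_splits)
  from partner_involution[OF admissible_layer no_cross this] assms
  show "b < width C (if t' then Suc j else j)"
    "partner (layers C ! j) (t', b) = (t, a)" "even a = even b \<longleftrightarrow> t \<noteq> t'"
    by (auto simp: side_width_def width_Suc split: if_splits)
qed

text \<open>After a through arc one returns in the opposite direction, after a turn in the same
  direction. The parity of the two positions tells these cases apart.\<close>

lemma go_points_back:
  assumes "p \<in> points C"
  shows "go C d p \<in> points C"
    "go C (if even (snd p) = even (snd (go C d p)) then \<not> d else d) (go C d p) = p"
proof -
  obtain j a where p: "p = (j, a)" by (cases p)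
  have ja: "j \<le> length (layers C)" "a < width C j" using assms p by (auto simp: points_def)
  have "go C d p \<in> points C \<and>
    go C (if even (snd p) = even (snd (go C d p)) then \<not> d else d) (go C d p) = p"
  proof (cases d)
    case True
    show ?thesis
    proof (cases "j = length (layers C)")
      case True
      then show ?thesis using \<open>d\<close> p ja width_length by (auto simp: go_def points_def)
    next
      case False
      then have j: "j < length (layers C)" using ja by simp
      obtain t b where tb: "partner (layers C ! j) (False, a) = (t, b)" by fastforce
      from partner_layer[OF j _ this] ja
      show ?thesis using \<open>d\<close> p False tb j by (auto simp: go_def points_def)
    qed
  next
    case False
    show ?thesis
    proof (cases j)
      case 0
      then show ?thesis using \<open>\<not> d\<close> p ja width_length by (auto simp: go_def points_def)
    next
      case (Suc i)
      then have j: "i < length (layers C)" using ja by simp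
      obtain t b where tb: "partner (layers C ! i) (True, a) = (t, b)" by fastforce
      from partner_layer[OF j _ this] ja Suc
      show ?thesis using \<open>\<not> d\<close> p tb j by (auto simp: go_def points_def)
    qed
  qed
  then show "go C d p \<in> points C"
    "go C (if even (snd p) = even (snd (go C d p)) then \<not> d else d) (go C d p) = p" by auto
qed

text \<open>
  Through arcs keep the parity of the position and turns change it. So a circle that leaves even
  positions counterclockwise and odd positions clockwise is consistently oriented.
\<close>

definition succ :: "point \<Rightarrow> point" where
  "succ p = (if p \<in> points C then go C (even (snd p)) p else p)"

definition pred :: "point \<Rightarrow> point" where
  "pred p = (if p \<in> points C then go C (odd (snd p)) p else p)"

lemma pred_succ: "pred (succ p) = p"
  using go_points_back[of p "even (snd p)"] by (auto simp: succ_def pred_def split: if_splits)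

lemma succ_pred: "succ (pred p) = p"
  using go_points_back[of p "odd (snd p)"] by (auto simp: succ_def pred_def split: if_splits)

lemma bij_succ: "bij succ"
  by (metis bijI' pred_succ succ_pred)

lemma permutation_succ: "permutation succ"
  unfolding permutation
proof (intro conjI bij_succ)
  show "finite {x. succ x \<noteq> x}"
    by (rule finite_subset[OF _ finite_points]) (auto simp: succ_def)
qed

abbreviation arcs where "arcs \<equiv> straight_arcs C \<union> turning_arcs C"

lemma straight_arcD:
  assumes "(p, q) \<in> straight_arcs C"
  shows "p \<in> points C" "q \<in> points C" "go C True p = q" "go C False q = p"
    "even (snd p) = even (snd q)"
proof -
  consider (layer) j a b where "p = (j, a)" "q = (Suc j, b)" "j < length (layers C)"
      "(a, b) \<in> through (layers C ! j) (width C j)"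
    | (wrap) a where "p = (length (layers C), a)" "q = (0, a)" "a < fst C"
    using assms by (auto simp: straight_arcs_def)
  then have "p \<in> points C \<and> q \<in> points C \<and> go C True p = q \<and> go C False q = p \<and>
    even (snd p) = even (snd q)"
  proof cases
    case layer
    with admissible_layer[of j] no_cross[of j] show ?thesis
      by (cases "layers C ! j") (auto simp: points_def go_def width_Suc is_cross_def)
  next
    case wrap
    then show ?thesis using width_length by (auto simp: points_def go_def)
  qed
  then show "p \<in> points C" "q \<in> points C" "go C True p = q" "go C False q = p"
    "even (snd p) = even (snd q)" by auto
qed

lemma turning_arcD:
  assumes "(p, q) \<in> turning_arcs C"
  shows "p \<in> points C" "q \<in> points C" "fst q = fst p" "snd q = Suc (snd p)"
    "\<exists>d. go C d p = q \<and> go C d q = p"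
proof -
  consider (bottom) j a b where "p = (j, a)" "q = (j, b)" "j < length (layers C)"
      "(a, b) \<in> bottom_turns (layers C ! j)"
    | (top) j a b where "p = (Suc j, a)" "q = (Suc j, b)" "j < length (layers C)"
      "(a, b) \<in> top_turns (layers C ! j)"
    using assms by (auto simp: turning_arcs_def)
  then have "p \<in> points C \<and> q \<in> points C \<and> fst q = fst p \<and> snd q = Suc (snd p) \<and>
    (\<exists>d. go C d p = q \<and> go C d q = p)"
  proof cases
    case bottom
    with admissible_layer[of j] show ?thesis
      by (cases "layers C ! j") (auto simp: points_def go_def intro!: exI[of _ True])
  next
    case top
    have "go C False (Suc j, x) =
      (let (t, b) = partner (layers C ! j) (True, x) in (if t then Suc j else j, b))" for x
      by (simp add: go_def case_prod_beta)
    with top admissible_layer[of j] show ?thesis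
      by (cases "layers C ! j") (auto simp: points_def width_Suc intro!: exI[of _ False])
  qed
  then show "p \<in> points C" "q \<in> points C" "fst q = fst p" "snd q = Suc (snd p)"
    "\<exists>d. go C d p = q \<and> go C d q = p" by auto
qed

lemma go_arc:
  assumes "p \<in> points C"
  shows "(p, go C d p) \<in> arcs \<union> arcs\<inverse>"
proof -
  obtain j a where p: "p = (j, a)" by (cases p)
  have ja: "j \<le> length (layers C)" "a < width C j" using assms p by (auto simp: points_def)
  show ?thesis
  proof (cases d)
    case True
    show ?thesis
    proof (cases "j = length (layers C)")
      case True
      then show ?thesis using \<open>d\<close> p ja width_length by (auto simp: go_def straight_arcs_def)
    next
      case False
      then have j: "j < length (layers C)" using ja by simp
      obtain t b where tb: "partner (layers C ! j) (False, a) = (t, b)" by fastforce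
      have "(if t then (a, b) \<in> through (layers C ! j) (width C j)
        else (a, b) \<in> bottom_turns (layers C ! j) \<or> (b, a) \<in> bottom_turns (layers C ! j))"
        using tb ja no_cross[OF j] admissible_layer[OF j]
        by (cases "layers C ! j") (auto simp: is_cross_def split: if_splits)
      then show ?thesis using \<open>d\<close> p j tb
        by (auto simp: go_def straight_arcs_def turning_arcs_def split: if_splits)
    qed
  next
    case False
    show ?thesis
    proof (cases j)
      case 0
      then show ?thesis using \<open>\<not> d\<close> p ja width_length by (auto simp: go_def straight_arcs_def)
    next
      case (Suc i)
      then have j: "i < length (layers C)" using ja by simp
      obtain t b where tb: "partner (layers C ! i) (True, a) = (t, b)" by fastforce
      have "(if t then (a, b) \<in> top_turns (layers C ! i) \<or> (b, a) \<in> top_turns (layers C ! i)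
        else (b, a) \<in> through (layers C ! i) (width C i))"
        using tb ja no_cross[OF j] admissible_layer[OF j] Suc j
        by (cases "layers C ! i") (auto simp: is_cross_def width_Suc split: if_splits)
      then show ?thesis using \<open>\<not> d\<close> p j tb Suc
        by (auto simp: go_def straight_arcs_def turning_arcs_def split: if_splits)
    qed
  qed
qed

lemma arc_go:
  assumes "(p, q) \<in> arcs \<union> arcs\<inverse>"
  shows "p \<in> points C \<and> q \<in> points C \<and> (\<exists>d. q = go C d p)"
  using assms straight_arcD turning_arcD by (auto; metis)

text \<open>Every arc is a step of \<open>succ\<close> in one of its two directions, and orbits of a
  permutation are symmetric.\<close>

lemma orbit_succ_connected:
  assumes "p \<in> points C"
  shows "(p, q) \<in> connected_by C \<longleftrightarrow> q \<in> orbit succ p"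
proof
  assume "(p, q) \<in> connected_by C"
  then have "(p, q) \<in> (arcs \<union> arcs\<inverse>)\<^sup>*" by (simp add: connected_by_def Let_def)
  then show "q \<in> orbit succ p"
  proof induction
    case base
    then show ?case by (rule permutation_self_in_orbit[OF permutation_succ])
  next
    case (step y z)
    from arc_go[OF step(2)] obtain d where d: "z = go C d y" "y \<in> points C" "z \<in> points C" by auto
    then have "z = succ y \<or> y = succ z"
      using succ_pred[of y] by (cases "d = even (snd y)") (auto simp: pred_def succ_def)
    moreover have "z \<in> orbit succ p" if "y = succ z"
    proof -
      have "y \<in> orbit succ z" using that by (auto simp: orbit.base)
      then have "z \<in> orbit succ y"
        by (metis orbit_swap permutation_self_in_orbit permutation_succ)
      then show ?thesis using step.IH by (rule orbit_trans)
    qed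
    ultimately show ?case using step.IH by (auto intro: orbit.step)
  qed
next
  have succ_step: "(x, succ x) \<in> (arcs \<union> arcs\<inverse>)\<^sup>* \<and> succ x \<in> points C" if "x \<in> points C" for x
    using go_arc[OF that] go_points_back(1)[OF that] that by (simp add: succ_def r_into_rtrancl)
  assume "q \<in> orbit succ p"
  then have "(p, q) \<in> (arcs \<union> arcs\<inverse>)\<^sup>* \<and> q \<in> points C"
  proof induction
    case base
    then show ?case by (rule succ_step[OF assms])
  next
    case (step y)
    with succ_step[of y] show ?case by (meson rtrancl_trans)
  qed
  then show "(p, q) \<in> connected_by C" by (simp add: connected_by_def Let_def)
qed

end

section \<open>Parity of positions on a circle\<close>

lemma arc_points:
  assumes D: "annular_diagram D" and "(p, q) \<in> straight_arcs D \<union> turning_arcs D"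
  shows "p \<in> points D" "q \<in> points D"
proof -
  have adm: "admissible (layers D ! j) (width D j)" if "j < length (layers D)" for j
    using D that by (auto simp: annular_diagram_def)
  have len: "width D (length (layers D)) = fst D" using D by (simp add: annular_diagram_def)
  consider (layer) j a b where "p = (j, a)" "q = (Suc j, b)" "j < length (layers D)"
      "(a, b) \<in> through (layers D ! j) (width D j)"
    | (wrap) a where "p = (length (layers D), a)" "q = (0, a)" "a < fst D"
    | (bottom) j a b where "p = (j, a)" "q = (j, b)" "j < length (layers D)"
      "(a, b) \<in> bottom_turns (layers D ! j)"
    | (top) j a b where "p = (Suc j, a)" "q = (Suc j, b)" "j < length (layers D)"
      "(a, b) \<in> top_turns (layers D ! j)"
    using assms by (auto simp: straight_arcs_def turning_arcs_def)
  then have "p \<in> points D \<and> q \<in> points D"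
  proof cases
    case layer
    with adm[of j] show ?thesis
      by (cases "layers D ! j") (auto simp: points_def width_Suc)
  next
    case wrap
    then show ?thesis using len by (auto simp: points_def)
  next
    case bottom
    with adm[of j] show ?thesis
      by (cases "layers D ! j") (auto simp: points_def)
  next
    case top
    with adm[of j] show ?thesis
      by (cases "layers D ! j") (auto simp: points_def width_Suc)
  qed
  then show "p \<in> points D" "q \<in> points D" by auto
qed

text \<open>These sets are the unions of components, but the condition speaks of single arcs. So it
  can be compared between smoothings whose components differ.\<close>

definition saturated :: "diagram \<Rightarrow> point set \<Rightarrow> bool" where
  "saturated D T \<longleftrightarrow> T \<subseteq> points D \<and> (\<forall>(p, q) \<in> straight_arcs D \<union> turning_arcs D. p \<in> T \<longleftrightarrow> q \<in> T)"

lemma saturated_iff: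
  "saturated D T \<Longrightarrow> (p, q) \<in> straight_arcs D \<union> turning_arcs D \<Longrightarrow> p \<in> T \<longleftrightarrow> q \<in> T"
  unfolding saturated_def by blast

lemma equiv_connected_by: "equiv UNIV (connected_by D)"
  unfolding connected_by_def Let_def
  by (intro equivI) (auto simp: refl_rtrancl trans_rtrancl sym_Un_converse intro: sym_rtrancl)

lemma saturated_connected:
  assumes "saturated D T" "(p, q) \<in> connected_by D"
  shows "p \<in> T \<longleftrightarrow> q \<in> T"
proof -
  have "(p, q) \<in> (straight_arcs D \<union> turning_arcs D \<union> (straight_arcs D \<union> turning_arcs D)\<inverse>)\<^sup>*"
    using assms(2) by (simp add: connected_by_def Let_def)
  then show ?thesis
  proof induction
    case (step y z)
    then show ?case
      using saturated_iff[OF assms(1), of y z] saturated_iff[OF assms(1), of z y] by blast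
  qed simp
qed

lemma arc_connected:
  "(p, q) \<in> straight_arcs D \<union> turning_arcs D \<Longrightarrow> (p, q) \<in> connected_by D"
  unfolding connected_by_def Let_def by (meson UnI1 r_into_rtrancl)

lemma saturated_points: "annular_diagram D \<Longrightarrow> saturated D (points D)"
  using arc_points unfolding saturated_def by blast

lemma component_of_eq_iff: "component_of D p = component_of D q \<longleftrightarrow> (p, q) \<in> connected_by D"
  unfolding component_of_def by (rule eq_equiv_class_iff[OF equiv_connected_by]) auto

lemma component_of_self: "p \<in> component_of D p"
  unfolding component_of_def using equiv_class_self[OF equiv_connected_by] by auto

lemma component_of_in: "p \<in> points D \<Longrightarrow> component_of D p \<in> components D"
  unfolding component_of_def components_def by (rule quotientI)

lemma component_eq: "c \<in> components D \<Longrightarrow> p \<in> c \<Longrightarrow> component_of D p = c"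
  unfolding component_of_def components_def quotient_def
  using equiv_class_eq[OF equiv_connected_by] by fastforce

lemma component_ex:
  assumes "c \<in> components D" obtains p where "p \<in> points D" "p \<in> c" "component_of D p = c"
  using assms component_of_self unfolding component_of_def components_def quotient_def by blast

lemma components_disjoint:
  "c \<in> components D \<Longrightarrow> c' \<in> components D \<Longrightarrow> p \<in> c \<Longrightarrow> p \<in> c' \<Longrightarrow> c = c'"
  using component_eq by metis

lemma component_nonempty: "c \<in> components D \<Longrightarrow> c \<noteq> {}"
  using component_ex by blast

lemma component_subset: "annular_diagram D \<Longrightarrow> c \<in> components D \<Longrightarrow> c \<subseteq> points D"
  using saturated_connected[OF saturated_points, of D]
  unfolding components_def quotient_def by blast

lemma component_subset_saturated:
  assumes "saturated D T" "c \<in> components D" "p \<in> c" "p \<in> T"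
  shows "c \<subseteq> T"
  using component_eq[OF assms(2,3)] saturated_connected[OF assms(1)] assms(4)
  by (auto simp: component_of_def)

lemma saturated_component:
  assumes "annular_diagram D" "c \<in> components D"
  shows "saturated D c"
proof -
  have "p \<in> c \<longleftrightarrow> q \<in> c" if "(p, q) \<in> straight_arcs D \<union> turning_arcs D" for p q
    using arc_connected[OF that] component_eq[OF assms(2)] component_of_eq_iff component_of_self
    by metis
  then show ?thesis using component_subset[OF assms] unfolding saturated_def by blast
qed

lemma finite_components: "annular_diagram D \<Longrightarrow> finite (components D)"
  using component_subset finite_points by (metis PowI finite_Pow_iff finite_subset subsetI)

lemma Union_components: "annular_diagram D \<Longrightarrow> \<Union> (components D) = points D"
  using component_subset component_of_in component_of_self by blast

lemma saturated_Union:
  assumes "annular_diagram D" "w \<subseteq> components D"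
  shows "saturated D (\<Union> w)"
  unfolding saturated_def
proof (intro conjI)
  show "\<Union> w \<subseteq> points D" using assms Union_components by blast
  show "\<forall>(p, q) \<in> straight_arcs D \<union> turning_arcs D. p \<in> \<Union> w \<longleftrightarrow> q \<in> \<Union> w"
    using saturated_iff[OF saturated_component[OF assms(1)]] assms(2) by blast
qed

lemma saturated_eq_Union:
  assumes "annular_diagram D" "saturated D T"
  shows "T = \<Union> {c \<in> components D. c \<subseteq> T}"
proof
  show "T \<subseteq> \<Union> {c \<in> components D. c \<subseteq> T}"
  proof
    fix p assume "p \<in> T"
    moreover from this have "p \<in> points D" using assms(2) by (auto simp: saturated_def)
    ultimately show "p \<in> \<Union> {c \<in> components D. c \<subseteq> T}"
      using component_of_in component_of_self component_subset_saturated[OF assms(2)]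
      by blast
  qed
qed auto

lemma bij_betw_saturated:
  assumes "annular_diagram D"
  shows "bij_betw \<Union> (Pow (components D)) {T. saturated D T}"
proof (rule bij_betwI[where g = "\<lambda>T. {c \<in> components D. c \<subseteq> T}"])
  show "\<Union> \<in> Pow (components D) \<rightarrow> {T. saturated D T}"
    using saturated_Union[OF assms] by auto
  show "\<Union> {c \<in> components D. c \<subseteq> T} = T" if "T \<in> {T. saturated D T}" for T
    using saturated_eq_Union[OF assms] that by auto
  show "{c \<in> components D. c \<subseteq> \<Union> w} = w" if w: "w \<in> Pow (components D)" for w
  proof
    show "{c \<in> components D. c \<subseteq> \<Union> w} \<subseteq> w"
    proof
      fix c assume c: "c \<in> {c \<in> components D. c \<subseteq> \<Union> w}"
      then obtain p where "p \<in> c" using component_nonempty by blast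
      with c obtain c' where "c' \<in> w" "p \<in> c'" by blast
      with c w \<open>p \<in> c\<close> show "c \<in> w" using components_disjoint[of c D c' p] by auto
    qed
  qed (use w in auto)
qed auto

lemma constant_on_component:
  assumes "c \<in> components D" "annular_diagram D"
    and arc: "\<And>x y. (x, y) \<in> straight_arcs D \<union> turning_arcs D \<Longrightarrow> x \<in> c \<Longrightarrow> y \<in> c \<Longrightarrow> f x = f y"
    and "p \<in> c" "q \<in> c"
  shows "f p = f q"
proof -
  have "(p, q) \<in> connected_by D"
    using component_eq assms component_of_eq_iff by metis
  then have "(p, q) \<in> (straight_arcs D \<union> turning_arcs D \<union> (straight_arcs D \<union> turning_arcs D)\<inverse>)\<^sup>*"
    by (simp add: connected_by_def Let_def)
  then have "q \<in> c \<and> f p = f q"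
  proof induction
    case base
    show ?case using assms by simp
  next
    case (step y z)
    then have "z \<in> c"
      using saturated_iff[OF saturated_component[OF assms(2,1)]] by blast
    with step arc[of y z] arc[of z y] show ?case by auto
  qed
  then show ?thesis ..
qed

section \<open>Parity counts along rays\<close>

definition count_below :: "(nat \<Rightarrow> bool) \<Rightarrow> nat \<Rightarrow> nat" where
  "count_below f a = card {x. x < a \<and> f x}"

lemma count_below_0 [simp]: "count_below f 0 = 0"
  by (simp add: count_below_def)

lemma count_below_Suc [simp]: "count_below f (Suc a) = count_below f a + of_bool (f a)"
proof -
  have "{x. x < Suc a \<and> f x} = (if f a then insert a {x. x < a \<and> f x} else {x. x < a \<and> f x})"
    by (auto simp: less_Suc_eq)
  then show ?thesis by (simp add: count_below_def)
qed

lemma count_below_cong: "(\<And>x. x < a \<Longrightarrow> f x = g x) \<Longrightarrow> count_below f a = count_below g a"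
  unfolding count_below_def by (rule arg_cong[of _ _ card]) auto

lemma count_below_shift:
  assumes "i \<le> a" "\<And>x. i \<le> x \<Longrightarrow> x < a \<Longrightarrow> f x = g (x + k)"
  shows "count_below g (a + k) + count_below f i = count_below f a + count_below g (i + k)"
  using assms
proof (induction a rule: dec_induct)
  case (step b)
  then have "f b = g (b + k)" by simp
  moreover have "count_below g (b + k) + count_below f i = count_below f b + count_below g (i + k)"
    by (rule step.IH) (use step.prems in simp)
  ultimately show ?case by simp
qed simp

text \<open>Here \<open>f\<close> and \<open>g\<close> tell which bottom and top points belong to a
  union of circles. Across the layer, the points below a through arc change only by the two ends of
  a turn, which both belong to the union or both do not. So the count changes by an even
  number.\<close>

lemma through_parity:
  assumes "\<not> is_cross l" "admissible l n" "(a, b) \<in> through l n"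
    and th: "\<And>x y. (x, y) \<in> through l n \<Longrightarrow> f x = g y"
    and bt: "\<And>x y. (x, y) \<in> bottom_turns l \<Longrightarrow> f x = f y"
    and tt: "\<And>x y. (x, y) \<in> top_turns l \<Longrightarrow> g x = g y"
  shows "even (count_below f a) = even (count_below g b)"
proof (cases l)
  case Straight
  then show ?thesis using assms(3) th by (auto intro!: arg_cong[of _ _ even] count_below_cong)
next
  case (Cup i)
  have low: "count_below f x = count_below g x" if "x \<le> i" for x
    using Cup that assms(2) by (intro count_below_cong th) auto
  show ?thesis
  proof (cases "a < i")
    case True
    then show ?thesis using low[of a] assms(3) Cup by auto
  next
    case False
    then have ab: "b = a + 2" "i \<le> a" "a < n" using assms(3) Cup by auto
    have "count_below g (a + 2) + count_below f i = count_below f a + count_below g (i + 2)"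
      using ab Cup by (intro count_below_shift th) auto
    moreover have "count_below g (i + 2) = count_below g i + 2 * of_bool (g i)"
      using tt[of i "i + 1"] Cup by (simp add: numeral_2_eq_2)
    ultimately have "count_below g b = count_below f a + 2 * of_bool (g i)"
      using low[of i] ab by simp
    then show ?thesis by simp
  qed
next
  case (Cap i)
  have low: "count_below f x = count_below g x" if "x \<le> i" for x
    using Cap that assms(2) by (intro count_below_cong th) auto
  show ?thesis
  proof (cases "b < i")
    case True
    then show ?thesis using low[of a] assms(3) Cap by auto
  next
    case False
    then have ab: "a = b + 2" "i \<le> b" "b + 2 < n" using assms(3) Cap by auto
    have "count_below f (b + 2) + count_below g i = count_below g b + count_below f (i + 2)"
      using ab Cap by (intro count_below_shift th[symmetric]) auto
    moreover have "count_below f (i + 2) = count_below f i + 2 * of_bool (f i)"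
      using bt[of i "i + 1"] Cap by (simp add: numeral_2_eq_2)
    ultimately have "count_below f a = count_below g b + 2 * of_bool (f i)"
      using low[of i] ab by simp
    then show ?thesis by simp
  qed
next
  case (CapCup i)
  have low: "count_below f x = count_below g x" if "x \<le> i" for x
    using CapCup that assms(2) by (intro count_below_cong th) auto
  show ?thesis
  proof (cases "a < i")
    case True
    then show ?thesis using low[of a] assms(3) CapCup by auto
  next
    case False
    then have ab: "a = b" "i + 2 \<le> a" "a < n" using assms(3) CapCup by auto
    have "count_below g (a + 0) + count_below f (i + 2) = count_below f a + count_below g (i + 2 + 0)"
      using ab CapCup by (intro count_below_shift th) auto
    moreover have "count_below f (i + 2) = count_below f i + 2 * of_bool (f i)"
      "count_below g (i + 2) = count_below g i + 2 * of_bool (g i)"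
      using bt[of i "i + 1"] tt[of i "i + 1"] CapCup by (simp_all add: numeral_2_eq_2)
    ultimately have "count_below g a + 2 * of_bool (f i) = count_below f a + 2 * of_bool (g i)"
      using low[of i] by simp
    then show ?thesis using ab by (metis dvd_triv_left even_add)
  qed
next
  case (Cross i b)
  then show ?thesis using assms(1) by (simp add: is_cross_def)
qed

text \<open>
  For a union \<open>T\<close> of circles, the parity of \<open>rank T p\<close> tells on which side of \<open>T\<close> the point \<open>p\<close>
  lies if \<open>p \<notin> T\<close>, and it orients \<open>T\<close> itself.
\<close>

definition rank :: "point set \<Rightarrow> point \<Rightarrow> nat" where
  "rank T p = count_below (\<lambda>a. (fst p, a) \<in> T) (snd p)"

lemma rank_Suc: "rank T (j, Suc a) = rank T (j, a) + of_bool ((j, a) \<in> T)"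
  by (simp add: rank_def)

text \<open>Both sides count the pairs of an element of \<open>f\<close> and one of \<open>g\<close> below \<open>w\<close>, by their order.\<close>

lemma inversions:
  assumes "\<And>a. \<not> (f a \<and> g a)"
  shows "(\<Sum>a | a < w \<and> f a. count_below g a) + (\<Sum>a | a < w \<and> g a. count_below f a) =
    count_below f w * count_below g w"
proof (induction w)
  case (Suc w)
  have split: "(\<Sum>a | a < Suc w \<and> f a. count_below g a) =
      (\<Sum>a | a < w \<and> f a. count_below g a) + of_bool (f w) * count_below g w" for f g
  proof -
    have "{a. a < Suc w \<and> f a} =
        (if f w then insert w {a. a < w \<and> f a} else {a. a < w \<and> f a})"
      by (auto simp: less_Suc_eq)
    then show ?thesis by simp
  qed
  show ?case using Suc assms[of w] unfolding split[of f g] split[of g f]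
    by (auto simp: algebra_simps)
qed simp

lemma even_sum_same_parity:
  fixes h :: "'a \<Rightarrow> nat"
  assumes "finite A" "\<And>x. x \<in> A \<Longrightarrow> even (h x) = even k"
  shows "even (sum h A) = even (card A * k)"
  using assms by (induction A) auto

lemma even_sum_cong:
  fixes h k :: "'a \<Rightarrow> nat"
  assumes "\<And>x. x \<in> A \<Longrightarrow> even (h x) = even (k x)"
  shows "even (sum h A) = even (sum k A)"
  using assms by (induction A rule: infinite_finite_induct) auto

text \<open>The signs along the elements of \<open>f\<close> alternate and start with
  \<open>1\<close>. This is the winding number of a circle that meets the ray in alternating
  directions.\<close>

lemma alternating_sum:
  "(\<Sum>a | a < w \<and> f a. if even (count_below f a) then 1 else - 1) =
    (if odd (count_below f w) then 1 else (0 :: int))"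
proof (induction w)
  case (Suc w)
  have "{a. a < Suc w \<and> f a} =
      (if f w then insert w {a. a < w \<and> f a} else {a. a < w \<and> f a})"
    by (auto simp: less_Suc_eq)
  then show ?case using Suc by auto
qed simp

context flat
begin

text \<open>Position \<open>fst C\<close> is one beyond the last point of the base ray, so all
  points of \<open>c\<close> on this ray are counted.\<close>

definition base_count :: "point set \<Rightarrow> nat" where
  "base_count c = rank c (0, fst C)"

lemma base_points_lt: "c \<in> components C \<Longrightarrow> (0, a) \<in> c \<Longrightarrow> a < fst C"
  using component_subset[OF annular] by (fastforce simp: points_def)

lemma rank_straight:
  assumes "saturated C T" "(p, q) \<in> straight_arcs C"
  shows "even (rank T p) = even (rank T q)"
proof -
  consider (layer) j a b where "p = (j, a)" "q = (Suc j, b)" "j < length (layers C)"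
      "(a, b) \<in> through (layers C ! j) (width C j)"
    | (wrap) a where "p = (length (layers C), a)" "q = (0, a)" "a < fst C"
    using assms by (auto simp: straight_arcs_def)
  then show ?thesis
  proof cases
    case layer
    have arcs_in: "((j, x), (Suc j, y)) \<in> straight_arcs C"
      if "(x, y) \<in> through (layers C ! j) (width C j)" for x y
      using that layer by (auto simp: straight_arcs_def)
    have turns_in: "((j, x), (j, y)) \<in> turning_arcs C" if "(x, y) \<in> bottom_turns (layers C ! j)" for x y
      using that layer unfolding turning_arcs_def by blast
    have turns_in': "((Suc j, x), (Suc j, y)) \<in> turning_arcs C" if "(x, y) \<in> top_turns (layers C ! j)" for x y
      using that layer unfolding turning_arcs_def by blast
    show ?thesis unfolding layer rank_def fst_conv snd_conv
      by (rule through_parity[OF no_cross admissible_layer])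
        (use layer arcs_in turns_in turns_in' saturated_iff[OF assms(1)] in blast)+
  next
    case wrap
    have "((length (layers C), x), (0, x)) \<in> straight_arcs C" if "x < fst C" for x
      using that by (auto simp: straight_arcs_def)
    then have "rank T p = rank T q" unfolding wrap rank_def fst_conv snd_conv
      using wrap saturated_iff[OF assms(1)] by (intro count_below_cong) (meson UnI1 order.strict_trans)
    then show ?thesis by simp
  qed
qed

lemma rank_turning:
  assumes "(p, q) \<in> turning_arcs C"
  shows "rank T q = rank T p + of_bool (p \<in> T)"
proof -
  have "q = (fst p, Suc (snd p))" using turning_arcD[OF assms] by (simp add: prod_eq_iff)
  then show ?thesis using rank_Suc[of T "fst p" "snd p"] by simp
qed

text \<open>A discrete Jordan curve argument: \<open>c\<close> stays on one side of
  \<open>c'\<close>. Through arcs keep the parity of the rank, and at a turn of \<open>c\<close> the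
  two ends are adjacent, so no point of \<open>c'\<close> is passed.\<close>

lemma rank_other_constant:
  assumes "c \<in> components C" "c' \<in> components C" "c \<noteq> c'" "p \<in> c" "q \<in> c"
  shows "even (rank c' p) = even (rank c' q)"
proof (rule constant_on_component[OF assms(1) annular _ assms(4,5)])
  fix x y assume "(x, y) \<in> straight_arcs C \<union> turning_arcs C" "x \<in> c" "y \<in> c"
  then show "even (rank c' x) = even (rank c' y)"
    using rank_straight[OF saturated_component[OF annular assms(2)], of x y] rank_turning[of x y c']
      components_disjoint[OF assms(1,2), of x] assms(3) by auto
qed

text \<open>The parity of \<open>rank c\<close> is kept by through arcs and changed by turns of
  \<open>c\<close>, so it is itself an orientation of \<open>c\<close>. A circle has only two
  orientations.\<close>

lemma orientation_rank_constant:
  assumes "c \<in> components C" "orientation C ori" "p \<in> c" "q \<in> c"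
  shows "(ori p \<longleftrightarrow> even (rank c p)) \<longleftrightarrow> (ori q \<longleftrightarrow> even (rank c q))"
proof (rule constant_on_component[OF assms(1) annular _ assms(3,4)])
  fix x y assume "(x, y) \<in> straight_arcs C \<union> turning_arcs C" "x \<in> c" "y \<in> c"
  then show "(ori x \<longleftrightarrow> even (rank c x)) \<longleftrightarrow> (ori y \<longleftrightarrow> even (rank c y))"
    using rank_straight[OF saturated_component[OF annular assms(1)], of x y] rank_turning[of x y c]
      assms(2) unfolding orientation_def by fastforce
qed

text \<open>It supplies the orientation asked for by the existential quantifier in
  \<open>essential\<close>, and it is the same for all smoothings.\<close>

lemma checkerboard_orientation: "orientation C (\<lambda>p. even (snd p))"
proof -
  have "even (snd p) = even (snd q)" if "(p, q) \<in> straight_arcs C" for p q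
    by (rule straight_arcD(5)[OF that])
  moreover have "even (snd p) \<noteq> even (snd q)" if "(p, q) \<in> turning_arcs C" for p q
    using turning_arcD(4)[OF that] by simp
  ultimately show ?thesis unfolding orientation_def by blast
qed

text \<open>Up to a global sign \<open>t\<close>, an orientation of \<open>c\<close> is the parity
  of its rank. So consecutive points of \<open>c\<close> on the base ray have opposite signs, and
  the winding number is \<open>0\<close>, \<open>1\<close> or \<open>-1\<close>.\<close>

lemma winding_parity:
  assumes c: "c \<in> components C" and ori: "orientation C ori"
  shows "winding ori c \<noteq> 0 \<longleftrightarrow> odd (base_count c)"
proof -
  let ?A = "{a. a < fst C \<and> (0, a) \<in> c}"
  have "{p \<in> c. fst p = 0} = Pair 0 ` ?A"
    using base_points_lt[OF c] by (auto simp: image_iff)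
  then have w: "winding ori c = (\<Sum>a\<in>?A. if ori (0, a) then 1 else - 1)"
    unfolding winding_def by (simp add: sum.reindex inj_on_def)
  obtain t where t: "\<And>p. p \<in> c \<Longrightarrow> ori p \<longleftrightarrow> (even (rank c p) \<longleftrightarrow> t)"
    using orientation_rank_constant[OF c ori] component_nonempty[OF c] by (metis ex_in_conv)
  have "winding ori c = (\<Sum>a\<in>?A. (if t then 1 else - 1) * (if even (rank c (0, a)) then 1 else - 1))"
    unfolding w by (rule sum.cong) (use t in auto)
  also have "\<dots> = (if t then 1 else - 1) *
      (\<Sum>a\<in>?A. (if even (count_below (\<lambda>a. (0, a) \<in> c) a) then 1 else - 1))"
    by (simp add: rank_def sum_distrib_left)
  also have "\<dots> = (if t then 1 else - 1) * (if odd (base_count c) then 1 else 0)"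
    unfolding alternating_sum base_count_def rank_def by simp
  finally show ?thesis by auto
qed

lemma essential_iff: "c \<in> components C \<Longrightarrow> essential C c \<longleftrightarrow> odd (base_count c)"
  unfolding essential_def using winding_parity checkerboard_orientation by blast

text \<open>Pairs of a point of \<open>c\<close> and a point of \<open>c'\<close> on the base ray
  are counted according to their order. By \<open>rank_other_constant\<close>, each of the two sums
  is modulo \<open>2\<close> a number of points times a constant rank.\<close>

lemma linking_parity:
  assumes "c \<in> components C" "c' \<in> components C" "c \<noteq> c'" "(0, a) \<in> c" "(0, a') \<in> c'"
  shows "even (base_count c * rank c' (0, a) + base_count c' * rank c (0, a')) =
    even (base_count c * base_count c')"
proof -
  have sum_par: "even (\<Sum>x | x < fst C \<and> (0, x) \<in> d. count_below (\<lambda>x. (0, x) \<in> d') x) =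
      even (base_count d * rank d' (0, y))"
    if "d \<in> components C" "d' \<in> components C" "d \<noteq> d'" "(0, y) \<in> d" for d d' y
  proof -
    have "even (\<Sum>x | x < fst C \<and> (0, x) \<in> d. count_below (\<lambda>x. (0, x) \<in> d') x) =
      even (card {x. x < fst C \<and> (0, x) \<in> d} * rank d' (0, y))"
      using rank_other_constant[OF that(1-3) _ that(4)]
      by (intro even_sum_same_parity) (auto simp: rank_def)
    then show ?thesis by (simp add: base_count_def rank_def count_below_def)
  qed
  have "(\<Sum>x | x < fst C \<and> (0, x) \<in> c. count_below (\<lambda>x. (0, x) \<in> c') x) +
    (\<Sum>x | x < fst C \<and> (0, x) \<in> c'. count_below (\<lambda>x. (0, x) \<in> c) x) =
    base_count c * base_count c'" (is "?S + ?S' = _")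
    unfolding base_count_def rank_def fst_conv snd_conv
    by (rule inversions) (use components_disjoint[OF assms(1,2)] assms(3) in blast)
  then have "even (base_count c * base_count c') = even (?S + ?S')" by simp
  also have "\<dots> = (even ?S = even ?S')" by (rule even_add)
  also have "even ?S = even (base_count c * rank c' (0, a))"
    by (rule sum_par) (use assms in auto)
  also have "even ?S' = even (base_count c' * rank c (0, a'))"
    by (rule sum_par) (use assms in auto)
  finally show ?thesis unfolding even_add ..
qed

lemma base_count_odd_ex:
  assumes "odd (base_count c)"
  shows "(0, first_position c) \<in> c"
proof -
  have "{a. a < fst C \<and> (0, a) \<in> c} \<noteq> {}"
    using assms unfolding base_count_def rank_def count_below_def fst_conv snd_conv
    by (metis card.empty even_zero)
  then show ?thesis unfolding first_position_def by (metis (mono_tags, lifting) Collect_empty_eq LeastI)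
qed

lemma rank_first_position: "a \<le> first_position c \<Longrightarrow> rank c (0, a) = 0"
proof -
  assume "a \<le> first_position c"
  then have "(0, x) \<notin> c" if "x < a" for x
    using that not_less_Least[of x "\<lambda>a. (0, a) \<in> c"] by (simp add: first_position_def)
  then have "{x. x < a \<and> (0, x) \<in> c} = {}" by blast
  then show ?thesis by (simp add: rank_def count_below_def)
qed

text \<open>Geometrically, a trivial circle does not enclose an essential one.
  \<open>linking_parity\<close> gives this if \<open>c'\<close> meets the base ray; otherwise the
  rank is \<open>0\<close>.\<close>

lemma rank_trivial:
  assumes "c \<in> components C" "c' \<in> components C" "c \<noteq> c'" "(0, a) \<in> c"
    "odd (base_count c)" "even (base_count c')"
  shows "even (rank c' (0, a))"
proof (cases "\<exists>a'. (0, a') \<in> c'")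
  case True
  then obtain a' where "(0, a') \<in> c'" by blast
  from linking_parity[OF assms(1-4) this] assms show ?thesis by simp
next
  case False
  then show ?thesis by (simp add: rank_def count_below_def)
qed

text \<open>By \<open>linking_parity\<close> exactly one of the two circles lies on the odd side of
  the other. It cannot be the one with the smaller first position, whose first point has rank
  \<open>0\<close>.\<close>

lemma rank_essential:
  assumes "c \<in> components C" "c' \<in> components C" "c \<noteq> c'"
    "odd (base_count c)" "odd (base_count c')"
  shows "odd (rank c' (0, first_position c)) \<longleftrightarrow> first_position c' < first_position c"
proof -
  note fc = base_count_odd_ex[OF assms(4)] and fc' = base_count_odd_ex[OF assms(5)]
  have ne: "first_position c \<noteq> first_position c'"
    using fc fc' components_disjoint[OF assms(1,2)] assms(3) by metis
  have par: "even (rank c' (0, first_position c)) \<noteq> even (rank c (0, first_position c'))"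
    using linking_parity[OF assms(1-3) fc fc'] assms by auto
  show ?thesis
  proof (cases "first_position c' < first_position c")
    case True
    then show ?thesis using par rank_first_position[of "first_position c'" c] by auto
  next
    case False
    then show ?thesis using ne rank_first_position[of "first_position c" c'] by auto
  qed
qed

lemma sum_rank_components:
  assumes "a \<le> fst C"
  shows "(\<Sum>c\<in>components C. rank c (0, a)) = a"
proof -
  have "{x. x < a} = (\<Union>c\<in>components C. {x. x < a \<and> (0, x) \<in> c})"
  proof -
    have "(0, x) \<in> \<Union> (components C)" if "x < a" for x
      unfolding Union_components[OF annular] using that assms by (auto simp: points_def)
    then show ?thesis by blast
  qed
  then have "a = card (\<Union>c\<in>components C. {x. x < a \<and> (0, x) \<in> c})"
    by (metis card_Collect_less_nat)
  also have "\<dots> = (\<Sum>c\<in>components C. card {x. x < a \<and> (0, x) \<in> c})"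
  proof (rule card_UN_disjoint[OF finite_components[OF annular]])
    show "\<forall>c\<in>components C. \<forall>c'\<in>components C. c \<noteq> c' \<longrightarrow>
      {x. x < a \<and> (0, x) \<in> c} \<inter> {x. x < a \<and> (0, x) \<in> c'} = {}"
      using components_disjoint by blast
  qed simp
  finally show ?thesis by (simp add: rank_def count_below_def)
qed

text \<open>The first position of \<open>c\<close> is the number of points before it on the ray.
  Modulo \<open>2\<close> each essential circle further inside contributes \<open>1\<close> and
  every other circle \<open>0\<close>, so it has the parity of the number of essential circles
  inside \<open>c\<close>. The index is one more.\<close>

lemma essential_index_parity:
  assumes c: "c \<in> components C" and ess: "essential C c"
  shows "odd (essential_index C c) \<longleftrightarrow> even (first_position c)"
proof -
  have odd_c: "odd (base_count c)" using essential_iff c ess by simp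
  let ?a = "first_position c"
  note fc = base_count_odd_ex[OF odd_c]
  let ?E = "{c' \<in> essential_circles C. first_position c' < ?a}"
  have fin: "finite (components C)" by (rule finite_components[OF annular])
  have idx: "{c' \<in> essential_circles C. first_position c' \<le> ?a} = insert c ?E"
  proof -
    have "c' = c" if "c' \<in> essential_circles C" "first_position c' = ?a" for c'
    proof -
      have "c' \<in> components C" "odd (base_count c')"
        using that essential_iff by (auto simp: essential_circles_def)
      then show ?thesis using base_count_odd_ex that fc components_disjoint c by metis
    qed
    then show ?thesis using c ess by (auto simp: essential_circles_def order_le_less)
  qed
  have "even (rank c' (0, ?a)) \<longleftrightarrow> even (of_bool (c' \<in> ?E) :: nat)" if "c' \<in> components C" for c'
  proof (cases "c' = c")
    case True
    then show ?thesis using rank_first_position[of ?a c] by auto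
  next
    case False
    then show ?thesis
      using that rank_trivial[OF c that _ fc odd_c] rank_essential[OF c that _ odd_c] essential_iff[OF that]
      by (auto simp: essential_circles_def)
  qed
  then have "even (\<Sum>c'\<in>components C. rank c' (0, ?a)) \<longleftrightarrow>
      even (\<Sum>c'\<in>components C. of_bool (c' \<in> ?E) :: nat)"
    by (intro even_sum_cong)
  moreover have "(\<Sum>c'\<in>components C. rank c' (0, ?a)) = ?a"
    using base_points_lt[OF c fc] by (intro sum_rank_components) simp
  moreover have "(\<Sum>c'\<in>components C. of_bool (c' \<in> ?E) :: nat) = card ?E"
    using fin by (simp add: essential_circles_def Int_def conj_ac)
  ultimately have "even ?a \<longleftrightarrow> even (card ?E)" by simp
  moreover have "essential_index C c = Suc (card ?E)"
    unfolding essential_index_def idx using fin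
    by (subst card_insert_disjoint) (auto simp: essential_circles_def)
  ultimately show ?thesis by simp
qed

text \<open>For a circle obtained by a merge, this compares points on the base ray that come from
  different circles before the merge.\<close>

lemma position_rank_constant:
  assumes "c \<in> components C" "p \<in> c" "q \<in> c"
  shows "even (snd p + rank c p) = even (snd q + rank c q)"
  using orientation_rank_constant[OF assms(1) checkerboard_orientation assms(2,3)] by auto

end

section \<open>Saddles\<close>

lemma fst_smoothing [simp]: "fst (smoothing D u) = fst D"
  by (simp add: smoothing_def)

lemma length_smoothing [simp]: "length (layers (smoothing D u)) = length (layers D)"
  by (simp add: smoothing_def layers_def)

lemma layers_smoothing:
  "j < length (layers D) \<Longrightarrow> layers (smoothing D u) ! j = smooth_layer (j \<in> u) (layers D ! j)"
  by (simp add: smoothing_def layers_def)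

lemma top_width_smooth [simp]: "top_width (smooth_layer w l) = top_width l"
  by (cases l) (auto simp: fun_eq_iff)

lemma width_smoothing:
  "j \<le> length (layers D) \<Longrightarrow> width (smoothing D u) j = width D j"
  by (induction j) (auto simp: width_Suc layers_smoothing)

lemma points_smoothing: "points (smoothing D u) = points D"
  by (auto simp: points_def width_smoothing)

lemma flat_smoothing:
  assumes "annular_diagram D"
  shows "flat (smoothing D u)"
proof
  have "admissible (smooth_layer w l) n" if "admissible l n" for w l n
    using that by (cases l) auto
  then show "annular_diagram (smoothing D u)"
    using assms by (auto simp: annular_diagram_def width_smoothing layers_smoothing)
  have "\<not> is_cross (smooth_layer w l)" for w l
    by (cases l) (auto simp: is_cross_def)
  then show "\<not> is_cross (layers (smoothing D u) ! j)" if "j < length (layers (smoothing D u))" for j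
    using that by (simp add: layers_smoothing)
qed

text \<open>Two smoothings that differ at one crossing, without fixing which one is the
  \<open>0\<close>-smoothing. By this symmetry every statement on the passage from \<open>C\<close>
  to \<open>C'\<close> also holds backwards, and a split is a merge read in reverse.\<close>

locale flat_pair =
  fixes C C' :: diagram and j i :: nat
  assumes flat: "flat C" and flat': "flat C'"
    and fst_eq: "fst C' = fst C" and length_eq: "length (layers C') = length (layers C)"
    and j_less: "j < length (layers C)"
    and layer_eq: "\<And>l. l < length (layers C) \<Longrightarrow> l \<noteq> j \<Longrightarrow> layers C' ! l = layers C ! l"
    and i_less: "i + 2 \<le> width C j"
    and width_eq: "\<And>l. l \<le> length (layers C) \<Longrightarrow> width C' l = width C l"
    and layers_j: "(layers C ! j = Straight \<and> layers C' ! j = CapCup i) \<or>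
      (layers C ! j = CapCup i \<and> layers C' ! j = Straight)"
begin

sublocale C: flat C by (rule flat)
sublocale C': flat C' by (rule flat')

lemma flip: "flat_pair C' C j i"
  using flat flat' fst_eq length_eq j_less layer_eq i_less width_eq layers_j
  by unfold_locales auto

lemma points_eq: "points C' = points C"
  using length_eq width_eq by (auto simp: points_def)

abbreviation "P \<equiv> (j, i)"
abbreviation "Q \<equiv> (j, Suc i)"
abbreviation "P' \<equiv> (Suc j, i)"
abbreviation "Q' \<equiv> (Suc j, Suc i)"

lemma width_Suc_j: "width C (Suc j) = width C j"
  using layers_j j_less by (auto simp: width_Suc)

lemma ends_points: "P \<in> points C" "Q \<in> points C" "P' \<in> points C" "Q' \<in> points C"
  using i_less j_less width_Suc_j by (auto simp: points_def)

lemma straight_local: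
  assumes "layers C ! j = Straight"
  shows "(P, P') \<in> straight_arcs C" "(Q, Q') \<in> straight_arcs C"
  using assms i_less j_less by (auto simp: straight_arcs_def)

lemma turning_local:
  assumes "layers C ! j = CapCup i"
  shows "(P, Q) \<in> turning_arcs C" "(P', Q') \<in> turning_arcs C"
  using assms j_less by (auto simp: turning_arcs_def)

lemma go_other:
  assumes "p \<in> points C" "\<not> (d \<and> p \<in> {P, Q})" "\<not> (\<not> d \<and> p \<in> {P', Q'})"
  shows "go C' d p = go C d p"
proof -
  obtain l a where p: "p = (l, a)" by (cases p)
  have l: "l \<le> length (layers C)" using assms p by (simp add: points_def)
  show ?thesis
  proof (cases d)
    case True
    then show ?thesis using l p assms layers_j length_eq layer_eq[of l]
      by (cases "l = j") (auto simp: go_def)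
  next
    case False
    show ?thesis
    proof (cases l)
      case 0
      then show ?thesis using False p length_eq by (simp add: go_def)
    next
      case (Suc m)
      then show ?thesis using False l p assms layers_j length_eq layer_eq[of m]
        by (cases "m = j") (auto simp: go_def)
    qed
  qed
qed

text \<open>The checkerboard orientation runs in opposite directions at the positions
  \<open>i\<close> and \<open>i + 1\<close>. So exactly two of the four ends lead into the crossing,
  the even one at the bottom and the odd one on top, and the two smoothings exchange their
  targets.\<close>

lemma succ_flip:
  assumes C: "layers C ! j = Straight"
  shows "C'.succ = C.succ \<circ> transpose (if even i then P else Q) (if even i then Q' else P')"
proof
  fix p
  have C': "layers C' ! j = CapCup i" using C layers_j by auto
  have go: "go C True (j, a) = (Suc j, a)" "go C False (Suc j, a) = (j, a)" for a
    using C j_less by (auto simp: go_def)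
  have go': "go C' True P = Q" "go C' True Q = P" "go C' False P' = Q'" "go C' False Q' = P'"
    using C' j_less length_eq by (auto simp: go_def)
  show "C'.succ p =
    (C.succ \<circ> transpose (if even i then P else Q) (if even i then Q' else P')) p"
  proof (cases "p = (if even i then P else Q) \<or> p = (if even i then Q' else P')")
    case True
    then show ?thesis
      using ends_points points_eq go go'
      by (auto simp: C.succ_def C'.succ_def split: if_splits)
  next
    case False
    have "C'.succ p = C.succ p"
    proof (cases "p \<in> points C")
      case True
      have "go C' (even (snd p)) p = go C (even (snd p)) p"
        by (rule go_other) (use True False in \<open>auto split: if_splits\<close>)
      then show ?thesis using True points_eq by (simp add: C.succ_def C'.succ_def)
    next
      case False
      then show ?thesis using points_eq by (simp add: C.succ_def C'.succ_def)
    qed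
    then show ?thesis using False by (simp add: transpose_def)
  qed
qed

text \<open>
  This excludes saddles from one circle to one circle: both resolutions carry the checkerboard
  orientation, and \<open>succ_flip\<close> relates their permutations by a transposition.
\<close>

lemma connected_flip_straight:
  assumes C: "layers C ! j = Straight"
  shows "(P, Q') \<in> connected_by C' \<longleftrightarrow> (P, Q') \<notin> connected_by C"
proof -
  have C': "layers C' ! j = CapCup i" using C layers_j by auto
  interpret flip: flat_pair C' C j i by (rule flip)
  note eq = equiv_connected_by
  have PP': "(P, P') \<in> connected_by C" and QQ': "(Q, Q') \<in> connected_by C"
    using straight_local[OF C] arc_connected by blast+
  have PQ: "(P, Q) \<in> connected_by C'" and PQ': "(P', Q') \<in> connected_by C'"
    using flip.turning_local[OF C'] arc_connected by blast+
  \<comment> \<open>The two ends that lead into the crossing. In each of the two diagrams they lie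
    on different local arcs, one containing \<open>P\<close> and the other
    \<open>Q'\<close>.\<close>
  let ?x = "if even i then P else Q" and ?y = "if even i then Q' else P'"
  have "?x \<noteq> ?y" by auto
  from orbit_comp_transpose[OF C.permutation_succ this]
  have "(?x, ?y) \<in> connected_by C' \<longleftrightarrow> (?x, ?y) \<notin> connected_by C"
    using ends_points points_eq
    by (simp only: C.orbit_succ_connected C'.orbit_succ_connected succ_flip[OF C] split: if_split) auto
  moreover have "(?x, ?y) \<in> connected_by C \<longleftrightarrow> (P, Q') \<in> connected_by C"
    using PP' QQ' unfolding component_of_eq_iff[symmetric] by auto
  moreover have "(?x, ?y) \<in> connected_by C' \<longleftrightarrow> (P, Q') \<in> connected_by C'"
    using PQ PQ' unfolding component_of_eq_iff[symmetric] by auto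
  ultimately show ?thesis by blast
qed

lemma connected_flip: "(P, Q') \<in> connected_by C' \<longleftrightarrow> (P, Q') \<notin> connected_by C"
  using layers_j
proof
  assume "layers C ! j = CapCup i \<and> layers C' ! j = Straight"
  then show ?thesis using flat_pair.connected_flip_straight[OF flip] by blast
qed (use connected_flip_straight in blast)

lemma arc_transfer:
  assumes "(p, q) \<in> straight_arcs C' \<union> turning_arcs C'" "\<not> {p, q} \<subseteq> {P, Q, P', Q'}"
  shows "(p, q) \<in> straight_arcs C \<union> turning_arcs C"
proof -
  consider (layer) l a b where "p = (l, a)" "q = (Suc l, b)" "l < length (layers C)"
      "(a, b) \<in> through (layers C' ! l) (width C l)"
    | (wrap) a where "p = (length (layers C), a)" "q = (0, a)" "a < fst C"
    | (bottom) l a b where "p = (l, a)" "q = (l, b)" "l < length (layers C)"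
      "(a, b) \<in> bottom_turns (layers C' ! l)"
    | (top) l a b where "p = (Suc l, a)" "q = (Suc l, b)" "l < length (layers C)"
      "(a, b) \<in> top_turns (layers C' ! l)"
    using assms(1) length_eq fst_eq width_eq by (auto simp: straight_arcs_def turning_arcs_def)
  then show ?thesis
  proof cases
    case layer
    then have "(a, b) \<in> through (layers C ! l) (width C l)"
      using assms(2) layers_j layer_eq[of l] by (cases "l = j") auto
    with layer show ?thesis by (auto simp: straight_arcs_def)
  next
    case wrap
    then show ?thesis by (auto simp: straight_arcs_def)
  next
    case bottom
    then have "(a, b) \<in> bottom_turns (layers C ! l)"
      using assms(2) layers_j layer_eq[of l] by (cases "l = j") auto
    with bottom show ?thesis by (auto simp: turning_arcs_def)
  next
    case top
    then have "(a, b) \<in> top_turns (layers C ! l)"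
      using assms(2) layers_j layer_eq[of l] by (cases "l = j") auto
    with top show ?thesis by (auto simp: turning_arcs_def)
  qed
qed

lemma ends_in: "P \<in> component_of C P" "Q' \<in> component_of C Q'"
  "{P, Q, P', Q'} \<subseteq> component_of C P \<union> component_of C Q'"
proof -
  show "P \<in> component_of C P" "Q' \<in> component_of C Q'" by (rule component_of_self)+
  have sat: "saturated C (component_of C x)" if "x \<in> points C" for x
    by (rule saturated_component[OF C.annular component_of_in[OF that]])
  show "{P, Q, P', Q'} \<subseteq> component_of C P \<union> component_of C Q'"
    using layers_j straight_local turning_local saturated_iff[OF sat[OF ends_points(1)]]
      saturated_iff[OF sat[OF ends_points(4)]] component_of_self
    by (elim disjE conjE; blast)
qed

lemma saturated_transfer:
  assumes T: "saturated C T" "T \<inter> {P, Q, P', Q'} = {}"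
  shows "saturated C' T"
proof -
  interpret flip: flat_pair C' C j i by (rule flip)
  have "p \<in> T \<longleftrightarrow> q \<in> T" if "(p, q) \<in> straight_arcs C' \<union> turning_arcs C'" for p q
    using arc_transfer[OF that] saturated_iff[OF T(1), of p q] T(2) by blast
  then show ?thesis using T(1) points_eq unfolding saturated_def by blast
qed

text \<open>A circle away from the four ends has the same arcs in both diagrams, hence is saturated
  in \<open>C'\<close>. That it does not fall apart there follows by carrying a component of
  \<open>C'\<close> inside it back to \<open>C\<close>.\<close>

lemma other_component:
  assumes "c \<in> components C" "c \<notin> {component_of C P, component_of C Q'}"
  shows "c \<in> components C'" "c \<notin> {component_of C' P, component_of C' Q'}"
proof -
  interpret flip: flat_pair C' C j i by (rule flip)
  have "c \<inter> (component_of C P \<union> component_of C Q') = {}"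
    using components_disjoint[OF assms(1) component_of_in] ends_points assms(2) by blast
  then have no_ends: "c \<inter> {P, Q, P', Q'} = {}" using ends_in(3) by blast
  have sat: "saturated C' c"
    by (rule saturated_transfer[OF saturated_component[OF C.annular assms(1)] no_ends])
  obtain p where p: "p \<in> points C" "p \<in> c" using component_ex[OF assms(1)] by blast
  let ?c' = "component_of C' p"
  have c': "?c' \<in> components C'" using p(1) points_eq component_of_in by blast
  have "?c' \<subseteq> c"
    by (rule component_subset_saturated[OF sat c' component_of_self p(2)])
  moreover have "c \<subseteq> ?c'"
  proof (rule component_subset_saturated[OF _ assms(1) p(2) component_of_self])
    show "saturated C ?c'"
      by (rule flip.saturated_transfer[OF saturated_component[OF C'.annular c']])
        (use \<open>?c' \<subseteq> c\<close> no_ends in blast)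
  qed
  ultimately have "c = ?c'" by blast
  then show "c \<in> components C'" using c' by simp
  show "c \<notin> {component_of C' P, component_of C' Q'}"
    using no_ends component_of_self by blast
qed

lemma other_components:
  "components C' - {component_of C' P, component_of C' Q'} =
    components C - {component_of C P, component_of C Q'}"
proof
  show "components C - {component_of C P, component_of C Q'} \<subseteq>
    components C' - {component_of C' P, component_of C' Q'}"
    using other_component by (intro subsetI DiffI) simp_all
  show "components C' - {component_of C' P, component_of C' Q'} \<subseteq>
    components C - {component_of C P, component_of C Q'}"
    using flat_pair.other_component[OF flip] by (intro subsetI DiffI) simp_all
qed

text \<open>Each side is the complement of the unchanged circles in the common set of
  points.\<close>

lemma Union_ends:
  "component_of C' P \<union> component_of C' Q' = component_of C P \<union> component_of C Q'"
proof -
  have eq: "component_of E P \<union> component_of E Q' =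
      points E - \<Union> (components E - {component_of E P, component_of E Q'})"
    if "annular_diagram E" "P \<in> points E" "Q' \<in> points E" for E
  proof -
    have ends: "component_of E P \<in> components E" "component_of E Q' \<in> components E"
      using that component_of_in by simp_all
    show ?thesis
    proof (intro equalityI subsetI DiffI)
      fix x assume x: "x \<in> component_of E P \<union> component_of E Q'"
      then show "x \<in> points E" using ends component_subset[OF that(1)] by blast
      show "x \<notin> \<Union> (components E - {component_of E P, component_of E Q'})"
      proof
        assume "x \<in> \<Union> (components E - {component_of E P, component_of E Q'})"
        then obtain c where "c \<in> components E" "x \<in> c" "c \<noteq> component_of E P" "c \<noteq> component_of E Q'"
          by auto
        then show False
          using x components_disjoint[OF _ ends(1), of c x] components_disjoint[OF _ ends(2), of c x]
          by auto
      qed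
    next
      fix x assume "x \<in> points E - \<Union> (components E - {component_of E P, component_of E Q'})"
      then have "component_of E x \<in> {component_of E P, component_of E Q'}"
        using component_of_in[of x E] component_of_self[of x E] by blast
      then show "x \<in> component_of E P \<union> component_of E Q'" using component_of_self[of x E] by auto
    qed
  qed
  show ?thesis
    using eq[OF C.annular] eq[OF C'.annular] ends_points points_eq other_components by simp
qed

lemma ends_flip:
  "component_of C' P = component_of C' Q' \<longleftrightarrow> component_of C P \<noteq> component_of C Q'"
  using connected_flip by (simp add: component_of_eq_iff)

text \<open>This decides which edges of the cube are nonzero. A colouring always passes through a
  split, and it passes through a merge iff the two circles have equal colour.\<close>

lemma saturated_pair_iff:
  assumes "saturated C T"
  shows "saturated C' T \<longleftrightarrow> (P \<in> T \<longleftrightarrow> Q' \<in> T)"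
proof -
  have PQ: "P \<in> component_of E P" "Q' \<in> component_of E Q'" for E
    by (rule component_of_self)+
  show ?thesis
  proof (cases "component_of C P = component_of C Q'")
    case True
    then have "(P, Q') \<in> connected_by C" by (simp add: component_of_eq_iff)
    then have iff: "P \<in> T \<longleftrightarrow> Q' \<in> T" by (rule saturated_connected[OF assms])
    have in_C': "component_of C' P \<subseteq> component_of C P" "component_of C' Q' \<subseteq> component_of C P"
      using Union_ends True by auto
    \<comment> \<open>The circle through both ends is cut into parts of itself, so \<open>T\<close>
      remains a union of circles.\<close>
    have "T = \<Union> {c \<in> components C'. c \<subseteq> T}"
    proof
      show "T \<subseteq> \<Union> {c \<in> components C'. c \<subseteq> T}"
      proof
        fix x assume x: "x \<in> T"
        then have xp: "x \<in> points C" using assms by (auto simp: saturated_def)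
        let ?c = "component_of C x"
        have c: "?c \<in> components C" "x \<in> ?c" using xp component_of_in component_of_self by blast+
        then have cT: "?c \<subseteq> T" using component_subset_saturated[OF assms] x by blast
        show "x \<in> \<Union> {c \<in> components C'. c \<subseteq> T}"
        proof (cases "?c = component_of C P")
          case True
          then have "x \<in> component_of C' P \<union> component_of C' Q'" using c Union_ends by blast
          moreover have "component_of C' P \<in> components C'" "component_of C' Q' \<in> components C'"
            using ends_points points_eq component_of_in by blast+
          ultimately show ?thesis using cT True in_C' by blast
        next
          case False
          then have "?c \<in> components C'" using other_component[OF c(1)] \<open>component_of C P = _\<close> by blast
          then show ?thesis using c cT by blast
        qed
      qed
    qed blast
    then have "saturated C' T" using saturated_Union[OF C'.annular] by (metis (no_types, lifting) mem_Collect_eq subsetI)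
    then show ?thesis using iff by simp
  next
    case False
    then have C'_eq: "component_of C' P = component_of C' Q'" using ends_flip by blast
    show ?thesis
    proof
      assume "saturated C' T"
      then show "P \<in> T \<longleftrightarrow> Q' \<in> T"
        using saturated_connected C'_eq by (simp add: component_of_eq_iff)
    next
      assume iff: "P \<in> T \<longleftrightarrow> Q' \<in> T"
      have ends: "{P, Q, P', Q'} \<subseteq> T" if "P \<in> T"
      proof -
        have "component_of C P \<subseteq> T" "component_of C Q' \<subseteq> T"
          using component_subset_saturated[OF assms component_of_in component_of_self] ends_points that iff
          by blast+
        then show ?thesis using ends_in(3) by blast
      qed
      have no_ends: "T \<inter> {P, Q, P', Q'} = {}" if "P \<notin> T"
      proof -
        have "x \<notin> T" if "x \<in> component_of C P \<union> component_of C Q'" for x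
          using that \<open>P \<notin> T\<close> iff saturated_connected[OF assms, of P x]
            saturated_connected[OF assms, of Q' x] by (auto simp: component_of_def)
        then show ?thesis using ends_in(3) by blast
      qed
      have "p \<in> T \<longleftrightarrow> q \<in> T" if "(p, q) \<in> straight_arcs C' \<union> turning_arcs C'" for p q
      proof (cases "{p, q} \<subseteq> {P, Q, P', Q'}")
        case True
        then have pq: "p \<in> {P, Q, P', Q'}" "q \<in> {P, Q, P', Q'}" by simp_all
        show ?thesis
        proof (cases "P \<in> T")
          case True
          then show ?thesis using subsetD[OF ends pq(1)] subsetD[OF ends pq(2)] by simp
        next
          case False
          then show ?thesis using no_ends[OF False] pq by (metis IntI empty_iff)
        qed
      next
        case False
        then show ?thesis using arc_transfer[OF that] saturated_iff[OF assms, of p q] by blast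
      qed
      then show "saturated C' T" using assms points_eq unfolding saturated_def by blast
    qed
  qed
qed

end

definition ctype :: "diagram \<Rightarrow> point set \<Rightarrow> bool option" where
  "ctype C c = (if essential C c then Some (even (essential_index C c)) else None)"

lemma rank_Un: "A \<inter> B = {} \<Longrightarrow> rank (A \<union> B) p = rank A p + rank B p"
proof -
  assume "A \<inter> B = {}"
  then have "count_below (\<lambda>a. (l, a) \<in> A \<union> B) x =
      count_below (\<lambda>a. (l, a) \<in> A) x + count_below (\<lambda>a. (l, a) \<in> B) x" for l x
    by (induction x) (auto simp: disjoint_iff)
  then show ?thesis by (simp add: rank_def)
qed

text \<open>The right-hand side involves only the points of \<open>c\<close> and the width of the
  base ray, so it can be compared between different diagrams.\<close>

lemma (in flat) ctype_eq:
  "c \<in> components C \<Longrightarrow> ctype C c =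
    (if odd (rank c (0, fst C)) then Some (odd (first_position c)) else None)"
  using essential_iff[of c] essential_index_parity[of c] by (auto simp: ctype_def base_count_def)

lemma fuse_commute: "fuse t1 t2 t \<longleftrightarrow> fuse t2 t1 t"
  by (auto simp: fuse_def)

text \<open>Base counts add, which decides whether the union is essential. For the types, two first
  points are compared on the merged circle by \<open>position_rank_constant\<close>. If only
  \<open>d\<close> is essential, then \<open>e\<close> has even rank at \<open>d\<close> and the
  parity of the first position is kept. If both circles are essential, \<open>linking_parity\<close>
  makes the parities of their first positions opposite.\<close>

lemma fuse_circles:
  assumes C: "flat C" and C': "flat C'" and eq: "fst C' = fst C"
    and a: "a \<in> components C" "b \<in> components C" "a \<noteq> b" and ab: "a \<union> b \<in> components C'"
  shows "fuse (ctype C a) (ctype C b) (ctype C' (a \<union> b))"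
proof -
  interpret C: flat C by (rule C)
  interpret C': flat C' by (rule C')
  have dis: "a \<inter> b = {}" using components_disjoint[OF a(1,2)] a(3) by blast
  note un = rank_Un[OF dis]
  let ?n = "fst C"
  have trivial: "fuse (ctype C d) (ctype C e) (ctype C' (d \<union> e))"
    if d: "d \<in> components C" "odd (rank d (0, ?n))" and e: "e \<in> components C" "even (rank e (0, ?n))"
      and de: "d \<noteq> e" "d \<inter> e = {}" "d \<union> e \<in> components C'" for d e
  proof -
    have odd_un: "odd (rank (d \<union> e) (0, ?n))" using d e rank_Un[OF de(2)] by simp
    have fd: "(0, first_position d) \<in> d"
      using C.base_count_odd_ex d by (simp add: C.base_count_def)
    have fu: "(0, first_position (d \<union> e)) \<in> d \<union> e"
      using C'.base_count_odd_ex[of "d \<union> e"] odd_un eq by (simp add: C'.base_count_def)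
    have "even (first_position (d \<union> e) + rank (d \<union> e) (0, first_position (d \<union> e))) =
      even (first_position d + rank (d \<union> e) (0, first_position d))"
      using C'.position_rank_constant[OF de(3) fu, of "(0, first_position d)"] fd by simp
    moreover have "rank (d \<union> e) (0, first_position (d \<union> e)) = 0" "rank d (0, first_position d) = 0"
      using C.rank_first_position by auto
    moreover have "even (rank e (0, first_position d))"
      using C.rank_trivial[OF d(1) e(1) de(1) fd] d e by (simp add: C.base_count_def)
    ultimately have "even (first_position (d \<union> e)) = even (first_position d)"
      by (simp add: rank_Un[OF de(2)])
    then show ?thesis using d e de odd_un eq by (simp add: C.ctype_eq C'.ctype_eq fuse_def)
  qed
  show ?thesis
  proof (cases "odd (rank a (0, ?n))"; cases "odd (rank b (0, ?n))")
    assume odd: "odd (rank a (0, ?n))" "odd (rank b (0, ?n))"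
    then have fa: "(0, first_position a) \<in> a" and fb: "(0, first_position b) \<in> b"
      using C.base_count_odd_ex by (simp_all add: C.base_count_def)
    have "even (first_position a + rank (a \<union> b) (0, first_position a)) =
      even (first_position b + rank (a \<union> b) (0, first_position b))"
      using C'.position_rank_constant[OF ab, of "(0, first_position a)" "(0, first_position b)"] fa fb
      by simp
    moreover have "rank a (0, first_position a) = 0" "rank b (0, first_position b) = 0"
      using C.rank_first_position by auto
    moreover have "even (rank b (0, first_position a)) \<noteq> even (rank a (0, first_position b))"
      using C.linking_parity[OF a fa fb] odd by (auto simp: C.base_count_def)
    ultimately have "even (first_position a) \<noteq> even (first_position b)"
      unfolding un by auto
    then show ?thesis using odd a ab eq un by (auto simp: C.ctype_eq C'.ctype_eq fuse_def)
  next
    assume "odd (rank a (0, ?n))" "\<not> odd (rank b (0, ?n))"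
    then show ?thesis using trivial[of a b] a dis ab by simp
  next
    assume "\<not> odd (rank a (0, ?n))" "odd (rank b (0, ?n))"
    then have "fuse (ctype C b) (ctype C a) (ctype C' (b \<union> a))"
      using trivial[of b a] a dis ab by (simp add: Un_commute Int_commute)
    then show ?thesis by (simp add: fuse_commute Un_commute)
  next
    assume "\<not> odd (rank a (0, ?n))" "\<not> odd (rank b (0, ?n))"
    then show ?thesis using a ab eq un by (simp add: C.ctype_eq C'.ctype_eq fuse_def)
  qed
qed

context flat_pair
begin

text \<open>The index of \<open>c\<close> may drop, for instance when two essential circles inside
  it merge into a trivial one. Its parity is determined by \<open>c\<close> itself and
  stays.\<close>

lemma ctype_other:
  assumes "c \<in> components C - {component_of C P, component_of C Q'}"
  shows "ctype C' c = ctype C c"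
proof -
  have "c \<in> components C' - {component_of C' P, component_of C' Q'}"
    unfolding other_components by (rule assms)
  then have "c \<in> components C" "c \<in> components C'" using assms by simp_all
  then show ?thesis by (simp only: C.ctype_eq C'.ctype_eq fst_eq)
qed

lemma merge:
  assumes "component_of C P \<noteq> component_of C Q'"
  shows "component_of C' Q' = component_of C' P"
    "component_of C' P = component_of C P \<union> component_of C Q'"
    "fuse (ctype C (component_of C P)) (ctype C (component_of C Q')) (ctype C' (component_of C' P))"
proof -
  show 1: "component_of C' Q' = component_of C' P" using ends_flip assms by simp
  show 2: "component_of C' P = component_of C P \<union> component_of C Q'"
    using Union_ends 1 by simp
  have "component_of C' P \<in> components C'" using component_of_in ends_points points_eq by blast
  then show "fuse (ctype C (component_of C P)) (ctype C (component_of C Q')) (ctype C' (component_of C' P))"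
    using fuse_circles[OF flat flat' fst_eq component_of_in[OF ends_points(1)]
      component_of_in[OF ends_points(4)] assms] 2 by simp
qed

end

lemma adeg_eq:
  assumes "annular_diagram C"
  shows "adeg C x = (\<Sum>c\<in>components C. if ctype C c = None then 0 else if c \<in> x then 1 else - 1)"
proof -
  have "adeg C x = (\<Sum>c\<in>components C. if essential C c then if c \<in> x then 1 else - 1 else 0)"
    unfolding adeg_def essential_circles_def
    by (rule sum.inter_filter[OF finite_components[OF assms]])
  also have "\<dots> = (\<Sum>c\<in>components C. if ctype C c = None then 0 else if c \<in> x then 1 else - 1)"
    by (rule sum.cong) (auto simp: ctype_def)
  finally show ?thesis .
qed

lemma flat_pair_smoothing:
  assumes D: "annular_diagram D" and j: "j < length (layers D)" "layers D ! j = Cross i b" "j \<notin> u"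
  shows "flat_pair (smoothing D u) (smoothing D (insert j u)) j i"
proof -
  have "admissible (layers D ! j) (width D j)"
    using D j(1) unfolding annular_diagram_def by blast
  then have "i + 2 \<le> width D j" using j by simp
  then show ?thesis
    using j flat_smoothing[OF D]
    by (intro flat_pair.intro) (auto simp: layers_smoothing width_smoothing)
qed

section \<open>Saddles in the basis of colourings\<close>

text \<open>
  A colouring is given by the set of points of colour \<open>True\<close>. It is a colouring of the circles of
  \<open>C\<close> iff this set is saturated in \<open>C\<close>.
\<close>

lemma subset_saturated_iff:
  "saturated C T \<Longrightarrow> c \<in> components C \<Longrightarrow> p \<in> c \<Longrightarrow> c \<subseteq> T \<longleftrightarrow> p \<in> T"
  using component_subset_saturated by blast

lemma circle_root_ctype: "circle_root C c = type_root (ctype C c)"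
  by (simp add: circle_root_def type_root_def ctype_def)

lemma adeg_deg:
  "annular_diagram C \<Longrightarrow> adeg C x = (\<Sum>c\<in>components C. deg (ctype C c) (c \<in> x))"
  by (simp add: adeg_eq deg_def)

lemma coord_basis_elem: "coord r (basis_elem r e) e' = of_bool (e = e')"
  by (simp add: coord_def basis_elem_def A_one_def)

text \<open>The tensor product of the eigenvectors with the colours given by \<open>k\<close>,
  expanded in the generators; \<open>Cov\<close> is the inverse matrix. The test
  \<open>c \<subseteq> k\<close> is the colour of \<open>c\<close> if \<open>k\<close> is
  saturated.\<close>

definition Mat :: "diagram \<Rightarrow> point set \<Rightarrow> point set set \<Rightarrow> K_alpha" where
  "Mat C k x = (\<Prod>c\<in>components C. vec (ctype C c) (c \<subseteq> k) (c \<in> x))"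

definition Cov :: "diagram \<Rightarrow> point set set \<Rightarrow> point set \<Rightarrow> K_alpha" where
  "Cov C x k = (\<Prod>c\<in>components C. covec (ctype C c) (c \<in> x) (c \<subseteq> k))"

lemma Mat_Cov:
  assumes C: "annular_diagram C" and k: "saturated C k" "saturated C k'"
  shows "(\<Sum>x\<in>Pow (components C). Mat C k x * Cov C x k') = of_bool (k = k')"
proof -
  note fin = finite_components[OF C]
  have "(\<Sum>x\<in>Pow (components C). Mat C k x * Cov C x k') =
      (\<Sum>x\<in>Pow (components C). \<Prod>c\<in>components C.
        (\<lambda>c z. vec (ctype C c) (c \<subseteq> k) z * covec (ctype C c) z (c \<subseteq> k')) c (c \<in> x))"
    by (simp add: Mat_def Cov_def prod.distrib)
  also have "\<dots> = (\<Prod>c\<in>components C. \<Sum>z\<in>UNIV. vec (ctype C c) (c \<subseteq> k) z * covec (ctype C c) z (c \<subseteq> k'))"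
    by (rule sum_Pow_prod[OF fin])
  also have "\<dots> = of_bool (\<forall>c\<in>components C. c \<subseteq> k \<longleftrightarrow> c \<subseteq> k')"
    unfolding vec_covec by (rule prod_of_bool[OF fin])
  also have "(\<forall>c\<in>components C. c \<subseteq> k \<longleftrightarrow> c \<subseteq> k') \<longleftrightarrow> k = k'"
  proof
    assume "\<forall>c\<in>components C. c \<subseteq> k \<longleftrightarrow> c \<subseteq> k'"
    then have "{c \<in> components C. c \<subseteq> k} = {c \<in> components C. c \<subseteq> k'}" by blast
    then have "\<Union> {c \<in> components C. c \<subseteq> k} = \<Union> {c \<in> components C. c \<subseteq> k'}" by simp
    then show "k = k'"
      unfolding saturated_eq_Union[OF C k(1), symmetric] saturated_eq_Union[OF C k(2), symmetric] .
  qed simp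
  finally show ?thesis .
qed

lemma subset_Union_iff:
  assumes "w \<subseteq> components C" "c \<in> components C"
  shows "c \<subseteq> \<Union> w \<longleftrightarrow> c \<in> w"
proof
  assume "c \<subseteq> \<Union> w"
  moreover obtain p where "p \<in> c" using component_nonempty[OF assms(2)] by blast
  ultimately obtain c' where "c' \<in> w" "p \<in> c'" by blast
  then show "c \<in> w" using components_disjoint[OF assms(2), of c' p] \<open>p \<in> c\<close> assms(1) by blast
qed blast

lemma Cov_Mat:
  assumes C: "annular_diagram C" and x: "x \<subseteq> components C" "x' \<subseteq> components C"
  shows "(\<Sum>k | saturated C k. Cov C x k * Mat C k x') = of_bool (x = x')"
proof -
  note fin = finite_components[OF C]
  have "(\<Sum>k | saturated C k. Cov C x k * Mat C k x') =
      (\<Sum>w\<in>Pow (components C). Cov C x (\<Union> w) * Mat C (\<Union> w) x')"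
    by (rule sum.reindex_bij_betw[OF bij_betw_saturated[OF C], symmetric])
  also have "\<dots> = (\<Sum>w\<in>Pow (components C). \<Prod>c\<in>components C.
        (\<lambda>c z. covec (ctype C c) (c \<in> x) z * vec (ctype C c) z (c \<in> x')) c (c \<in> w))"
  proof (rule sum.cong)
    fix w assume "w \<in> Pow (components C)"
    then have "c \<subseteq> \<Union> w \<longleftrightarrow> c \<in> w" if "c \<in> components C" for c
      using subset_Union_iff that by auto
    then show "Cov C x (\<Union> w) * Mat C (\<Union> w) x' = (\<Prod>c\<in>components C.
        (\<lambda>c z. covec (ctype C c) (c \<in> x) z * vec (ctype C c) z (c \<in> x')) c (c \<in> w))"
      unfolding Mat_def Cov_def prod.distrib[symmetric] by (intro prod.cong) simp_all
  qed simp
  also have "\<dots> = (\<Prod>c\<in>components C. \<Sum>z\<in>UNIV. covec (ctype C c) (c \<in> x) z * vec (ctype C c) z (c \<in> x'))"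
    by (rule sum_Pow_prod[OF fin])
  also have "\<dots> = of_bool (\<forall>c\<in>components C. c \<in> x \<longleftrightarrow> c \<in> x')"
    unfolding covec_vec by (rule prod_of_bool[OF fin])
  also have "(\<forall>c\<in>components C. c \<in> x \<longleftrightarrow> c \<in> x') \<longleftrightarrow> x = x'" using x by blast
  finally show ?thesis .
qed

lemma sum_Pow_delta:
  fixes f :: "'a set \<Rightarrow> 'b :: semiring_1"
  assumes "finite A"
  shows "(\<Sum>x\<in>Pow A. of_bool (\<forall>c\<in>A. c \<in> x \<longleftrightarrow> c \<in> y) * f x) = f (y \<inter> A)"
proof -
  have "(\<Sum>x\<in>Pow A. of_bool (\<forall>c\<in>A. c \<in> x \<longleftrightarrow> c \<in> y) * f x) =
      (\<Sum>x\<in>Pow A. if x = y \<inter> A then f x else 0)"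
  proof (rule sum.cong)
    fix x assume "x \<in> Pow A"
    then have "(\<forall>c\<in>A. c \<in> x \<longleftrightarrow> c \<in> y) \<longleftrightarrow> x = y \<inter> A" by blast
    then show "of_bool (\<forall>c\<in>A. c \<in> x \<longleftrightarrow> c \<in> y) * f x = (if x = y \<inter> A then f x else 0)" by simp
  qed simp
  also have "\<dots> = f (y \<inter> A)" using assms by (subst sum.delta) auto
  finally show ?thesis .
qed

text \<open>This is \<open>G_saddle\<close> over the fraction field with both diagrams and both end
  points as parameters, so that it can be treated in \<open>flat_pair\<close>, away from the
  cube.\<close>

definition saddle_entry ::
  "diagram \<Rightarrow> diagram \<Rightarrow> point \<Rightarrow> point \<Rightarrow> point set set \<Rightarrow> point set set \<Rightarrow> K_alpha" where
  "saddle_entry C C' p q x y =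
    (let a1 = component_of C p; a2 = component_of C q; b1 = component_of C' p; b2 = component_of C' q
     in if adeg C x = adeg C' y then
       of_R ((\<Prod>c \<in> components C - {a1, a2}.
            coord (circle_root C' c) (basis_elem (circle_root C c) (c \<in> x)) (c \<in> y)) *
         (if a1 \<noteq> a2
          then coord (circle_root C' b1)
                 (A_mult (basis_elem (circle_root C a1) (a1 \<in> x))
                         (basis_elem (circle_root C a2) (a2 \<in> x)))
                 (b1 \<in> y)
          else coord2 (circle_root C' b1) (circle_root C' b2)
                 (A_comult (basis_elem (circle_root C a1) (a1 \<in> x)))
                 (b1 \<in> y) (b2 \<in> y))) else 0)"

lemma of_R_of_bool [simp]: "of_R (of_bool P) = of_bool P"
  by simp

context flat_pair
begin

abbreviation "a1 \<equiv> component_of C P"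
abbreviation "a2 \<equiv> component_of C Q'"
abbreviation "b1 \<equiv> component_of C' P"
abbreviation "b2 \<equiv> component_of C' Q'"
abbreviation "others \<equiv> components C - {a1, a2}"

lemma comps_C: "a1 \<in> components C" "a2 \<in> components C" "components C = insert a1 (insert a2 others)"
  using component_of_in ends_points by blast+

lemma comps_C': "b1 \<in> components C'" "b2 \<in> components C'" "components C' = insert b1 (insert b2 others)"
proof -
  show b: "b1 \<in> components C'" "b2 \<in> components C'"
    using component_of_in ends_points points_eq by blast+
  then have "components C' = insert b1 (insert b2 (components C' - {b1, b2}))" by blast
  then show "components C' = insert b1 (insert b2 others)" unfolding other_components .
qed

lemma b_notin: "b1 \<notin> others" "b2 \<notin> others"
  unfolding other_components[symmetric] by blast+

lemma finite_others: "finite others"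
  using finite_components[OF C.annular] by blast

lemma others_prod:
  "(\<Prod>c\<in>others. coord (circle_root C' c) (basis_elem (circle_root C c) (c \<in> x)) (c \<in> y)) =
    of_bool (\<forall>c\<in>others. c \<in> x \<longleftrightarrow> c \<in> y)"
proof -
  have "(\<Prod>c\<in>others. coord (circle_root C' c) (basis_elem (circle_root C c) (c \<in> x)) (c \<in> y)) =
      (\<Prod>c\<in>others. of_bool (c \<in> x \<longleftrightarrow> c \<in> y))"
    by (rule prod.cong) (simp_all only: circle_root_ctype ctype_other coord_basis_elem)
  then show ?thesis by (simp only: prod_of_bool[OF finite_others])
qed

lemma others_deg:
  assumes "\<forall>c\<in>others. c \<in> x \<longleftrightarrow> c \<in> y"
  shows "(\<Sum>c\<in>others. deg (ctype C c) (c \<in> x)) = (\<Sum>c\<in>others. deg (ctype C' c) (c \<in> y))"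
  by (rule sum.cong) (use assms ctype_other in auto)

lemma saddle_entry_merge:
  assumes "a1 \<noteq> a2"
  shows "saddle_entry C C' P Q' x y = of_bool (\<forall>c\<in>others. c \<in> x \<longleftrightarrow> c \<in> y) *
    merge_entry (ctype C a1) (ctype C a2) (ctype C' b1) (a1 \<in> x) (a2 \<in> x) (b1 \<in> y)"
proof (cases "\<forall>c\<in>others. c \<in> x \<longleftrightarrow> c \<in> y")
  case True
  have "b2 = b1" using merge(1)[OF assms] .
  have "adeg C x = (\<Sum>c\<in>insert a1 (insert a2 others). deg (ctype C c) (c \<in> x))"
    using adeg_deg[OF C.annular, of x] comps_C(3) by simp
  also have "\<dots> = deg (ctype C a1) (a1 \<in> x) + (deg (ctype C a2) (a2 \<in> x) +
      (\<Sum>c\<in>others. deg (ctype C c) (c \<in> x)))"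
    using finite_others assms by (subst sum.insert; simp)+
  finally have C_deg: "adeg C x = deg (ctype C a1) (a1 \<in> x) + (deg (ctype C a2) (a2 \<in> x) +
      (\<Sum>c\<in>others. deg (ctype C c) (c \<in> x)))" .
  have "adeg C' y = (\<Sum>c\<in>insert b1 others. deg (ctype C' c) (c \<in> y))"
    using adeg_deg[OF C'.annular, of y] comps_C'(3) \<open>b2 = b1\<close> by simp
  also have "\<dots> = deg (ctype C' b1) (b1 \<in> y) + (\<Sum>c\<in>others. deg (ctype C' c) (c \<in> y))"
    using finite_others b_notin by (subst sum.insert) auto
  finally have "adeg C x = adeg C' y \<longleftrightarrow>
      deg (ctype C a1) (a1 \<in> x) + deg (ctype C a2) (a2 \<in> x) = deg (ctype C' b1) (b1 \<in> y)"
    using C_deg others_deg[OF True] by simp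
  then show ?thesis using True assms
    unfolding saddle_entry_def Let_def unfolding others_prod
    unfolding merge_entry_def circle_root_ctype by simp
next
  case False
  then show ?thesis by (auto simp: saddle_entry_def Let_def others_prod)
qed

lemma saddle_entry_split:
  assumes "a1 = a2"
  shows "saddle_entry C C' P Q' x y = of_bool (\<forall>c\<in>others. c \<in> x \<longleftrightarrow> c \<in> y) *
    split_entry (ctype C a1) (ctype C' b1) (ctype C' b2) (a1 \<in> x) (b1 \<in> y) (b2 \<in> y)"
proof (cases "\<forall>c\<in>others. c \<in> x \<longleftrightarrow> c \<in> y")
  case True
  have "b1 \<noteq> b2" using ends_flip assms by simp
  have "adeg C x = (\<Sum>c\<in>insert a1 others. deg (ctype C c) (c \<in> x))"
    using adeg_deg[OF C.annular, of x] comps_C(3) assms by simp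
  also have "\<dots> = deg (ctype C a1) (a1 \<in> x) + (\<Sum>c\<in>others. deg (ctype C c) (c \<in> x))"
    using finite_others by (subst sum.insert; simp)
  finally have C_deg: "adeg C x = deg (ctype C a1) (a1 \<in> x) + (\<Sum>c\<in>others. deg (ctype C c) (c \<in> x))" .
  have "adeg C' y = (\<Sum>c\<in>insert b1 (insert b2 others). deg (ctype C' c) (c \<in> y))"
    using adeg_deg[OF C'.annular, of y] comps_C'(3) by simp
  also have "\<dots> = deg (ctype C' b1) (b1 \<in> y) + (deg (ctype C' b2) (b2 \<in> y) +
      (\<Sum>c\<in>others. deg (ctype C' c) (c \<in> y)))"
    using finite_others b_notin \<open>b1 \<noteq> b2\<close> by (subst sum.insert; simp)+
  finally have "adeg C x = adeg C' y \<longleftrightarrow>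
      deg (ctype C a1) (a1 \<in> x) = deg (ctype C' b1) (b1 \<in> y) + deg (ctype C' b2) (b2 \<in> y)"
    using C_deg others_deg[OF True] by simp
  then show ?thesis using True assms
    unfolding saddle_entry_def Let_def unfolding others_prod
    unfolding split_entry_def circle_root_ctype by simp
next
  case False
  then show ?thesis by (auto simp: saddle_entry_def Let_def others_prod)
qed

lemma Mat_others:
  "(\<Prod>c\<in>others. vec (ctype C c) (c \<subseteq> k) (c \<in> y \<inter> others)) = (\<Prod>c\<in>others. vec (ctype C' c) (c \<subseteq> k) (c \<in> y))"
  by (rule prod.cong) (use ctype_other in auto)

text \<open>In the colour basis a saddle is diagonal. A labelling is divided into its part on
  \<open>a1\<close>, \<open>a2\<close> and its part on the untouched circles: the first part gives
  \<open>merge_vec\<close> or \<open>split_vec\<close>, the second is forced by \<open>y\<close>. A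
  merge of different colours is \<open>0\<close>, and this is the case where \<open>k\<close> is not
  saturated in \<open>C'\<close>.\<close>

lemma saddle_Mat:
  assumes k: "saturated C k"
  shows "(\<Sum>x\<in>Pow (components C). saddle_entry C C' P Q' x y * Mat C k x) =
    (if saturated C' k then (if a1 \<noteq> a2 then 1 else delta (P \<in> k)) * Mat C' k y else 0)"
proof (cases "a1 = a2")
  case False
  define W where "W x = (\<Prod>c\<in>others. vec (ctype C c) (c \<subseteq> k) (c \<in> x))" for x
  define agree where "agree x = (of_bool (\<forall>c\<in>others. c \<in> x \<longleftrightarrow> c \<in> y) :: K_alpha)" for x
  define h where "h z1 z2 = merge_entry (ctype C a1) (ctype C a2) (ctype C' b1) z1 z2 (b1 \<in> y) *
    (vec (ctype C a1) (a1 \<subseteq> k) z1 * vec (ctype C a2) (a2 \<subseteq> k) z2)" for z1 z2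
  have Mat_eq: "Mat C k x = vec (ctype C a1) (a1 \<subseteq> k) (a1 \<in> x) * (vec (ctype C a2) (a2 \<subseteq> k) (a2 \<in> x) * W x)" for x
  proof -
    have "Mat C k x = (\<Prod>c\<in>insert a1 (insert a2 others). vec (ctype C c) (c \<subseteq> k) (c \<in> x))"
      unfolding Mat_def using comps_C(3) by simp
    then show ?thesis
      unfolding W_def using finite_others False by (simp add: prod.insert)
  qed
  have entry: "saddle_entry C C' P Q' (x \<union> A) y * Mat C k (x \<union> A) =
      agree x * (h (a1 \<in> A) (a2 \<in> A) * W x)"
    if "x \<in> Pow others" "A \<subseteq> {a1, a2}" for x A
  proof -
    have "c \<in> x \<union> A \<longleftrightarrow> c \<in> x" if "c \<in> others" for c
      using that \<open>A \<subseteq> _\<close> by auto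
    then have "(\<forall>c\<in>others. c \<in> x \<union> A \<longleftrightarrow> c \<in> y) \<longleftrightarrow> (\<forall>c\<in>others. c \<in> x \<longleftrightarrow> c \<in> y)" "W (x \<union> A) = W x"
      unfolding W_def by (auto intro!: prod.cong)
    moreover have "a1 \<in> x \<union> A \<longleftrightarrow> a1 \<in> A" "a2 \<in> x \<union> A \<longleftrightarrow> a2 \<in> A"
      using that by auto
    ultimately show ?thesis
      unfolding saddle_entry_merge[OF False] Mat_eq h_def agree_def by (simp only: mult_ac)
  qed
  have "(\<Sum>x\<in>Pow (components C). saddle_entry C C' P Q' x y * Mat C k x) =
      (\<Sum>x\<in>Pow (insert a1 (insert a2 others)). saddle_entry C C' P Q' x y * Mat C k x)"
    using comps_C(3) by simp
  also have "\<dots> = (\<Sum>x\<in>Pow others.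
      agree x * ((\<Sum>z1\<in>UNIV. \<Sum>z2\<in>UNIV. h z1 z2) * W x))"
  proof -
    have sub: "(\<Sum>x\<in>Pow (insert a1 (insert a2 others)). f x) =
        (\<Sum>x\<in>Pow others. (f (x \<union> {}) + f (x \<union> {a2})) + (f (x \<union> {a1}) + f (x \<union> {a1, a2})))"
      for f :: "point set set \<Rightarrow> K_alpha"
      using False finite_others
      by (simp add: sum_Pow_insert sum.distrib insert_commute add_ac)
    show ?thesis unfolding sub
    proof (rule sum.cong)
      fix x assume x: "x \<in> Pow others"
      show "(saddle_entry C C' P Q' (x \<union> {}) y * Mat C k (x \<union> {}) +
          saddle_entry C C' P Q' (x \<union> {a2}) y * Mat C k (x \<union> {a2})) +
          (saddle_entry C C' P Q' (x \<union> {a1}) y * Mat C k (x \<union> {a1}) +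
          saddle_entry C C' P Q' (x \<union> {a1, a2}) y * Mat C k (x \<union> {a1, a2})) =
          agree x * ((\<Sum>z1\<in>UNIV. \<Sum>z2\<in>UNIV. h z1 z2) * W x)"
        using entry[OF x, of "{}"] entry[OF x, of "{a2}"] entry[OF x, of "{a1}"]
          entry[OF x, of "{a1, a2}"] False
        by (simp add: UNIV_bool distrib_left distrib_right add_ac)
    qed simp
  qed
  \<comment> \<open>The factor \<open>agree\<close> leaves only the labelling of the untouched
    circles that coincides with \<open>y\<close>.\<close>
  also have "\<dots> = (\<Sum>z1\<in>UNIV. \<Sum>z2\<in>UNIV. h z1 z2) * W (y \<inter> others)"
    unfolding agree_def by (rule sum_Pow_delta[OF finite_others])
  also have "(\<Sum>z1\<in>UNIV. \<Sum>z2\<in>UNIV. h z1 z2) =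
      (if (a1 \<subseteq> k) = (a2 \<subseteq> k) then vec (ctype C' b1) (a1 \<subseteq> k) (b1 \<in> y) else 0)"
    unfolding h_def by (rule merge_vec[OF merge(3)[OF False]])
  finally have sum_eq: "(\<Sum>x\<in>Pow (components C). saddle_entry C C' P Q' x y * Mat C k x) =
      (if (a1 \<subseteq> k) = (a2 \<subseteq> k) then vec (ctype C' b1) (a1 \<subseteq> k) (b1 \<in> y) else 0) * W (y \<inter> others)" .
  have iff: "(a1 \<subseteq> k) = (P \<in> k)" "(a2 \<subseteq> k) = (Q' \<in> k)"
    using subset_saturated_iff[OF k] comps_C component_of_self by simp_all
  show ?thesis
  proof (cases "saturated C' k")
    case True
    then have eq: "(P \<in> k) = (Q' \<in> k)" using saturated_pair_iff[OF k] by simp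
    have b: "(b1 \<subseteq> k) = (P \<in> k)" using subset_saturated_iff[OF True] comps_C' component_of_self by simp
    have "Mat C' k y = (\<Prod>c\<in>insert b1 others. vec (ctype C' c) (c \<subseteq> k) (c \<in> y))"
      unfolding Mat_def using comps_C'(3) merge(1)[OF False] by simp
    also have "\<dots> = vec (ctype C' b1) (b1 \<subseteq> k) (b1 \<in> y) * W (y \<inter> others)"
      unfolding W_def Mat_others using finite_others b_notin by (subst prod.insert) auto
    finally show ?thesis using True False sum_eq iff b eq by simp
  next
    case not_sat: False
    then have "(P \<in> k) \<noteq> (Q' \<in> k)" using saturated_pair_iff[OF k] by simp
    then show ?thesis unfolding sum_eq using not_sat iff by simp
  qed
next
  case True
  define W where "W x = (\<Prod>c\<in>others. vec (ctype C c) (c \<subseteq> k) (c \<in> x))" for x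
  define agree where "agree x = (of_bool (\<forall>c\<in>others. c \<in> x \<longleftrightarrow> c \<in> y) :: K_alpha)" for x
  define h where "h z = split_entry (ctype C a1) (ctype C' b1) (ctype C' b2) z (b1 \<in> y) (b2 \<in> y) *
    vec (ctype C a1) (a1 \<subseteq> k) z" for z
  interpret flip: flat_pair C' C j i by (rule flip)
  have "b1 \<noteq> b2" using ends_flip True by simp
  have Mat_eq: "Mat C k x = vec (ctype C a1) (a1 \<subseteq> k) (a1 \<in> x) * W x" for x
  proof -
    have "Mat C k x = (\<Prod>c\<in>insert a1 others. vec (ctype C c) (c \<subseteq> k) (c \<in> x))"
      unfolding Mat_def using comps_C(3) True by simp
    then show ?thesis
      unfolding W_def using finite_others by (simp add: prod.insert)
  qed
  have entry: "saddle_entry C C' P Q' (x \<union> A) y * Mat C k (x \<union> A) =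
      agree x * (h (a1 \<in> A) * W x)"
    if "x \<in> Pow others" "A \<subseteq> {a1}" for x A
  proof -
    have "c \<in> x \<union> A \<longleftrightarrow> c \<in> x" if "c \<in> others" for c
      using that \<open>A \<subseteq> _\<close> by auto
    then have "(\<forall>c\<in>others. c \<in> x \<union> A \<longleftrightarrow> c \<in> y) \<longleftrightarrow> (\<forall>c\<in>others. c \<in> x \<longleftrightarrow> c \<in> y)" "W (x \<union> A) = W x"
      unfolding W_def by (auto intro!: prod.cong)
    moreover have "a1 \<in> x \<union> A \<longleftrightarrow> a1 \<in> A"
      using that by auto
    ultimately show ?thesis
      unfolding saddle_entry_split[OF True] Mat_eq h_def agree_def by (simp only: mult_ac)
  qed
  have "(\<Sum>x\<in>Pow (components C). saddle_entry C C' P Q' x y * Mat C k x) =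
      (\<Sum>x\<in>Pow (insert a1 others). saddle_entry C C' P Q' x y * Mat C k x)"
    using comps_C(3) True by simp
  also have "\<dots> = (\<Sum>x\<in>Pow others.
      agree x * ((\<Sum>z\<in>UNIV. h z) * W x))"
  proof -
    have sub: "(\<Sum>x\<in>Pow (insert a1 others). f x) =
        (\<Sum>x\<in>Pow others. f (x \<union> {}) + f (x \<union> {a1}))"
      for f :: "point set set \<Rightarrow> K_alpha"
      using finite_others by (simp add: sum_Pow_insert)
    show ?thesis unfolding sub
    proof (rule sum.cong)
      fix x assume x: "x \<in> Pow others"
      show "saddle_entry C C' P Q' (x \<union> {}) y * Mat C k (x \<union> {}) +
          saddle_entry C C' P Q' (x \<union> {a1}) y * Mat C k (x \<union> {a1}) =
          agree x * ((\<Sum>z\<in>UNIV. h z) * W x)"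
        using entry[OF x, of "{}"] entry[OF x, of "{a1}"]
        by (simp add: UNIV_bool distrib_left distrib_right)
    qed simp
  qed
  also have "\<dots> = (\<Sum>z\<in>UNIV. h z) * W (y \<inter> others)"
    unfolding agree_def by (rule sum_Pow_delta[OF finite_others])
  \<comment> \<open>The types of \<open>b1\<close>, \<open>b2\<close> and \<open>a1\<close> satisfy
    \<open>fuse\<close> because the flipped pair merges \<open>b1\<close> and \<open>b2\<close> into
    \<open>a1\<close>.\<close>
  also have "(\<Sum>z\<in>UNIV. h z) = delta (a1 \<subseteq> k) *
      (vec (ctype C' b1) (a1 \<subseteq> k) (b1 \<in> y) * vec (ctype C' b2) (a1 \<subseteq> k) (b2 \<in> y))"
    unfolding h_def using split_vec[OF flip.merge(3)[OF \<open>b1 \<noteq> b2\<close>]] by simp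
  finally have sum_eq: "(\<Sum>x\<in>Pow (components C). saddle_entry C C' P Q' x y * Mat C k x) =
      delta (a1 \<subseteq> k) * (vec (ctype C' b1) (a1 \<subseteq> k) (b1 \<in> y) * vec (ctype C' b2) (a1 \<subseteq> k) (b2 \<in> y)) *
      W (y \<inter> others)" .
  have iff: "(a1 \<subseteq> k) = (P \<in> k)" "(a1 \<subseteq> k) = (Q' \<in> k)"
    using subset_saturated_iff[OF k] comps_C component_of_self True by metis+
  then have sat: "saturated C' k" using saturated_pair_iff[OF k] by simp
  have b: "(b1 \<subseteq> k) = (P \<in> k)" "(b2 \<subseteq> k) = (Q' \<in> k)"
    using subset_saturated_iff[OF sat] comps_C' component_of_self by simp_all
  have "Mat C' k y = (\<Prod>c\<in>insert b1 (insert b2 others). vec (ctype C' c) (c \<subseteq> k) (c \<in> y))"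
    unfolding Mat_def using comps_C'(3) by simp
  also have "\<dots> = vec (ctype C' b1) (b1 \<subseteq> k) (b1 \<in> y) * (vec (ctype C' b2) (b2 \<subseteq> k) (b2 \<in> y) * W (y \<inter> others))"
    unfolding W_def Mat_others using finite_others b_notin \<open>b1 \<noteq> b2\<close> by (simp add: prod.insert)
  finally show ?thesis using True sat sum_eq iff b by simp
qed

text \<open>A split adds one circle of the colour at the crossing and a merge removes one. The
  equation is arranged to avoid subtraction of natural numbers.\<close>

lemma ncol_step:
  assumes k: "saturated C k" "saturated C' k"
  shows "card {c \<in> components C'. (c \<subseteq> k) = b} + of_bool (b = (P \<in> k)) =
    card {c \<in> components C. (c \<subseteq> k) = b} + 2 * of_bool (b = (P \<in> k)) * of_bool (a1 = a2)"
proof -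
  have PQ: "(P \<in> k) = (Q' \<in> k)" using saturated_pair_iff[OF k(1)] k(2) by simp
  have a: "(a1 \<subseteq> k) = (P \<in> k)" "(a2 \<subseteq> k) = (P \<in> k)"
    using subset_saturated_iff[OF k(1) comps_C(1) component_of_self]
      subset_saturated_iff[OF k(1) comps_C(2) component_of_self] PQ by simp_all
  have b: "(b1 \<subseteq> k) = (P \<in> k)" "(b2 \<subseteq> k) = (P \<in> k)"
    using subset_saturated_iff[OF k(2) comps_C'(1) component_of_self]
      subset_saturated_iff[OF k(2) comps_C'(2) component_of_self] PQ by simp_all
  define N where "N = {c \<in> others. (c \<subseteq> k) = b}"
  have fin: "finite N" and notin: "b1 \<notin> N" "b2 \<notin> N" "a1 \<notin> N" "a2 \<notin> N"
    using finite_others b_notin by (auto simp: N_def)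
  have filter: "{c \<in> insert d1 (insert d2 others). (c \<subseteq> k) = b} =
      (if b = (P \<in> k) then insert d1 (insert d2 N) else N)"
    if "(d1 \<subseteq> k) = (P \<in> k)" "(d2 \<subseteq> k) = (P \<in> k)" for d1 d2
    using that by (auto simp: N_def)
  have C: "{c \<in> components C. (c \<subseteq> k) = b} = (if b = (P \<in> k) then insert a1 (insert a2 N) else N)"
    using filter[OF a] comps_C(3) by simp
  have C': "{c \<in> components C'. (c \<subseteq> k) = b} = (if b = (P \<in> k) then insert b1 (insert b2 N) else N)"
    using filter[OF b] comps_C'(3) by simp
  show ?thesis
  proof (cases "a1 = a2")
    case True
    then have "b1 \<noteq> b2" using ends_flip by simp
    then show ?thesis unfolding C C' using fin notin True by simp
  next
    case False
    then have "b1 = b2" using ends_flip by simp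
    then show ?thesis unfolding C C' using fin notin False by simp
  qed
qed

end

section \<open>Colourings and orientations layer by layer\<close>

definition layer_ok :: "layer \<Rightarrow> nat \<Rightarrow> (nat \<Rightarrow> bool) \<Rightarrow> (nat \<Rightarrow> bool) \<Rightarrow> bool" where
  "layer_ok l n f g \<longleftrightarrow> (\<forall>a b. (a, b) \<in> through l n \<longrightarrow> f a = g b) \<and>
     (\<forall>a b. (a, b) \<in> bottom_turns l \<longrightarrow> f a = f b) \<and> (\<forall>a b. (a, b) \<in> top_turns l \<longrightarrow> g a = g b)"

definition orient_ok :: "layer \<Rightarrow> nat \<Rightarrow> (nat \<Rightarrow> bool) \<Rightarrow> (nat \<Rightarrow> bool) \<Rightarrow> bool" where
  "orient_ok l n f g \<longleftrightarrow> (\<forall>a b. (a, b) \<in> through l n \<longrightarrow> f a = g b) \<and>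
     (\<forall>a b. (a, b) \<in> bottom_turns l \<longrightarrow> f a \<noteq> f b) \<and> (\<forall>a b. (a, b) \<in> top_turns l \<longrightarrow> g a \<noteq> g b)"

lemma all_straight_arcs:
  "(\<forall>p q. (p, q) \<in> straight_arcs C \<longrightarrow> R p q) \<longleftrightarrow>
    (\<forall>j<length (layers C). \<forall>a b. (a, b) \<in> through (layers C ! j) (width C j) \<longrightarrow> R (j, a) (Suc j, b)) \<and>
    (\<forall>a<fst C. R (length (layers C), a) (0, a))"
  unfolding straight_arcs_def by blast

lemma all_turning_arcs:
  "(\<forall>p q. (p, q) \<in> turning_arcs C \<longrightarrow> R p q) \<longleftrightarrow>
    (\<forall>j<length (layers C). (\<forall>a b. (a, b) \<in> bottom_turns (layers C ! j) \<longrightarrow> R (j, a) (j, b)) \<and>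
      (\<forall>a b. (a, b) \<in> top_turns (layers C ! j) \<longrightarrow> R (Suc j, a) (Suc j, b)))"
  unfolding turning_arcs_def by blast

text \<open>As a conjunction over layers, saturation at one crossing does not see how the other
  crossings are smoothed. Hence the vertices carrying a given colouring form an interval of the
  cube.\<close>

lemma saturated_layers:
  "saturated C T \<longleftrightarrow> T \<subseteq> points C \<and>
    (\<forall>j < length (layers C). layer_ok (layers C ! j) (width C j) (\<lambda>a. (j, a) \<in> T) (\<lambda>a. (Suc j, a) \<in> T)) \<and>
    (\<forall>a < fst C. (length (layers C), a) \<in> T \<longleftrightarrow> (0, a) \<in> T)"
proof -
  have "saturated C T \<longleftrightarrow> T \<subseteq> points C \<and> (\<forall>p q. (p, q) \<in> straight_arcs C \<longrightarrow> (p \<in> T \<longleftrightarrow> q \<in> T)) \<and>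
      (\<forall>p q. (p, q) \<in> turning_arcs C \<longrightarrow> (p \<in> T \<longleftrightarrow> q \<in> T))"
    unfolding saturated_def ball_Un by (simp add: split_beta' Ball_def)
  then show ?thesis unfolding all_straight_arcs all_turning_arcs layer_ok_def by blast
qed

lemma orientation_layers:
  "orientation C ori \<longleftrightarrow>
    (\<forall>j < length (layers C). orient_ok (layers C ! j) (width C j) (\<lambda>a. ori (j, a)) (\<lambda>a. ori (Suc j, a))) \<and>
    (\<forall>a < fst C. ori (length (layers C), a) \<longleftrightarrow> ori (0, a))"
proof -
  have "orientation C ori \<longleftrightarrow> (\<forall>p q. (p, q) \<in> straight_arcs C \<longrightarrow> ori p = ori q) \<and>
      (\<forall>p q. (p, q) \<in> turning_arcs C \<longrightarrow> ori p \<noteq> ori q)"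
    unfolding orientation_def by (simp add: split_beta' Ball_def)
  then show ?thesis unfolding all_straight_arcs all_turning_arcs orient_ok_def by blast
qed

text \<open>
  At a crossing, exactly one of the two smoothings is compatible with a colouring iff the colouring
  twisted by the parity of positions is an orientation of the two strands.
\<close>

lemma orient_ok_parity:
  assumes "admissible l n"
  shows "orient_ok l n (\<lambda>a. f a \<longleftrightarrow> even a) (\<lambda>a. g a \<longleftrightarrow> even a) \<longleftrightarrow>
    (if is_cross l then layer_ok (smooth_layer False l) n f g \<noteq> layer_ok (smooth_layer True l) n f g
     else layer_ok l n f g)"
proof (cases "is_cross l")
  case True
  then obtain i b where l: "l = Cross i b" by (auto simp: is_cross_def)
  then have i: "i < n" "i + 1 < n" using assms by simp_all
  define rest where "rest = (\<forall>a. a < n \<and> a \<noteq> i \<and> a \<noteq> i + 1 \<longrightarrow> f a = g a)"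
  have S: "layer_ok Straight n f g \<longleftrightarrow> rest \<and> f i = g i \<and> f (i + 1) = g (i + 1)"
  proof -
    have "layer_ok Straight n f g \<longleftrightarrow> (\<forall>a<n. f a = g a)" by (auto simp: layer_ok_def)
    also have "\<dots> \<longleftrightarrow> rest \<and> f i = g i \<and> f (i + 1) = g (i + 1)"
    proof
      assume R: "rest \<and> f i = g i \<and> f (i + 1) = g (i + 1)"
      show "\<forall>a<n. f a = g a"
      proof (intro allI impI)
        fix a assume "a < n"
        then show "f a = g a" using R unfolding rest_def by (cases "a = i"; cases "a = i + 1") auto
      qed
    qed (use i in \<open>auto simp: rest_def\<close>)
    finally show ?thesis .
  qed
  have K: "layer_ok (CapCup i) n f g \<longleftrightarrow> rest \<and> f i = f (i + 1) \<and> g i = g (i + 1)"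
    by (auto simp: layer_ok_def rest_def)
  have O: "orient_ok l n F G \<longleftrightarrow> (\<forall>a. a < n \<and> a \<noteq> i \<and> a \<noteq> i + 1 \<longrightarrow> F a = G a) \<and>
      F i = G (i + 1) \<and> F (i + 1) = G i" for F G
    using l by (auto simp: orient_ok_def)
  \<comment> \<open>Both strands change the parity of the position, so the twist turns equality
    along a strand into inequality.\<close>
  have O': "orient_ok l n (\<lambda>a. f a \<longleftrightarrow> even a) (\<lambda>a. g a \<longleftrightarrow> even a) \<longleftrightarrow>
      rest \<and> f i \<noteq> g (i + 1) \<and> f (i + 1) \<noteq> g i"
  proof -
    have "((f a \<longleftrightarrow> even a) = (g a \<longleftrightarrow> even a)) = (f a = g a)" for a by blast
    then show ?thesis unfolding O rest_def by auto
  qed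
  have "layer_ok (smooth_layer False l) n f g \<noteq> layer_ok (smooth_layer True l) n f g \<longleftrightarrow>
      layer_ok Straight n f g \<noteq> layer_ok (CapCup i) n f g"
    using l by auto
  \<comment> \<open>Each smoothing joins the four ends in two pairs. With two colours, exactly one
    of these pairings has equal colours in both pairs iff the ends of each strand differ in
    colour.\<close>
  then show ?thesis unfolding O' S K using True by auto
next
  case False
  have "even a = even b" if "(a, b) \<in> through l n" for a b
    using that False by (cases l) (auto simp: is_cross_def)
  then have e1: "((f a \<longleftrightarrow> even a) = (g b \<longleftrightarrow> even b)) = (f a = g b)" if "(a, b) \<in> through l n" for a b
    using that by blast
  have "even a \<noteq> even b" if "(a, b) \<in> bottom_turns l \<or> (a, b) \<in> top_turns l" for a b
    using that by (cases l) auto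
  then have e2: "((h a \<longleftrightarrow> even a) \<noteq> (h b \<longleftrightarrow> even b)) = (h a = h b)"
    if "(a, b) \<in> bottom_turns l \<or> (a, b) \<in> top_turns l" for a b h
    using that by blast
  have "orient_ok l n (\<lambda>a. f a \<longleftrightarrow> even a) (\<lambda>a. g a \<longleftrightarrow> even a) \<longleftrightarrow> layer_ok l n f g"
    unfolding orient_ok_def layer_ok_def
    by (intro arg_cong2[of _ _ _ _ "(\<and>)"] arg_cong[of _ _ All] ext imp_cong refl e1 e2) simp_all
  then show ?thesis using False by simp
qed

section \<open>The complex as a direct sum of cubes\<close>

lemma finite_saturated: "finite {k. saturated C k}"
  by (rule finite_subset[of _ "Pow (points C)"]) (auto simp: saturated_def finite_points)

section \<open>Membership in the localised ring\<close>

lemma of_R_power: "of_R (a ^ n) = of_R a ^ n"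
  by (induction n) simp_all

lemma of_R_discr: "of_R discr = delta b ^ 2"
  by (cases b) (simp_all add: discr_def of_R_power delta_def root_def power2_commute)

lemma carrier_R_alphaD: "x \<in> carrier R_alphaD \<longleftrightarrow> (\<exists>a m. x = of_R a / of_R discr ^ m)"
  by (auto simp: R_alphaD_def)

lemma of_R_discr_nonzero: "of_R discr \<noteq> 0"
  using of_R_discr[of True] by simp

lemma R_alphaD_of_R [intro, simp]: "of_R a \<in> carrier R_alphaD"
  unfolding carrier_R_alphaD by (intro exI[of _ a] exI[of _ 0]) simp

lemma R_alphaD_0 [intro, simp]: "0 \<in> carrier R_alphaD"
  using R_alphaD_of_R[of 0] by simp

lemma R_alphaD_1 [intro, simp]: "1 \<in> carrier R_alphaD"
  using R_alphaD_of_R[of 1] by simp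

lemma R_alphaD_mult [intro]:
  assumes "x \<in> carrier R_alphaD" "y \<in> carrier R_alphaD"
  shows "x * y \<in> carrier R_alphaD"
proof -
  obtain a m b n where "x = of_R a / of_R discr ^ m" "y = of_R b / of_R discr ^ n"
    using assms unfolding carrier_R_alphaD by blast
  then have "x * y = of_R (a * b) / of_R discr ^ (m + n)" by (simp add: power_add)
  then show ?thesis unfolding carrier_R_alphaD by blast
qed

lemma R_alphaD_add [intro]:
  assumes "x \<in> carrier R_alphaD" "y \<in> carrier R_alphaD"
  shows "x + y \<in> carrier R_alphaD"
proof -
  obtain a m b n where "x = of_R a / of_R discr ^ m" "y = of_R b / of_R discr ^ n"
    using assms unfolding carrier_R_alphaD by blast
  then have "x + y = of_R (a * discr ^ n + b * discr ^ m) / of_R discr ^ (m + n)"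
    using of_R_discr_nonzero by (simp add: power_add of_R_power add_divide_distrib)
  then show ?thesis unfolding carrier_R_alphaD by blast
qed

lemma R_alphaD_uminus [intro]:
  assumes "x \<in> carrier R_alphaD"
  shows "- x \<in> carrier R_alphaD"
  using R_alphaD_mult[OF R_alphaD_of_R[of "- 1"] assms] by simp

lemma R_alphaD_diff [intro]:
  assumes "x \<in> carrier R_alphaD" "y \<in> carrier R_alphaD"
  shows "x - y \<in> carrier R_alphaD"
  using R_alphaD_add[OF assms(1) R_alphaD_uminus[OF assms(2)]] by simp

lemma R_alphaD_sum: "(\<And>i. i \<in> A \<Longrightarrow> f i \<in> carrier R_alphaD) \<Longrightarrow> sum f A \<in> carrier R_alphaD"
  by (induction A rule: infinite_finite_induct) auto

lemma R_alphaD_prod: "(\<And>i. i \<in> A \<Longrightarrow> f i \<in> carrier R_alphaD) \<Longrightarrow> prod f A \<in> carrier R_alphaD"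
  by (induction A rule: infinite_finite_induct) auto

lemma R_alphaD_root [intro, simp]: "root b \<in> carrier R_alphaD"
  by (simp add: root_def)

lemma R_alphaD_delta [intro, simp]: "delta b \<in> carrier R_alphaD"
  by (simp add: delta_def R_alphaD_diff)

text \<open>\<open>delta b ^ 2\<close> is the discriminant, so the inverse is \<open>delta b\<close>
  over the discriminant. This is the point where inverting the discriminant is used.\<close>

lemma R_alphaD_inverse_delta [intro, simp]: "1 / delta b \<in> carrier R_alphaD"
proof -
  have "1 / delta b = of_R (if b then alpha1 - alpha0 else alpha0 - alpha1) / of_R discr ^ 1"
    unfolding of_R_discr[of b] by (simp add: power2_eq_square delta_def root_def)
  then show ?thesis unfolding carrier_R_alphaD by blast
qed

lemma cring_R_alphaD: "cring R_alphaD"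
proof (rule cringI)
  show "abelian_group R_alphaD"
  proof (rule abelian_groupI)
    fix x assume "x \<in> carrier R_alphaD"
    then show "\<exists>y\<in>carrier R_alphaD. y \<oplus>\<^bsub>R_alphaD\<^esub> x = \<zero>\<^bsub>R_alphaD\<^esub>"
      using R_alphaD_uminus by (intro bexI[of _ "- x"]) (auto simp: R_alphaD_def)
  qed (use R_alphaD_add R_alphaD_0 in \<open>simp_all add: R_alphaD_def add_ac\<close>)
  show "comm_monoid R_alphaD"
    by (rule comm_monoidI) (use R_alphaD_mult R_alphaD_1 in \<open>simp_all add: R_alphaD_def mult_ac\<close>)
qed (simp add: R_alphaD_def distrib_right)

lemma R_alphaD_vec: "vec t k z \<in> carrier R_alphaD"
proof -
  have "- root (\<not> k) * (1 / delta k) \<in> carrier R_alphaD" by (rule R_alphaD_mult) auto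
  then show ?thesis by (auto simp: vec_def split: option.split)
qed

lemma R_alphaD_covec: "covec t z k \<in> carrier R_alphaD"
  by (auto simp: covec_def split: option.split)

lemma R_alphaD_Mat: "Mat C k x \<in> carrier R_alphaD"
  unfolding Mat_def by (rule R_alphaD_prod) (rule R_alphaD_vec)

lemma R_alphaD_Cov: "Cov C x k \<in> carrier R_alphaD"
  unfolding Cov_def by (rule R_alphaD_prod) (rule R_alphaD_covec)

section \<open>The change of basis on the whole cube\<close>

locale cube_diagram =
  fixes D :: diagram and ori :: "point \<Rightarrow> bool" and s :: "nat set \<Rightarrow> nat set \<Rightarrow> nat"
  assumes D: "annular_diagram D" and ori: "orientation D ori" and s: "sign_assignment D s"
begin

abbreviation "X \<equiv> crossings D"
abbreviation "res u \<equiv> smoothing D u"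
abbreviation "sat u k \<equiv> saturated (res u) k"
abbreviation "S \<equiv> carrier R_alphaD"

definition pos :: "nat \<Rightarrow> nat" where
  "pos j = (THE i. \<exists>b. layers D ! j = Cross i b)"

abbreviation "inn j \<equiv> (j, pos j)"
abbreviation "out j \<equiv> (Suc j, Suc (pos j))"

lemma finite_X: "finite X"
  by (simp add: crossings_def)

lemma crossing_layer:
  assumes "j \<in> X"
  shows "\<exists>b. layers D ! j = Cross (pos j) b"
proof -
  obtain i b where "layers D ! j = Cross i b" using assms by (auto simp: crossings_def)
  then have "pos j = i" unfolding pos_def by (intro the_equality) auto
  then show ?thesis using \<open>layers D ! j = Cross i b\<close> by blast
qed

lemma pair: "j \<in> X \<Longrightarrow> j \<notin> u \<Longrightarrow> flat_pair (res u) (res (insert j u)) j (pos j)"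
  using crossing_layer[of j] flat_pair_smoothing[OF D] by (auto simp: crossings_def)

lemma res_annular: "annular_diagram (res u)"
  using flat_smoothing[OF D] by (rule flat.annular)

lemma G_saddle_entry:
  "of_R (G_saddle D j u x y) = saddle_entry (res u) (res (insert j u)) (inn j) (out j) x y"
  unfolding G_saddle_def F_saddle_def saddle_entry_def Let_def pos_def by simp

definition lam :: "nat set \<Rightarrow> nat \<Rightarrow> point set \<Rightarrow> K_alpha" where
  "lam u j k = (if component_of (res u) (inn j) \<noteq> component_of (res u) (out j) then 1
     else delta (inn j \<in> k))"

definition eps :: "point set \<Rightarrow> nat set \<Rightarrow> nat \<Rightarrow> K_alpha" where
  "eps k u j = (- 1) ^ s u (insert j u) * lam u j k"

lemma G_saddle_Mat:
  assumes "j \<in> X" "j \<notin> u" "sat u k"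
  shows "(\<Sum>x\<in>Pow (components (res u)). of_R (G_saddle D j u x y) * Mat (res u) k x) =
    (if sat (insert j u) k then lam u j k * Mat (res (insert j u)) k y else 0)"
  unfolding G_saddle_entry lam_def using flat_pair.saddle_Mat[OF pair[OF assms(1,2)] assms(3)] .

text \<open>\<open>Psi\<close> passes from coordinates with respect to colourings to coordinates
  with respect to generators, and \<open>Phi\<close> back. They act on all vertices at once and are
  extended by \<open>0\<close>, hence inverse to each other only up to this truncation.\<close>

definition Psi :: "(nat set \<times> point set \<Rightarrow> K_alpha) \<Rightarrow> generator \<Rightarrow> K_alpha" where
  "Psi c = (\<lambda>(u, x). if u \<subseteq> X \<and> x \<subseteq> components (res u)
     then \<Sum>k | sat u k. c (u, k) * Mat (res u) k x else 0)"

definition Phi :: "(generator \<Rightarrow> K_alpha) \<Rightarrow> nat set \<times> point set \<Rightarrow> K_alpha" where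
  "Phi f = (\<lambda>(u, k). if u \<subseteq> X \<and> sat u k
     then \<Sum>x\<in>Pow (components (res u)). f (u, x) * Cov (res u) x k else 0)"

definition model_d :: "(nat set \<times> point set \<Rightarrow> K_alpha) \<Rightarrow> nat set \<times> point set \<Rightarrow> K_alpha" where
  "model_d c = (\<lambda>(v, k). if v \<subseteq> X \<and> sat v k
     then \<Sum>j | j \<in> v \<and> sat (v - {j}) k. eps k (v - {j}) j * c (v - {j}, k) else 0)"

lemma Phi_Psi: "Phi (Psi c) (u, k) = (if u \<subseteq> X \<and> sat u k then c (u, k) else 0)"
proof (cases "u \<subseteq> X \<and> sat u k")
  case True
  have "Phi (Psi c) (u, k) =
      (\<Sum>x\<in>Pow (components (res u)). (\<Sum>k' | sat u k'. c (u, k') * Mat (res u) k' x) * Cov (res u) x k)"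
    using True unfolding Phi_def Psi_def by (auto intro!: sum.cong)
  also have "\<dots> = (\<Sum>k' | sat u k'. c (u, k') *
      (\<Sum>x\<in>Pow (components (res u)). Mat (res u) k' x * Cov (res u) x k))"
    unfolding sum_distrib_left sum_distrib_right by (subst sum.swap) (simp only: mult.assoc)
  also have "\<dots> = (\<Sum>k' | sat u k'. if k' = k then c (u, k) else 0)"
    by (rule sum.cong) (use True in \<open>simp_all add: Mat_Cov[OF res_annular]\<close>)
  also have "\<dots> = c (u, k)" using True finite_saturated by (simp add: sum.delta)
  finally show ?thesis using True by simp
qed (auto simp: Phi_def)

lemma Psi_Phi: "Psi (Phi f) (u, x) = (if u \<subseteq> X \<and> x \<subseteq> components (res u) then f (u, x) else 0)"
proof (cases "u \<subseteq> X \<and> x \<subseteq> components (res u)")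
  case True
  have "Psi (Phi f) (u, x) =
      (\<Sum>k | sat u k. (\<Sum>x'\<in>Pow (components (res u)). f (u, x') * Cov (res u) x' k) * Mat (res u) k x)"
    using True unfolding Phi_def Psi_def by (auto intro!: sum.cong)
  also have "\<dots> = (\<Sum>x'\<in>Pow (components (res u)). f (u, x') *
      (\<Sum>k | sat u k. Cov (res u) x' k * Mat (res u) k x))"
    unfolding sum_distrib_left sum_distrib_right by (subst sum.swap) (simp only: mult.assoc)
  also have "\<dots> = (\<Sum>x'\<in>Pow (components (res u)). if x' = x then f (u, x) else 0)"
    by (rule sum.cong) (use True in \<open>simp_all add: Cov_Mat[OF res_annular]\<close>)
  also have "\<dots> = f (u, x)" using True finite_components[OF res_annular] by (simp add: sum.delta)
  finally show ?thesis using True by simp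
qed (auto simp: Psi_def)

text \<open>By \<open>G_saddle_Mat\<close> an edge multiplies each colouring by a scalar. What
  remains is to exchange the sum over incoming edges with the sum over colourings of their
  sources.\<close>

lemma differential_Psi: "differential D s (Psi c) = Psi (model_d c)"
proof
  fix vy :: generator
  obtain v y where vy: "vy = (v, y)" by (cases vy)
  show "differential D s (Psi c) vy = Psi (model_d c) vy"
  proof (cases "v \<subseteq> X \<and> y \<subseteq> components (res v)")
    case True
    then have fin_v: "finite v" using finite_X finite_subset by blast
    define t where "t j k = eps k (v - {j}) j * c (v - {j}, k) * Mat (res v) k y" for j k
    have edge: "(\<Sum>x\<in>Pow (components (res (v - {j}))).
        (- 1) ^ s (v - {j}) v * of_R (G_saddle D j (v - {j}) x y) * Psi c (v - {j}, x)) =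
        (\<Sum>k | k \<in> {k. sat v k} \<and> sat (v - {j}) k. t j k)" if "j \<in> v" for j
    proof -
      let ?u = "v - {j}"
      have j: "j \<in> X" "j \<notin> ?u" "insert j ?u = v" "?u \<subseteq> X" using that True by auto
      have "(\<Sum>x\<in>Pow (components (res ?u)).
          (- 1) ^ s ?u v * of_R (G_saddle D j ?u x y) * Psi c (?u, x)) =
          (\<Sum>x\<in>Pow (components (res ?u)). \<Sum>k | sat ?u k.
            (- 1) ^ s ?u v * c (?u, k) * (of_R (G_saddle D j ?u x y) * Mat (res ?u) k x))"
        by (rule sum.cong) (use j in \<open>simp_all add: Psi_def sum_distrib_left mult_ac\<close>)
      also have "\<dots> = (\<Sum>k | sat ?u k. (- 1) ^ s ?u v * c (?u, k) *
          (\<Sum>x\<in>Pow (components (res ?u)). of_R (G_saddle D j ?u x y) * Mat (res ?u) k x))"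
        by (subst sum.swap) (simp only: sum_distrib_left)
      \<comment> \<open>Colourings of the source that are not colourings of the target are sent to
        \<open>0\<close>.\<close>
      also have "\<dots> = (\<Sum>k | sat ?u k. if sat v k then t j k else 0)"
        by (rule sum.cong) (use G_saddle_Mat[OF j(1,2)] j(3) in \<open>simp_all add: t_def eps_def mult_ac\<close>)
      also have "\<dots> = (\<Sum>k | k \<in> {k. sat v k} \<and> sat ?u k. t j k)"
        by (subst sum.inter_filter[symmetric]) (auto intro!: sum.cong simp: finite_saturated)
      finally show ?thesis .
    qed
    have "differential D s (Psi c) vy = (\<Sum>j\<in>v. \<Sum>k | k \<in> {k. sat v k} \<and> sat (v - {j}) k. t j k)"
      unfolding differential_def vy using True edge by simp
    also have "\<dots> = (\<Sum>k | sat v k. \<Sum>j | j \<in> v \<and> sat (v - {j}) k. t j k)"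
      using sum.swap_restrict[OF fin_v finite_saturated[of "res v"], of t "\<lambda>j k. sat (v - {j}) k"] by simp
    also have "\<dots> = Psi (model_d c) vy"
      unfolding vy Psi_def model_d_def using True
      by (auto intro!: sum.cong simp: t_def sum_distrib_right)
    finally show ?thesis .
  qed (auto simp: vy differential_def Psi_def)
qed

definition ok :: "point set \<Rightarrow> nat \<Rightarrow> bool \<Rightarrow> bool" where
  "ok k l w \<longleftrightarrow> layer_ok (smooth_layer w (layers D ! l)) (width D l) (\<lambda>a. (l, a) \<in> k) (\<lambda>a. (Suc l, a) \<in> k)"

text \<open>The part of saturation that is the same at every vertex of the cube: layers without a
  crossing and the closing of the annulus.\<close>

definition base :: "point set \<Rightarrow> bool" where
  "base k \<longleftrightarrow> k \<subseteq> points D \<and> (\<forall>l < length (layers D). l \<notin> X \<longrightarrow> ok k l False) \<and>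
    (\<forall>a < fst D. (length (layers D), a) \<in> k \<longleftrightarrow> (0, a) \<in> k)"

text \<open>
  The vertices at which \<open>k\<close> is a colouring form the interval from \<open>lo k\<close> to \<open>hi k\<close>. It may be
  empty because \<open>lo k \<subseteq> hi k\<close> can fail.
\<close>

definition lo :: "point set \<Rightarrow> nat set" where
  "lo k = {j \<in> X. \<not> ok k j False}"

definition hi :: "point set \<Rightarrow> nat set" where
  "hi k = {j \<in> X. ok k j True}"

lemma smooth_noncrossing: "l < length (layers D) \<Longrightarrow> l \<notin> X \<Longrightarrow> smooth_layer w (layers D ! l) = layers D ! l"
  by (cases "layers D ! l") (auto simp: crossings_def)

text \<open>A crossing whose \<open>0\<close>-smoothing does not fit \<open>k\<close> has to lie in
  \<open>u\<close>, and a crossing in \<open>u\<close> needs a fitting \<open>1\<close>-smoothing.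
  Both conditions concern one crossing at a time.\<close>

lemma sat_iff:
  assumes "u \<subseteq> X"
  shows "sat u k \<longleftrightarrow> base k \<and> lo k \<subseteq> u \<and> u \<subseteq> hi k"
proof -
  have "sat u k \<longleftrightarrow> k \<subseteq> points D \<and> (\<forall>l < length (layers D). ok k l (l \<in> u)) \<and>
      (\<forall>a < fst D. (length (layers D), a) \<in> k \<longleftrightarrow> (0, a) \<in> k)"
    unfolding saturated_layers points_smoothing ok_def
    by (simp add: layers_smoothing width_smoothing)
  also have "(\<forall>l < length (layers D). ok k l (l \<in> u)) \<longleftrightarrow>
      (\<forall>l < length (layers D). l \<notin> X \<longrightarrow> ok k l False) \<and> lo k \<subseteq> u \<and> u \<subseteq> hi k"
  proof -
    have X: "j < length (layers D)" if "j \<in> X" for j using that by (simp add: crossings_def)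
    have const: "ok k l w = ok k l False" if "l < length (layers D)" "l \<notin> X" for l w
      using that smooth_noncrossing by (simp add: ok_def)
    have "(\<forall>l < length (layers D). ok k l (l \<in> u)) \<longleftrightarrow>
        (\<forall>l < length (layers D). l \<notin> X \<longrightarrow> ok k l (l \<in> u)) \<and> (\<forall>l\<in>X. ok k l (l \<in> u))"
      using X by blast
    also have "(\<forall>l < length (layers D). l \<notin> X \<longrightarrow> ok k l (l \<in> u)) \<longleftrightarrow>
        (\<forall>l < length (layers D). l \<notin> X \<longrightarrow> ok k l False)"
      using const by (metis (no_types))
    also have "(\<forall>l\<in>X. ok k l (l \<in> u)) \<longleftrightarrow> lo k \<subseteq> u \<and> u \<subseteq> hi k"
    proof (intro iffI conjI subsetI ballI)
      fix l assume *: "\<forall>l\<in>X. ok k l (l \<in> u)"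
      show "l \<in> u" if "l \<in> lo k"
      proof (rule ccontr)
        assume "l \<notin> u"
        moreover have "l \<in> X" "\<not> ok k l False" using that by (simp_all add: lo_def)
        ultimately show False using * by auto
      qed
      show "l \<in> hi k" if "l \<in> u"
      proof -
        have "l \<in> X" using that assms by blast
        then have "ok k l (l \<in> u)" using * by blast
        then show ?thesis using that \<open>l \<in> X\<close> by (simp add: hi_def)
      qed
    next
      fix l assume *: "lo k \<subseteq> u \<and> u \<subseteq> hi k" and "l \<in> X"
      show "ok k l (l \<in> u)"
      proof (cases "l \<in> u")
        case True
        then have "l \<in> hi k" using * by blast
        then show ?thesis using True by (simp add: hi_def)
      next
        case False
        then have "l \<notin> lo k" using * by blast
        then show ?thesis using False \<open>l \<in> X\<close> by (simp add: lo_def)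
      qed
    qed
    finally show ?thesis .
  qed
  finally show ?thesis unfolding base_def by blast
qed

lemma hi_subset: "hi k \<subseteq> X"
  by (auto simp: hi_def)

lemma model_d_cube:
  "model_d c (v, k) = (if base k then cube_d (lo k) (hi k) (eps k) (\<lambda>u. c (u, k)) v else 0)"
proof (cases "v \<subseteq> X \<and> sat v k")
  case True
  then have v: "base k" "lo k \<subseteq> v" "v \<subseteq> hi k" using sat_iff by auto
  have "sat (v - {j}) k \<longleftrightarrow> j \<notin> lo k" if "j \<in> v" for j
    using v sat_iff[of "v - {j}" k] True that by auto
  then have "{j. j \<in> v \<and> sat (v - {j}) k} = v - lo k" by blast
  then show ?thesis using True v by (simp add: model_d_def cube_d_def)
next
  case False
  then have "\<not> (base k \<and> lo k \<subseteq> v \<and> v \<subseteq> hi k)" using sat_iff[of v] hi_subset by blast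
  then show ?thesis using False by (auto simp: model_d_def cube_d_def)
qed

lemma lam_nonzero: "lam u j k \<noteq> 0"
  by (simp add: lam_def)

lemma eps_nonzero: "eps k u j \<noteq> 0"
  by (simp add: eps_def lam_nonzero)

text \<open>
  A split adds a circle of its colour and a merge removes one, so the number of splits of each colour
  along a path is determined by the end points.
\<close>

lemma lam_commute:
  assumes ij: "i \<in> X - u" "j \<in> X - u" "i \<noteq> j"
    and sat: "sat u k" "sat (insert i u) k" "sat (insert j u) k" "sat (insert j (insert i u)) k"
  shows "lam u i k * lam (insert i u) j k = lam u j k * lam (insert j u) i k"
proof -
  define N where "N u b = card {c \<in> components (res u). (c \<subseteq> k) = b}" for u b
  define sp where "sp u j = (of_bool (component_of (res u) (inn j) = component_of (res u) (out j)) :: nat)" for u j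
  define col where "col j \<longleftrightarrow> inn j \<in> k" for j
  have lam: "lam u j k = delta (col j) ^ sp u j" for u j
    by (simp add: lam_def sp_def col_def)
  have step: "N (insert j u) b + of_bool (b = col j) = N u b + 2 * of_bool (b = col j) * sp u j"
    if "j \<in> X" "j \<notin> u" "sat u k" "sat (insert j u) k" for u j b
    unfolding N_def sp_def col_def by (rule flat_pair.ncol_step[OF pair[OF that(1,2)] that(3,4)])
  have ins: "insert j (insert i u) = insert i (insert j u)" by auto
  note s1 = step[of i u] and s2 = step[of j "insert i u"] and s3 = step[of j u] and s4 = step[of i "insert j u"]
  show ?thesis
  \<comment> \<open>If the colours agree, counting circles only determines the sum of the two
    exponents, which is enough. If they differ, each exponent is determined separately by the
    circles of its own colour.\<close>
  proof (cases "col i = col j")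
    case True
    have "sp u i + sp (insert i u) j = sp u j + sp (insert j u) i"
      using s1[of "col i"] s2[of "col i"] s3[of "col i"] s4[of "col i"] ij sat ins True by auto
    then show ?thesis unfolding lam using True by (simp flip: power_add)
  next
    case False
    have "sp u i = sp (insert j u) i"
      using s1[of "col i"] s2[of "col i"] s3[of "col i"] s4[of "col i"] ij sat ins False by auto
    moreover have "sp u j = sp (insert i u) j"
      using s1[of "col j"] s2[of "col j"] s3[of "col j"] s4[of "col j"] ij sat ins False by auto
    ultimately show ?thesis unfolding lam by simp
  qed
qed

lemma cube_base:
  assumes "base k"
  shows "cube (lo k) (hi k) (eps k)"
proof
  show "finite (hi k)" using hi_subset finite_X finite_subset by blast
  fix u j assume u: "lo k \<subseteq> u" "u \<subseteq> hi k" and j: "j \<in> hi k - u"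
  show "eps k u j \<noteq> 0" by (rule eps_nonzero)
  fix i assume i: "i \<in> hi k - u" and "i \<noteq> j"
  have satI: "sat w k" if "lo k \<subseteq> w" "w \<subseteq> hi k" for w
    using sat_iff[of w] that assms hi_subset by blast
  have "sat u k" "sat (insert i u) k" "sat (insert j u) k" "sat (insert j (insert i u)) k"
    by (rule satI; use u i j in blast)+
  then have lam: "lam u i k * lam (insert i u) j k = lam u j k * lam (insert j u) i k"
    using i j \<open>i \<noteq> j\<close> hi_subset[of k] by (intro lam_commute) auto
  let ?w = "insert j (insert i u)"
  have "odd (s u (insert i u) + s (insert i u) ?w + s u (insert j u) + s (insert j u) ?w)"
  proof -
    have "u \<subseteq> X \<and> i \<in> X - u \<and> j \<in> X - u \<and> i \<noteq> j"
      using i j u \<open>i \<noteq> j\<close> hi_subset[of k] by auto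
    then show ?thesis using s unfolding sign_assignment_def by blast
  qed
  then have "odd (s u (insert i u) + s (insert i u) ?w) \<longleftrightarrow> even (s u (insert j u) + s (insert j u) ?w)"
    by auto
  then have sign: "(- 1 :: K_alpha) ^ (s u (insert i u) + s (insert i u) ?w) =
      - ((- 1) ^ (s u (insert j u) + s (insert j u) ?w))"
    by (auto simp: minus_one_power_iff)
  have "eps k u i * eps k (insert i u) j =
      (- 1) ^ (s u (insert i u) + s (insert i u) ?w) * (lam u i k * lam (insert i u) j k)"
    by (simp add: eps_def power_add)
  moreover have "eps k u j * eps k (insert j u) i =
      (- 1) ^ (s u (insert j u) + s (insert j u) ?w) * (lam u j k * lam (insert j u) i k)"
    by (simp add: eps_def power_add insert_commute)
  ultimately show "eps k u i * eps k (insert i u) j + eps k u j * eps k (insert j u) i = 0"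
    unfolding sign lam by simp
qed

section \<open>Counting the colourings that survive\<close>

definition surv :: "point set set" where
  "surv = {k. base k \<and> lo k = hi k}"

text \<open>\<open>lo k = hi k\<close> says that exactly one smoothing fits \<open>k\<close> at
  every crossing. By \<open>orient_ok_parity\<close> this is the orientation condition
  there.\<close>

lemma surv_iff: "k \<in> surv \<longleftrightarrow> k \<subseteq> points D \<and> orientation D (\<lambda>p. p \<in> k \<longleftrightarrow> even (snd p))"
proof -
  have layer: "orient_ok (layers D ! l) (width D l) (\<lambda>a. (l, a) \<in> k \<longleftrightarrow> even a) (\<lambda>a. (Suc l, a) \<in> k \<longleftrightarrow> even a)
      \<longleftrightarrow> (if l \<in> X then ok k l False \<noteq> ok k l True else ok k l False)"
    if "l < length (layers D)" for l
  proof -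
    have "admissible (layers D ! l) (width D l)" using D that unfolding annular_diagram_def by blast
    from orient_ok_parity[OF this] have "orient_ok (layers D ! l) (width D l)
        (\<lambda>a. (l, a) \<in> k \<longleftrightarrow> even a) (\<lambda>a. (Suc l, a) \<in> k \<longleftrightarrow> even a) \<longleftrightarrow>
      (if is_cross (layers D ! l) then ok k l False \<noteq> ok k l True
       else layer_ok (layers D ! l) (width D l) (\<lambda>a. (l, a) \<in> k) (\<lambda>a. (Suc l, a) \<in> k))"
      unfolding ok_def .
    moreover have "is_cross (layers D ! l) \<longleftrightarrow> l \<in> X" using that by (auto simp: is_cross_def crossings_def)
    moreover have "ok k l False \<longleftrightarrow> layer_ok (layers D ! l) (width D l) (\<lambda>a. (l, a) \<in> k) (\<lambda>a. (Suc l, a) \<in> k)"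
      if "l \<notin> X" using smooth_noncrossing[OF \<open>l < _\<close> that] by (simp add: ok_def)
    ultimately show ?thesis by auto
  qed
  have X: "l < length (layers D)" if "l \<in> X" for l using that by (simp add: crossings_def)
  have "lo k = hi k \<longleftrightarrow> (\<forall>l\<in>X. ok k l False \<noteq> ok k l True)"
    unfolding lo_def hi_def by blast
  moreover have "orientation D (\<lambda>p. p \<in> k \<longleftrightarrow> even (snd p)) \<longleftrightarrow>
      (\<forall>l<length (layers D). if l \<in> X then ok k l False \<noteq> ok k l True else ok k l False) \<and>
      (\<forall>a < fst D. (length (layers D), a) \<in> k \<longleftrightarrow> (0, a) \<in> k)"
    unfolding orientation_layers snd_conv using layer by auto
  ultimately show ?thesis unfolding surv_def base_def using X by auto
qed

text \<open>Two orientations differ by a function that is constant on link components. With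
  \<open>ori\<close> as base point, orientations therefore correspond to saturated sets.\<close>

lemma saturated_xor:
  assumes "k \<subseteq> points D"
  shows "saturated D {p \<in> points D. (p \<in> k \<longleftrightarrow> even (snd p)) \<noteq> ori p} \<longleftrightarrow>
    orientation D (\<lambda>p. p \<in> k \<longleftrightarrow> even (snd p))"
proof -
  let ?T = "{p \<in> points D. (p \<in> k \<longleftrightarrow> even (snd p)) \<noteq> ori p}" and ?o = "\<lambda>p. p \<in> k \<longleftrightarrow> even (snd p)"
  have sat: "saturated D ?T \<longleftrightarrow> (\<forall>p q. (p, q) \<in> straight_arcs D \<longrightarrow> (p \<in> ?T \<longleftrightarrow> q \<in> ?T)) \<and>
      (\<forall>p q. (p, q) \<in> turning_arcs D \<longrightarrow> (p \<in> ?T \<longleftrightarrow> q \<in> ?T))"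
    unfolding saturated_def ball_Un by (simp add: split_beta' Ball_def)
  have orient: "orientation D f \<longleftrightarrow> (\<forall>p q. (p, q) \<in> straight_arcs D \<longrightarrow> f p = f q) \<and>
      (\<forall>p q. (p, q) \<in> turning_arcs D \<longrightarrow> f p \<noteq> f q)" for f
    unfolding orientation_def by (simp add: split_beta' Ball_def)
  have s1: "(p \<in> ?T \<longleftrightarrow> q \<in> ?T) \<longleftrightarrow> ?o p = ?o q" if "(p, q) \<in> straight_arcs D" for p q
  proof -
    have "p \<in> points D" "q \<in> points D" using arc_points[OF D, of p q] that by simp_all
    moreover have "ori p = ori q" using that ori unfolding orient by blast
    ultimately show ?thesis by auto
  qed
  have s2: "(p \<in> ?T \<longleftrightarrow> q \<in> ?T) \<longleftrightarrow> ?o p \<noteq> ?o q" if "(p, q) \<in> turning_arcs D" for p q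
  proof -
    have "p \<in> points D" "q \<in> points D" using arc_points[OF D, of p q] that by simp_all
    moreover have "ori p \<noteq> ori q" using that ori unfolding orient by blast
    ultimately show ?thesis by auto
  qed
  show ?thesis unfolding sat orient by (simp only: s1 s2 cong: imp_cong)
qed

text \<open>Exclusive or with the checkerboard pattern and with \<open>ori\<close> is an involution
  on sets of points. It exchanges surviving colourings with unions of link components.\<close>

lemma surv_card: "finite surv" "card surv = 2 ^ card (components D)"
proof -
  let ?h = "\<lambda>k. {p \<in> points D. (p \<in> k \<longleftrightarrow> even (snd p)) \<noteq> ori p}"
  have inv: "?h (?h k) = k" if "k \<subseteq> points D" for k
    using that by auto
  have bij: "bij_betw ?h surv {T. saturated D T}"
  proof (rule bij_betwI[where g = ?h])
    show "?h \<in> surv \<rightarrow> {T. saturated D T}"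
      using saturated_xor surv_iff by auto
    show "?h \<in> {T. saturated D T} \<rightarrow> surv"
    proof
      fix T assume "T \<in> {T. saturated D T}"
      then have T: "saturated D T" "T \<subseteq> points D" by (auto simp: saturated_def)
      have "saturated D (?h (?h T))" unfolding inv[OF T(2)] by (rule T(1))
      then have "orientation D (\<lambda>p. p \<in> ?h T \<longleftrightarrow> even (snd p))"
        by (subst (asm) saturated_xor) auto
      then show "?h T \<in> surv" unfolding surv_iff by blast
    qed
  qed (use inv surv_iff in \<open>auto simp: saturated_def\<close>)
  show "finite surv"
    using bij_betw_finite[OF bij] finite_saturated by simp
  have "card surv = card {T. saturated D T}" by (rule bij_betw_same_card[OF bij])
  also have "\<dots> = card (Pow (components D))"
    by (rule bij_betw_same_card[OF bij_betw_saturated[OF D], symmetric])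
  finally show "card surv = 2 ^ card (components D)"
    using finite_components[OF D] by (simp add: card_Pow)
qed

end

section \<open>Homology\<close>

context cube_diagram
begin

abbreviation "shift \<equiv> int (card (negative_crossings D ori))"
abbreviation "Ch i \<equiv> carrier (CKh D ori i)"
abbreviation "cyc i \<equiv> cycles D ori s i"
abbreviation "bnd i \<equiv> boundaries D ori s i"
abbreviation "diff \<equiv> differential D s"

lemma Ch_iff: "f \<in> Ch i \<longleftrightarrow> (\<forall>g. f g \<in> S) \<and>
    (\<forall>u x. \<not> (u \<subseteq> X \<and> int (card u) = i + shift \<and> x \<subseteq> components (res u)) \<longrightarrow> f (u, x) = 0)"
  by (auto simp: CKh_def generators_def)

definition Model :: "int \<Rightarrow> (nat set \<times> point set \<Rightarrow> K_alpha) set" where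
  "Model i = {c. (\<forall>g. c g \<in> S) \<and>
    (\<forall>u k. \<not> (u \<subseteq> X \<and> int (card u) = i + shift \<and> sat u k) \<longrightarrow> c (u, k) = 0)}"

lemma ModelI:
  assumes "\<And>u k. c (u, k) \<in> S"
    "\<And>u k. c (u, k) \<noteq> 0 \<Longrightarrow> u \<subseteq> X \<and> int (card u) = i + shift \<and> sat u k"
  shows "c \<in> Model i"
  unfolding Model_def
proof (intro CollectI conjI allI impI)
  fix g :: "nat set \<times> point set"
  show "c g \<in> S" using assms(1)[of "fst g" "snd g"] by simp
qed (use assms(2) in blast)

lemma Model_mem: "c \<in> Model i \<Longrightarrow> c g \<in> S"
  unfolding Model_def by blast

lemma Model_nonzero: "c \<in> Model i \<Longrightarrow> c (u, k) \<noteq> 0 \<Longrightarrow> u \<subseteq> X \<and> int (card u) = i + shift \<and> sat u k"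
  unfolding Model_def by blast

lemma Psi_Ch:
  assumes c: "c \<in> Model i"
  shows "Psi c \<in> Ch i"
  unfolding Ch_iff
proof (intro conjI allI impI)
  fix g :: generator
  obtain u x where g: "g = (u, x)" by (cases g)
  have "(\<Sum>k | sat u k. c (u, k) * Mat (res u) k x) \<in> S"
    by (intro R_alphaD_sum R_alphaD_mult R_alphaD_Mat Model_mem[OF c])
  then show "Psi c g \<in> S" by (simp add: Psi_def g)
next
  fix u x assume not: "\<not> (u \<subseteq> X \<and> int (card u) = i + shift \<and> x \<subseteq> components (res u))"
  show "Psi c (u, x) = 0"
  proof (cases "u \<subseteq> X \<and> x \<subseteq> components (res u)")
    case True
    then have "c (u, k) = 0" for k using not Model_nonzero[OF c] by blast
    then show ?thesis by (simp add: Psi_def)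
  qed (auto simp: Psi_def)
qed

lemma Phi_Model:
  assumes f: "f \<in> Ch i"
  shows "Phi f \<in> Model i"
proof (rule ModelI)
  fix u k
  have fS: "f g \<in> S" for g using f Ch_iff by blast
  have "(\<Sum>x\<in>Pow (components (res u)). f (u, x) * Cov (res u) x k) \<in> S"
    by (intro R_alphaD_sum R_alphaD_mult R_alphaD_Cov fS)
  then show "Phi f (u, k) \<in> S" by (simp add: Phi_def)
  assume nz: "Phi f (u, k) \<noteq> 0"
  then have u: "u \<subseteq> X" "sat u k" by (auto simp: Phi_def split: if_splits)
  have "int (card u) = i + shift"
  proof (rule ccontr)
    assume "int (card u) \<noteq> i + shift"
    then have "f (u, x) = 0" for x using f Ch_iff by blast
    then have "Phi f (u, k) = 0" by (simp add: Phi_def)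
    with nz show False ..
  qed
  with u show "u \<subseteq> X \<and> int (card u) = i + shift \<and> sat u k" by simp
qed

lemma Psi_Phi_Ch: "f \<in> Ch i \<Longrightarrow> Psi (Phi f) = f"
proof
  fix g :: generator
  assume f: "f \<in> Ch i"
  obtain u x where g: "g = (u, x)" by (cases g)
  show "Psi (Phi f) g = f g"
    unfolding g Psi_Phi using f[unfolded Ch_iff] by auto
qed

lemma Psi_add: "Psi (\<lambda>g. c g + c' g) = (\<lambda>g. Psi c g + Psi c' g)"
  by (auto simp: Psi_def fun_eq_iff sum.distrib distrib_right)

lemma Psi_scale: "Psi (\<lambda>g. r * c g) = (\<lambda>g. r * Psi c g)"
  by (auto simp: Psi_def fun_eq_iff sum_distrib_left mult.assoc)

lemma Psi_zero: "Psi (\<lambda>g. 0) = (\<lambda>g. 0)"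
  by (auto simp: Psi_def fun_eq_iff)

lemma Phi_zero: "Phi (\<lambda>g. 0) = (\<lambda>g. 0)"
  by (auto simp: Phi_def fun_eq_iff)

lemma diff_add: "diff (\<lambda>g. f g + f' g) = (\<lambda>g. diff f g + diff f' g)"
  by (auto simp: differential_def fun_eq_iff sum.distrib distrib_left)

lemma diff_scale: "diff (\<lambda>g. r * f g) = (\<lambda>g. r * diff f g)"
  by (auto simp: differential_def fun_eq_iff sum_distrib_left mult_ac)

lemma Ch_add: "f \<in> Ch i \<Longrightarrow> f' \<in> Ch i \<Longrightarrow> (\<lambda>g. f g + f' g) \<in> Ch i"
  unfolding Ch_iff by (auto intro: R_alphaD_add)

lemma Ch_scale: "r \<in> S \<Longrightarrow> f \<in> Ch i \<Longrightarrow> (\<lambda>g. r * f g) \<in> Ch i"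
  unfolding Ch_iff by (auto intro: R_alphaD_mult)

lemma Ch_zero: "(\<lambda>g. 0) \<in> Ch i"
  unfolding Ch_iff by auto

lemma inverse_lam_S: "1 / lam u j k \<in> S"
  by (simp add: lam_def)

lemma sign_S: "(- 1) ^ n \<in> S"
  by (cases "even n") (auto simp: R_alphaD_uminus)

text \<open>The homotopy divides by edge coefficients. These are units of \<open>R_alphaD\<close>,
  so it maps chains over \<open>R_alphaD\<close> to such chains.\<close>

lemma inverse_eps_S: "1 / eps k u j \<in> S"
proof -
  have "1 / eps k u j = (- 1) ^ s u (insert j u) * (1 / lam u j k)"
    unfolding eps_def by (simp add: minus_one_power_iff)
  then show ?thesis by (simp only: R_alphaD_mult sign_S inverse_lam_S)
qed

definition pivot :: "point set \<Rightarrow> nat" where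
  "pivot k = (SOME m. m \<in> hi k - lo k)"

definition model_h :: "(nat set \<times> point set \<Rightarrow> K_alpha) \<Rightarrow> nat set \<times> point set \<Rightarrow> K_alpha" where
  "model_h c = (\<lambda>(u, k). if base k \<and> \<not> hi k \<subseteq> lo k
     then cube_h (lo k) (hi k) (eps k) (pivot k) (\<lambda>u. c (u, k)) u else 0)"

lemma model_h_Model:
  assumes c: "c \<in> Model i"
  shows "model_h c \<in> Model (i - 1)"
proof (rule ModelI)
  fix u k
  have "c (insert (pivot k) u, k) * (1 / eps k u (pivot k)) \<in> S"
    by (intro R_alphaD_mult inverse_eps_S Model_mem[OF c])
  then show "model_h c (u, k) \<in> S" by (simp add: model_h_def cube_h_def)
  assume nz: "model_h c (u, k) \<noteq> 0"
  then have u: "base k" "lo k \<subseteq> u" "u \<subseteq> hi k" "pivot k \<notin> u" "c (insert (pivot k) u, k) \<noteq> 0"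
    by (auto simp: model_h_def cube_h_def split: if_splits)
  have "u \<subseteq> X" using u hi_subset by blast
  moreover have "sat u k" using sat_iff[OF \<open>u \<subseteq> X\<close>] u by blast
  moreover have "finite u" using \<open>u \<subseteq> X\<close> finite_X finite_subset by blast
  then have "int (card (insert (pivot k) u)) = int (card u) + 1" using u by simp
  then have "int (card u) = i - 1 + shift" using Model_nonzero[OF c u(5)] by simp
  ultimately show "u \<subseteq> X \<and> int (card u) = i - 1 + shift \<and> sat u k" by blast
qed

lemma model_d_surv: "k \<in> surv \<Longrightarrow> model_d c (v, k) = 0"
  unfolding model_d_cube surv_def cube_d_def by auto

text \<open>On a cube with a free direction, the homotopy identity shows that a cycle is the
  boundary of its image under \<open>model_h\<close>. On a cube with one vertex there is no edge,
  and the coordinate remains.\<close>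

lemma model_decompose:
  assumes c: "c \<in> Model i" and dc: "model_d c = (\<lambda>g. 0)"
  shows "c (u, k) = model_d (model_h c) (u, k) + (if k \<in> surv then c (u, k) else 0)"
proof (cases "u \<subseteq> X \<and> sat u k")
  case True
  then have u: "base k" "lo k \<subseteq> u" "u \<subseteq> hi k" using sat_iff by auto
  show ?thesis
  proof (cases "k \<in> surv")
    case True
    then show ?thesis using model_d_surv by simp
  next
    case False
    then have ne: "\<not> hi k \<subseteq> lo k" using u unfolding surv_def by blast
    then have "\<exists>m. m \<in> hi k - lo k" by blast
    then have pivot: "pivot k \<in> hi k - lo k" unfolding pivot_def by (rule someI_ex)
    have "cube_d (lo k) (hi k) (eps k) (\<lambda>u. c (u, k)) v = 0" for v
      using fun_cong[OF dc, of "(v, k)"] u unfolding model_d_cube by simp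
    then have "cube_h (lo k) (hi k) (eps k) (pivot k) (cube_d (lo k) (hi k) (eps k) (\<lambda>u. c (u, k))) u = 0"
      by (simp add: cube_h_def)
    moreover have "(\<lambda>u. model_h c (u, k)) = cube_h (lo k) (hi k) (eps k) (pivot k) (\<lambda>u. c (u, k))"
      using u ne by (simp add: model_h_def)
    ultimately have "model_d (model_h c) (u, k) = c (u, k)"
      using cube.cube_homotopy[OF cube_base[OF u(1)] pivot u(2,3), of "\<lambda>u. c (u, k)"] u
      by (simp add: model_d_cube)
    then show ?thesis using False by simp
  qed
next
  case False
  then have "c (u, k) = 0" using Model_nonzero[OF c] by blast
  then show ?thesis using False by (auto simp: model_d_def)
qed

lemma cyc_iff: "z \<in> cyc i \<longleftrightarrow> z \<in> Ch i \<and> diff z = (\<lambda>g. 0)"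
  by (auto simp: cycles_def)

lemma bnd_add: "b \<in> bnd i \<Longrightarrow> b' \<in> bnd i \<Longrightarrow> (\<lambda>g. b g + b' g) \<in> bnd i"
proof -
  assume "b \<in> bnd i" "b' \<in> bnd i"
  then obtain f f' where f: "f \<in> Ch (i - 1)" "b = diff f" "f' \<in> Ch (i - 1)" "b' = diff f'"
    unfolding boundaries_def by blast
  then have "(\<lambda>g. b g + b' g) = diff (\<lambda>g. f g + f' g)" by (simp add: diff_add)
  then show ?thesis unfolding boundaries_def using Ch_add[OF f(1,3)] by blast
qed

lemma bnd_scale: "r \<in> S \<Longrightarrow> b \<in> bnd i \<Longrightarrow> (\<lambda>g. r * b g) \<in> bnd i"
proof -
  assume r: "r \<in> S" and "b \<in> bnd i"
  then obtain f where f: "f \<in> Ch (i - 1)" "b = diff f"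
    unfolding boundaries_def by blast
  then have "(\<lambda>g. r * b g) = diff (\<lambda>g. r * f g)" by (simp add: diff_scale)
  then show ?thesis unfolding boundaries_def using Ch_scale[OF r f(1)] by blast
qed

lemma bnd_zero: "(\<lambda>g. 0) \<in> bnd i"
proof -
  have "diff (\<lambda>g. 0) = (\<lambda>g. 0)" by (auto simp: differential_def fun_eq_iff)
  then show ?thesis unfolding boundaries_def using Ch_zero by (metis image_eqI)
qed

lemma bnd_diff: "b \<in> bnd i \<Longrightarrow> b' \<in> bnd i \<Longrightarrow> (\<lambda>g. b g - b' g) \<in> bnd i"
  using bnd_add[of b i "\<lambda>g. - 1 * b' g"] bnd_scale[of "- 1" b' i] R_alphaD_uminus[OF R_alphaD_1] by simp

lemma bnd_Psi:
  assumes "b \<in> bnd i"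
  shows "\<exists>c \<in> Model (i - 1). b = Psi (model_d c)"
proof -
  obtain f where f: "f \<in> Ch (i - 1)" "b = diff f" using assms by (auto simp: boundaries_def)
  then show ?thesis using Phi_Model[OF f(1)] differential_Psi[of "Phi f"] Psi_Phi_Ch[OF f(1)] by metis
qed

lemma Psi_bnd: "c \<in> Model (i - 1) \<Longrightarrow> Psi (model_d c) \<in> bnd i"
  unfolding boundaries_def using differential_Psi[of c] Psi_Ch by (metis image_eqI)

section \<open>The homology record in terms of cosets of boundaries\<close>

definition coset :: "int \<Rightarrow> (generator \<Rightarrow> K_alpha) \<Rightarrow> (generator \<Rightarrow> K_alpha) set" where
  "coset i z = {\<lambda>g. b g + z g | b. b \<in> bnd i}"

lemma coset_iff: "f \<in> coset i z \<longleftrightarrow> (\<lambda>g. f g - z g) \<in> bnd i"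
proof
  assume "f \<in> coset i z"
  then obtain b where b: "b \<in> bnd i" "f = (\<lambda>g. b g + z g)" unfolding coset_def by blast
  have "(\<lambda>g. f g - z g) = b" unfolding b(2) by simp
  with b show "(\<lambda>g. f g - z g) \<in> bnd i" by simp
next
  assume b: "(\<lambda>g. f g - z g) \<in> bnd i"
  show "f \<in> coset i z" unfolding coset_def
    by (rule CollectI, rule exI[of _ "\<lambda>g. f g - z g"]) (simp add: b)
qed

lemma coset_self: "z \<in> coset i z"
  unfolding coset_iff using bnd_zero by simp

lemma coset_eq_iff: "coset i z = coset i z' \<longleftrightarrow> (\<lambda>g. z g - z' g) \<in> bnd i"
proof
  assume "coset i z = coset i z'"
  then have "z \<in> coset i z'" using coset_self by metis
  then show "(\<lambda>g. z g - z' g) \<in> bnd i" by (simp only: coset_iff)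
next
  assume d: "(\<lambda>g. z g - z' g) \<in> bnd i"
  have "(\<lambda>g. f g - z g) \<in> bnd i \<longleftrightarrow> (\<lambda>g. f g - z' g) \<in> bnd i" for f
  proof
    assume "(\<lambda>g. f g - z g) \<in> bnd i"
    from bnd_add[OF this d] show "(\<lambda>g. f g - z' g) \<in> bnd i" by simp
  next
    assume "(\<lambda>g. f g - z' g) \<in> bnd i"
    from bnd_diff[OF this d] show "(\<lambda>g. f g - z g) \<in> bnd i" by simp
  qed
  then have "f \<in> coset i z \<longleftrightarrow> f \<in> coset i z'" for f by (simp only: coset_iff)
  then show "coset i z = coset i z'" by blast
qed

lemma coset_zero: "coset i (\<lambda>g. 0) = bnd i"
  by (auto simp: coset_def)

lemma r_coset_eq: "r_coset (add_monoid (submodule_of (CKh D ori i) Z)) (bnd i) z = coset i z"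
  unfolding r_coset_def coset_def submodule_of_def CKh_def by auto

lemma carrier_homology: "carrier (homology D ori s i) = coset i ` cyc i"
proof -
  have "carrier (homology D ori s i) =
      (\<Union>z\<in>cyc i. {r_coset (add_monoid (submodule_of (CKh D ori i) (cyc i))) (bnd i) z})"
    by (simp add: homology_def quotient_module_def A_RCOSETS_def RCOSETS_def submodule_of_def)
  then show ?thesis unfolding r_coset_eq by blast
qed

lemma zero_homology: "\<zero>\<^bsub>homology D ori s i\<^esub> = bnd i"
  by (simp add: homology_def quotient_module_def)

lemma add_homology: "coset i z \<oplus>\<^bsub>homology D ori s i\<^esub> coset i z' = coset i (\<lambda>g. z g + z' g)"
proof -
  have "coset i z \<oplus>\<^bsub>homology D ori s i\<^esub> coset i z' = {\<lambda>g. f g + f' g | f f'. f \<in> coset i z \<and> f' \<in> coset i z'}"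
    unfolding homology_def quotient_module_def submodule_of_def set_add_def set_mult_def
    by (auto simp: CKh_def)
  also have "\<dots> = coset i (\<lambda>g. z g + z' g)"
  proof (intro equalityI subsetI)
    fix h assume "h \<in> {\<lambda>g. f g + f' g | f f'. f \<in> coset i z \<and> f' \<in> coset i z'}"
    then obtain f f' where f: "f \<in> coset i z" "f' \<in> coset i z'" and h: "h = (\<lambda>g. f g + f' g)" by blast
    from bnd_add[OF f[unfolded coset_iff]] show "h \<in> coset i (\<lambda>g. z g + z' g)"
      unfolding coset_iff h by (simp add: algebra_simps)
  next
    fix h assume "h \<in> coset i (\<lambda>g. z g + z' g)"
    then have "(\<lambda>g. h g - z' g) \<in> coset i z" by (simp add: coset_iff diff_diff_eq2 algebra_simps)
    then show "h \<in> {\<lambda>g. f g + f' g | f f'. f \<in> coset i z \<and> f' \<in> coset i z'}"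
      using coset_self[of z' i]
      by (intro CollectI exI[of _ "\<lambda>g. h g - z' g"] exI[of _ z']) simp
  qed
  finally show ?thesis .
qed

lemma smult_homology:
  assumes r: "r \<in> S"
  shows "r \<odot>\<^bsub>homology D ori s i\<^esub> coset i z = coset i (\<lambda>g. r * z g)"
proof -
  have "r \<odot>\<^bsub>homology D ori s i\<^esub> coset i z = (\<Union>f\<in>coset i z. coset i (\<lambda>g. r * f g))"
    by (simp add: homology_def quotient_module_def a_r_coset_def r_coset_eq)
      (simp add: submodule_of_def CKh_def)
  \<comment> \<open>Scalar multiplication in the quotient is a union over all representatives; all
    its members are one and the same coset.\<close>
  moreover have "coset i (\<lambda>g. r * f g) = coset i (\<lambda>g. r * z g)" if f: "f \<in> coset i z" for f
  proof -
    obtain b where b: "b \<in> bnd i" "f = (\<lambda>g. b g + z g)" using f unfolding coset_def by blast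
    have "(\<lambda>g. r * f g - r * z g) = (\<lambda>g. r * b g)" using b by (simp add: algebra_simps)
    then show ?thesis unfolding coset_eq_iff using bnd_scale[OF r b(1)] by simp
  qed
  moreover have "coset i z \<noteq> {}" using coset_self by blast
  ultimately show ?thesis by auto
qed

text \<open>A surviving colouring lives at its only vertex \<open>hi k\<close>, hence in degree
  \<open>card (hi k) - shift\<close>. In degree \<open>i\<close> the coordinates of all other
  colourings are dropped.\<close>

definition embed :: "int \<Rightarrow> (point set \<Rightarrow> K_alpha) \<Rightarrow> nat set \<times> point set \<Rightarrow> K_alpha" where
  "embed i a = (\<lambda>(u, k). if k \<in> surv \<and> u = hi k \<and> int (card u) = i + shift then a k else 0)"

abbreviation "degrees \<equiv> {- shift .. int (card (positive_crossings D ori))}"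

definition basis_map :: "(point set \<Rightarrow> K_alpha) \<Rightarrow> int \<Rightarrow> (generator \<Rightarrow> K_alpha) set" where
  "basis_map a = (\<lambda>i\<in>degrees. coset i (Psi (embed i a)))"

lemma embed_Model:
  assumes "a \<in> surv \<rightarrow>\<^sub>E S"
  shows "embed i a \<in> Model i"
proof (rule ModelI)
  fix u k
  show "embed i a (u, k) \<in> S" using PiE_mem[OF assms, of k] by (simp add: embed_def)
  assume "embed i a (u, k) \<noteq> 0"
  then have u: "k \<in> surv" "u = hi k" "int (card u) = i + shift" by (auto simp: embed_def split: if_splits)
  then have "u \<subseteq> X" using hi_subset by simp
  moreover have "sat u k" using sat_iff[OF \<open>u \<subseteq> X\<close>] u by (simp add: surv_def)
  ultimately show "u \<subseteq> X \<and> int (card u) = i + shift \<and> sat u k" using u by simp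
qed

lemma model_d_embed: "model_d (embed i a) = (\<lambda>g. 0)"
proof
  fix g :: "nat set \<times> point set"
  obtain v k where g: "g = (v, k)" by (cases g)
  show "model_d (embed i a) g = 0"
  proof (cases "k \<in> surv")
    case False
    then show ?thesis unfolding g model_d_def embed_def by auto
  qed (simp add: g model_d_surv)
qed

lemma Psi_embed_cyc: "a \<in> surv \<rightarrow>\<^sub>E S \<Longrightarrow> Psi (embed i a) \<in> cyc i"
  unfolding cyc_iff differential_Psi model_d_embed Psi_zero using Psi_Ch[OF embed_Model] by simp

text \<open>No surviving colouring falls outside the range of degrees over which \<open>Kh\<close>
  is summed, so each contributes to the rank.\<close>

lemma surv_degree:
  assumes "k \<in> surv"
  shows "int (card (hi k)) - shift \<in> degrees"
proof -
  have "positive_crossings D ori \<subseteq> X" by (auto simp: positive_crossings_def crossings_def)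
  then have "card X = card (positive_crossings D ori) + card (negative_crossings D ori)"
    unfolding negative_crossings_def using finite_X
    by (metis card_Diff_subset card_mono finite_subset le_add_diff_inverse)
  moreover have "card (hi k) \<le> card X" by (rule card_mono[OF finite_X hi_subset])
  ultimately show ?thesis by simp
qed

lemma carrier_Kh: "carrier (Kh D ori s) = (\<Pi>\<^sub>E i\<in>degrees. coset i ` cyc i)"
  by (simp add: Kh_def direct_sum_def carrier_homology)

lemma basis_map_inj:
  assumes a: "a \<in> surv \<rightarrow>\<^sub>E S" "a' \<in> surv \<rightarrow>\<^sub>E S" and eq: "basis_map a = basis_map a'"
  shows "a = a'"
proof
  fix k
  show "a k = a' k"
  proof (cases "k \<in> surv")
    case True
    define i where "i = int (card (hi k)) - shift"
    have i: "i \<in> degrees" unfolding i_def by (rule surv_degree[OF True])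
    then have "coset i (Psi (embed i a)) = coset i (Psi (embed i a'))"
      using fun_cong[OF eq, of i] by (simp add: basis_map_def)
    then have "(\<lambda>g. Psi (embed i a) g - Psi (embed i a') g) \<in> bnd i" by (simp add: coset_eq_iff)
    moreover have "(\<lambda>g. Psi (embed i a) g - Psi (embed i a') g) = Psi (\<lambda>g. embed i a g + - 1 * embed i a' g)"
      unfolding Psi_add Psi_scale by simp
    ultimately obtain c where c: "c \<in> Model (i - 1)"
      "Psi (\<lambda>g. embed i a g + - 1 * embed i a' g) = Psi (model_d c)"
      using bnd_Psi by metis
    \<comment> \<open>Boundaries have coordinate \<open>0\<close> at a surviving colouring, so the
      class determines the value at \<open>k\<close>.\<close>
    have "Phi (Psi (\<lambda>g. embed i a g + - 1 * embed i a' g)) (hi k, k) = Phi (Psi (model_d c)) (hi k, k)"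
      unfolding c(2) ..
    moreover have "sat (hi k) k" using sat_iff[OF hi_subset] True by (simp add: surv_def)
    ultimately have "embed i a (hi k, k) - embed i a' (hi k, k) = model_d c (hi k, k)"
      unfolding Phi_Psi using hi_subset by simp
    then show ?thesis using model_d_surv[OF True] True by (simp add: embed_def i_def)
  next
    case False
    then show ?thesis using PiE_arb[OF a(1)] PiE_arb[OF a(2)] by simp
  qed
qed

lemma basis_map_surj:
  assumes F: "F \<in> carrier (Kh D ori s)"
  shows "\<exists>a \<in> surv \<rightarrow>\<^sub>E S. F = basis_map a"
proof -
  have "\<forall>i\<in>degrees. \<exists>z. z \<in> cyc i \<and> F i = coset i z"
    using F unfolding carrier_Kh by (auto simp: PiE_def Pi_def)
  then obtain z where z: "\<And>i. i \<in> degrees \<Longrightarrow> z i \<in> cyc i" "\<And>i. i \<in> degrees \<Longrightarrow> F i = coset i (z i)"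
    by metis
  \<comment> \<open>The coordinate of \<open>k\<close> is read off from the cycle in the degree
    where \<open>k\<close> lives, at the vertex of \<open>k\<close>.\<close>
  define a where "a = (\<lambda>k\<in>surv. Phi (z (int (card (hi k)) - shift)) (hi k, k))"
  have a: "a \<in> surv \<rightarrow>\<^sub>E S"
  proof (rule PiE_I)
    fix k assume k: "k \<in> surv"
    have "z (int (card (hi k)) - shift) \<in> Ch (int (card (hi k)) - shift)"
      using z(1)[OF surv_degree[OF k]] by (simp add: cyc_iff)
    from Model_mem[OF Phi_Model[OF this]] show "a k \<in> S" using k by (simp add: a_def)
  qed (simp add: a_def)
  have "F i = basis_map a i" if i: "i \<in> degrees" for i
  proof -
    have zi: "z i \<in> Ch i" "diff (z i) = (\<lambda>g. 0)" using z(1)[OF i] by (simp_all add: cyc_iff)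
    define c where "c = Phi (z i)"
    have c: "c \<in> Model i" unfolding c_def by (rule Phi_Model[OF zi(1)])
    have zc: "z i = Psi c" unfolding c_def by (rule Psi_Phi_Ch[OF zi(1), symmetric])
    have dc: "model_d c = (\<lambda>g. 0)"
    proof
      fix g :: "nat set \<times> point set"
      obtain v k where g: "g = (v, k)" by (cases g)
      have "Psi (model_d c) = (\<lambda>g. 0)" using zi(2) unfolding zc differential_Psi .
      then have "Phi (Psi (model_d c)) g = 0" by (simp add: Phi_zero)
      then show "model_d c g = 0" unfolding g Phi_Psi by (auto simp: model_d_def split: if_splits)
    qed
    \<comment> \<open>The part of the cycle on surviving colourings is concentrated at their
      vertices \<open>hi k\<close>, so it is the embedding of its coordinates; the rest is a
      boundary.\<close>
    have "c (u, k) = model_d (model_h c) (u, k) + embed i a (u, k)" for u k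
    proof -
      have "(if k \<in> surv then c (u, k) else 0) = embed i a (u, k)"
      proof (cases "k \<in> surv \<and> c (u, k) \<noteq> 0")
        case True
        then have u: "u \<subseteq> X" "int (card u) = i + shift" "sat u k" using Model_nonzero[OF c] by blast+
        then have "u = hi k" using sat_iff[OF u(1)] True by (auto simp: surv_def)
        then show ?thesis using True u by (simp add: embed_def a_def c_def)
      next
        case False
        show ?thesis
        proof (cases "k \<in> surv \<and> u = hi k \<and> int (card u) = i + shift")
          case True
          then have "int (card (hi k)) - shift = i" by auto
          then have "a k = c (u, k)" using True by (simp add: a_def c_def)
          moreover have "embed i a (u, k) = a k" using True unfolding embed_def by auto
          ultimately show ?thesis using True by simp
        qed (use False in \<open>auto simp: embed_def\<close>)
      qed
      then show ?thesis using model_decompose[OF c dc, of u k] by simp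
    qed
    then have c_eq: "c = (\<lambda>g. model_d (model_h c) g + embed i a g)" by (auto simp: fun_eq_iff)
    have "z i = (\<lambda>g. Psi (model_d (model_h c)) g + Psi (embed i a) g)"
      unfolding zc by (subst c_eq) (rule Psi_add)
    then have "(\<lambda>g. z i g - Psi (embed i a) g) = Psi (model_d (model_h c))" by simp
    then have "coset i (z i) = coset i (Psi (embed i a))"
      unfolding coset_eq_iff using Psi_bnd[OF model_h_Model[OF c]] by simp
    then show ?thesis using z(2)[OF i] i by (simp add: basis_map_def)
  qed
  moreover have "F i = basis_map a i" if "i \<notin> degrees" for i
    using F that unfolding carrier_Kh basis_map_def by (auto simp: PiE_def extensional_def)
  ultimately have "F = basis_map a" by blast
  then show ?thesis using a by blast
qed

lemma basis_map_bij: "bij_betw basis_map (surv \<rightarrow>\<^sub>E S) (carrier (Kh D ori s))"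
  unfolding bij_betw_def
proof
  show "inj_on basis_map (surv \<rightarrow>\<^sub>E S)" using basis_map_inj by (rule inj_onI)
  show "basis_map ` (surv \<rightarrow>\<^sub>E S) = carrier (Kh D ori s)"
  proof
    show "basis_map ` (surv \<rightarrow>\<^sub>E S) \<subseteq> carrier (Kh D ori s)"
      unfolding carrier_Kh basis_map_def using Psi_embed_cyc by auto
    show "carrier (Kh D ori s) \<subseteq> basis_map ` (surv \<rightarrow>\<^sub>E S)" using basis_map_surj by blast
  qed
qed

lemma embed_restrict: "embed i (\<lambda>k\<in>surv. h k) = embed i h"
  by (auto simp: embed_def fun_eq_iff)

lemma Kh_free: "free_of_rank R_alphaD (Kh D ori s) (2 ^ card (components D))"
proof (rule free_of_rankI[OF cring_R_alphaD surv_card basis_map_bij])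
  fix x y
  have "embed i (\<lambda>k. x k + y k) = (\<lambda>g. embed i x g + embed i y g)" for i
    by (auto simp: embed_def fun_eq_iff)
  then have "Psi (embed i (\<lambda>k. x k + y k)) = (\<lambda>g. Psi (embed i x) g + Psi (embed i y) g)" for i
    by (simp add: Psi_add)
  then show "basis_map (\<lambda>b\<in>surv. x b \<oplus>\<^bsub>R_alphaD\<^esub> y b) = basis_map x \<oplus>\<^bsub>Kh D ori s\<^esub> basis_map y"
    by (simp add: R_alphaD_def basis_map_def Kh_def direct_sum_def embed_restrict add_homology cong: restrict_cong)
next
  fix r x assume r: "r \<in> S"
  have "embed i (\<lambda>k. r * x k) = (\<lambda>g. r * embed i x g)" for i
    by (auto simp: embed_def fun_eq_iff)
  then have "Psi (embed i (\<lambda>k. r * x k)) = (\<lambda>g. r * Psi (embed i x) g)" for i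
    by (simp add: Psi_scale)
  then show "basis_map (\<lambda>b\<in>surv. r \<otimes>\<^bsub>R_alphaD\<^esub> x b) = r \<odot>\<^bsub>Kh D ori s\<^esub> basis_map x"
    using r by (simp add: R_alphaD_def basis_map_def Kh_def direct_sum_def embed_restrict smult_homology cong: restrict_cong)
next
  have "embed i (\<lambda>k. 0) = (\<lambda>g. 0)" for i
    by (auto simp: embed_def fun_eq_iff)
  then show "basis_map (\<lambda>b\<in>surv. \<zero>\<^bsub>R_alphaD\<^esub>) = \<zero>\<^bsub>Kh D ori s\<^esub>"
    by (simp add: R_alphaD_def basis_map_def Kh_def direct_sum_def embed_restrict Psi_zero coset_zero zero_homology cong: restrict_cong)
qed

end

theorem corollary4p6:
  fixes D :: diagram and ori :: "point \<Rightarrow> bool"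
    and s :: "nat set \<Rightarrow> nat set \<Rightarrow> nat" and k :: nat
  assumes "annular_diagram D" and "orientation D ori"
    and "sign_assignment D s"
    and "card (components D) = k"
  shows "free_of_rank R_alphaD (Kh D ori s) (2 ^ k)"
  using cube_diagram.Kh_free[OF cube_diagram.intro[OF assms(1-3)]] assms(4) by simp

end
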